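(* Let $d\ge 2$, let $\Omega\subset\mathbb R^d$ be a bounded polytopal domain, $\mu>0$, $\lambda>0$, $\iota\in(0,1]$ and $f\in L^2(\Omega;\mathbb R^d)$. A pair $(\Phi,u)\in H^{-1}(\operatorname{div}\operatorname{div},\Omega;\mathbb S\otimes\mathbb R^d)\times H_0^1(\Omega;\mathbb R^d)$ satisfies the distributional mixed formulation $$\iota^{-2}(\widetilde{\mathcal A}\Phi,\Psi)-\langle \operatorname{div}\operatorname{div}\Psi,u\rangle=0\quad\forall\,\Psi\in H^{-1}(\operatorname{div}\operatorname{div},\Omega;\mathbb S\otimes\mathbb R^d),$$ $$-\langle \operatorname{div}\operatorname{div}\Phi,v\rangle-(\sigma(u),\varepsilon(v))=-(f,v)\quad\forall\,v\in H_0^1(\Omega;\mathbb R^d)$$ if and only if $u\in H_0^2(\Omega;\mathbb R^d)$ satisfies $$\iota^2(\operatorname{grad}\sigma(u),\operatorname{grad}\varepsilon(v))+(\sigma(u),\varepsilon(v))=(f,v)\quad\forall\,v\in H_0^2(\Omega;\mathbb R^d)$$ and $\Phi=\iota^2\operatorname{grad}\sigma(u)$. Consequently, the distributional mixed formulation is equivalent to this weak formulation, on $H^2_0(\Omega;\mathbb R^d)$, of the strain gradient elasticity problem $-\operatorname{div}((\boldsymbol I-\iota^2\Delta)\sigma(u))=f$ in $\Omega$, $u=\partial_nu=0$ on $\partial\Omega$.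
   Context: Notation. $\mathbb S$ is the space of symmetric real $d\times d$ matrices, $I$ the identity matrix. $\mathbb S\otimes\mathbb R^d$ is the space of third-order tensors $\Psi=(\Psi_{ijk})$ with $\Psi_{ijk}=\Psi_{jik}$; $(\tau\otimes v)_{ijk}=\tau_{ij}v_k$; the trace of $\Psi$ is the vector $\operatorname{tr}(\Psi)\in\mathbb R^d$ with $\operatorname{tr}(\Psi)_k=\sum_i\Psi_{iik}$. All tensor inner products are Frobenius inner products; $(\cdot,\cdot)$ is the $L^2(\Omega)$ inner product; $\langle\cdot,\cdot\rangle$ is the duality pairing between $H^{-1}(\Omega;\mathbb R^d)$ and $H^1_0(\Omega;\mathbb R^d)$. $H_0^m(\Omega)$ is the closure of $C_0^\infty(\Omega)$ in $H^m(\Omega)$. Differential operators: $\varepsilon_{ij}(v)=\tfrac12(\partial_jv_i+\partial_iv_j)$, $\sigma(v)=2\mu\,\varepsilon(v)+\lambda(\operatorname{div}v)I$, $(\operatorname{grad}\tau)_{ijk}=\partial_k\tau_{ij}$ and $(\operatorname{div}\tau)_i=\sum_j\partial_j\tau_{ij}$ for second-order tensors, $(\operatorname{div}\Psi)_{ij}=\sum_k\partial_k\Psi_{ijk}$ for third-order tensors (in the distributional sense). Compliance tensor: $\widetilde{\mathcal A}\Psi=\frac1{2\mu}\big(\Psi-\frac{\lambda}{2\mu+d\lambda}I\otimes\operatorname{tr}(\Psi)\big)$. Space: $H^{-1}(\operatorname{div}\operatorname{div},\Omega;\mathbb S\otimes\mathbb R^d)=\{\Psi\in L^2(\Omega;\mathbb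 S\otimes\mathbb R^d):\operatorname{div}\operatorname{div}\Psi\in H^{-1}(\Omega;\mathbb R^d)\}$. *)

theory Defs
  imports "HOL-Analysis.Analysis"
begin

text \<open>
  The dimension \<open>d\<close> is \<open>CARD('n)\<close>. A second-order tensor field has values \<open>\<tau> x $ i $ j\<close>, a
  third-order one \<open>\<Psi> x $ i $ j $ k\<close>; the library inner product on these iterated vector types is
  the Frobenius product. Elements of \<open>L\<^sup>2(\<Omega>)\<close> and of Sobolev spaces are represented by functions on
  the whole space, whose values outside \<open>\<Omega>\<close> are irrelevant; they are identified when
  they agree almost everywhere in \<open>\<Omega>\<close>.
\<close>

type_synonym 'n scalar_field = "real ^ 'n \<Rightarrow> real"
type_synonym 'n vector_field = "real ^ 'n \<Rightarrow> real ^ 'n"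
type_synonym 'n tensor2_field = "real ^ 'n \<Rightarrow> real ^ 'n ^ 'n"
type_synonym 'n tensor3_field = "real ^ 'n \<Rightarrow> real ^ 'n ^ 'n ^ 'n"

text \<open>Only the values of a distribution at test functions matter.\<close>

type_synonym 'n distribution = "'n scalar_field \<Rightarrow> real"


section \<open>Domains\<close>

text \<open>
  A bounded polytopal domain: the boundary consists of finitely many flat pieces, each a polytope
  of dimension \<open>d - 1\<close>. Neither convexity nor the Lipschitz property is required.
\<close>

definition bounded_polytopal_domain :: "(real ^ 'n) set \<Rightarrow> bool" where
  "bounded_polytopal_domain \<Omega> \<longleftrightarrow>
     open \<Omega> \<and> connected \<Omega> \<and> \<Omega> \<noteq> {} \<and> bounded \<Omega> \<and>
     (\<exists>F. finite F \<and> (\<forall>P\<in>F. polytope P \<and> aff_dim P = int CARD('n) - 1) \<and> frontier \<Omega> = \<Union>F)"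


section \<open>Square integrable functions\<close>

definition L2_space :: "(real ^ 'n) set \<Rightarrow> (real ^ 'n \<Rightarrow> 'b::euclidean_space) set" where
  "L2_space \<Omega> = {f. f \<in> borel_measurable (lebesgue_on \<Omega>) \<and>
                    integrable (lebesgue_on \<Omega>) (\<lambda>x. (norm (f x))\<^sup>2)}"

definition L2_inner ::
    "(real ^ 'n) set \<Rightarrow> (real ^ 'n \<Rightarrow> 'b::euclidean_space) \<Rightarrow> (real ^ 'n \<Rightarrow> 'b) \<Rightarrow> real" where
  "L2_inner \<Omega> f g = (\<integral>x. f x \<bullet> g x \<partial>lebesgue_on \<Omega>)"

definition locally_integrable :: "(real ^ 'n) set \<Rightarrow> 'n scalar_field \<Rightarrow> bool" where
  "locally_integrable \<Omega> f \<longleftrightarrow> (\<forall>K. compact K \<and> K \<subseteq> \<Omega> \<longrightarrow> integrable (lebesgue_on K) f)"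


section \<open>Test functions and distributions\<close>

definition classical_partial :: "'n \<Rightarrow> 'n scalar_field \<Rightarrow> ('n::finite) scalar_field" where
  "classical_partial i \<phi> = (\<lambda>x. frechet_derivative \<phi> (at x) (axis i 1))"

definition smooth :: "('n::finite) scalar_field \<Rightarrow> bool" where
  "smooth \<phi> \<longleftrightarrow> (\<forall>is. foldr classical_partial is \<phi> differentiable_on UNIV)"

definition test_functions :: "(real ^ 'n) set \<Rightarrow> ('n::finite) scalar_field set" where
  "test_functions \<Omega> =
     {\<phi>. smooth \<phi> \<and> compact (closure {x. \<phi> x \<noteq> 0}) \<and> closure {x. \<phi> x \<noteq> 0} \<subseteq> \<Omega>}"

definition test_vector_fields :: "(real ^ 'n) set \<Rightarrow> ('n::finite) vector_field set" where
  "test_vector_fields \<Omega> = {\<phi>. \<forall>i. (\<lambda>x. \<phi> x $ i) \<in> test_functions \<Omega>}"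

definition distr :: "(real ^ 'n) set \<Rightarrow> 'n scalar_field \<Rightarrow> ('n::finite) distribution" where
  "distr \<Omega> f = (\<lambda>\<phi>. \<integral>x. f x * \<phi> x \<partial>lebesgue_on \<Omega>)"

definition distr_partial :: "'n \<Rightarrow> 'n distribution \<Rightarrow> ('n::finite) distribution" where
  "distr_partial i T = (\<lambda>\<phi>. - T (classical_partial i \<phi>))"

definition distr_laplacian :: "'n distribution \<Rightarrow> ('n::finite) distribution" where
  "distr_laplacian T = (\<lambda>\<phi>. \<Sum>k\<in>UNIV. distr_partial k (distr_partial k T) \<phi>)"

definition distr_div2 :: "('n \<Rightarrow> 'n \<Rightarrow> 'n distribution) \<Rightarrow> 'n \<Rightarrow> ('n::finite) distribution" where
  "distr_div2 T i = (\<lambda>\<phi>. \<Sum>j\<in>UNIV. distr_partial j (T i j) \<phi>)"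

definition distr_div3 ::
    "('n \<Rightarrow> 'n \<Rightarrow> 'n \<Rightarrow> 'n distribution) \<Rightarrow> 'n \<Rightarrow> 'n \<Rightarrow> ('n::finite) distribution" where
  "distr_div3 T i j = (\<lambda>\<phi>. \<Sum>k\<in>UNIV. distr_partial k (T i j k) \<phi>)"

definition div_div :: "(real ^ 'n) set \<Rightarrow> 'n tensor3_field \<Rightarrow> 'n \<Rightarrow> ('n::finite) distribution" where
  "div_div \<Omega> \<Psi> = distr_div2 (distr_div3 (\<lambda>i j k. distr \<Omega> (\<lambda>x. \<Psi> x $ i $ j $ k)))"


section \<open>Weak derivatives and Sobolev spaces\<close>

text \<open>
  A multi-index is represented by the list of directions in which one differentiates.
\<close>

definition has_weak_deriv ::
    "(real ^ 'n) set \<Rightarrow> 'n list \<Rightarrow> 'n scalar_field \<Rightarrow> ('n::finite) scalar_field \<Rightarrow> bool" where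
  "has_weak_deriv \<Omega> is f g \<longleftrightarrow>
     locally_integrable \<Omega> f \<and> locally_integrable \<Omega> g \<and>
     (\<forall>\<phi>\<in>test_functions \<Omega>. foldr distr_partial is (distr \<Omega> f) \<phi> = distr \<Omega> g \<phi>)"

text \<open>The weak derivative, if it exists, is unique only up to a null set.\<close>

definition weak_deriv ::
    "(real ^ 'n) set \<Rightarrow> 'n list \<Rightarrow> 'n scalar_field \<Rightarrow> ('n::finite) scalar_field" where
  "weak_deriv \<Omega> is f = (SOME g. has_weak_deriv \<Omega> is f g)"

definition sobolev :: "nat \<Rightarrow> (real ^ 'n) set \<Rightarrow> ('n::finite) scalar_field set" where
  "sobolev m \<Omega> = {f. \<forall>is. length is \<le> m \<longrightarrow> (\<exists>g\<in>L2_space \<Omega>. has_weak_deriv \<Omega> is f g)}"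

text \<open>
  Summing over lists instead of multi-indices counts a mixed derivative once for each order of
  differentiation, so the terms of order \<open>k\<close> add up to the squared Frobenius norm of the tensor of
  all \<open>k\<close>-th derivatives.
\<close>

definition sobolev_norm :: "nat \<Rightarrow> (real ^ 'n) set \<Rightarrow> ('n::finite) scalar_field \<Rightarrow> real" where
  "sobolev_norm m \<Omega> f =
     sqrt (\<Sum>is | length is \<le> m. L2_inner \<Omega> (weak_deriv \<Omega> is f) (weak_deriv \<Omega> is f))"

definition sobolev0 :: "nat \<Rightarrow> (real ^ 'n) set \<Rightarrow> ('n::finite) scalar_field set" where
  "sobolev0 m \<Omega> =
     {f \<in> sobolev m \<Omega>. \<forall>e>0. \<exists>\<phi>\<in>test_functions \<Omega>. sobolev_norm m \<Omega> (\<lambda>x. f x - \<phi> x) < e}"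

definition sobolev0_vec :: "nat \<Rightarrow> (real ^ 'n) set \<Rightarrow> ('n::finite) vector_field set" where
  "sobolev0_vec m \<Omega> = {v. \<forall>i. (\<lambda>x. v x $ i) \<in> sobolev0 m \<Omega>}"

definition sobolev_norm_vec :: "nat \<Rightarrow> (real ^ 'n) set \<Rightarrow> ('n::finite) vector_field \<Rightarrow> real" where
  "sobolev_norm_vec m \<Omega> v = sqrt (\<Sum>i\<in>UNIV. (sobolev_norm m \<Omega> (\<lambda>x. v x $ i))\<^sup>2)"

text \<open>
  \<open>H\<^sup>-\<^sup>1(\<Omega>; R\<^sup>d)\<close>: the bounded linear functionals on \<open>H\<^sub>0\<^sup>1(\<Omega>; R\<^sup>d)\<close>. Boundedness forces them to
  respect almost everywhere equality.
\<close>

definition H_minus1 :: "(real ^ 'n) set \<Rightarrow> (('n::finite) vector_field \<Rightarrow> real) set" where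
  "H_minus1 \<Omega> = {F.
     (\<forall>v\<in>sobolev0_vec 1 \<Omega>. \<forall>w\<in>sobolev0_vec 1 \<Omega>. F (\<lambda>x. v x + w x) = F v + F w) \<and>
     (\<forall>c. \<forall>v\<in>sobolev0_vec 1 \<Omega>. F (\<lambda>x. c *\<^sub>R v x) = c * F v) \<and>
     (\<exists>C. \<forall>v\<in>sobolev0_vec 1 \<Omega>. \<bar>F v\<bar> \<le> C * sobolev_norm_vec 1 \<Omega> v)}"

text \<open>
  A vector-valued distribution belongs to \<open>H\<^sup>-\<^sup>1\<close> iff it is the restriction to test vector fields of
  such a functional, which is then unique on \<open>H\<^sub>0\<^sup>1\<close> by density.
\<close>

definition extends_distr ::
    "(real ^ 'n) set \<Rightarrow> ('n \<Rightarrow> 'n distribution) \<Rightarrow> (('n::finite) vector_field \<Rightarrow> real) \<Rightarrow> bool" where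
  "extends_distr \<Omega> T F \<longleftrightarrow>
     F \<in> H_minus1 \<Omega> \<and> (\<forall>\<phi>\<in>test_vector_fields \<Omega>. F \<phi> = (\<Sum>i\<in>UNIV. T i (\<lambda>x. \<phi> x $ i)))"

definition in_H_minus1 :: "(real ^ 'n) set \<Rightarrow> ('n \<Rightarrow> ('n::finite) distribution) \<Rightarrow> bool" where
  "in_H_minus1 \<Omega> T \<longleftrightarrow> (\<exists>F. extends_distr \<Omega> T F)"

definition duality_pairing ::
    "(real ^ 'n) set \<Rightarrow> ('n \<Rightarrow> 'n distribution) \<Rightarrow> ('n::finite) vector_field \<Rightarrow> real" where
  "duality_pairing \<Omega> T v = (SOME F. extends_distr \<Omega> T F) v"

definition H_minus1_div_div :: "(real ^ 'n) set \<Rightarrow> ('n::finite) tensor3_field set" where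
  "H_minus1_div_div \<Omega> = {\<Psi> \<in> L2_space \<Omega>.
     (AE x in lebesgue_on \<Omega>. \<forall>i j k. \<Psi> x $ i $ j $ k = \<Psi> x $ j $ i $ k) \<and>
     in_H_minus1 \<Omega> (div_div \<Omega> \<Psi>)}"


section \<open>Linear elasticity\<close>

definition strain :: "(real ^ 'n) set \<Rightarrow> 'n vector_field \<Rightarrow> ('n::finite) tensor2_field" where
  "strain \<Omega> v = (\<lambda>x. \<chi> i j.
     (weak_deriv \<Omega> [j] (\<lambda>y. v y $ i) x + weak_deriv \<Omega> [i] (\<lambda>y. v y $ j) x) / 2)"

definition divergence :: "(real ^ 'n) set \<Rightarrow> 'n vector_field \<Rightarrow> ('n::finite) scalar_field" where
  "divergence \<Omega> v = (\<lambda>x. \<Sum>i\<in>UNIV. weak_deriv \<Omega> [i] (\<lambda>y. v y $ i) x)"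

definition stress ::
    "(real ^ 'n) set \<Rightarrow> real \<Rightarrow> real \<Rightarrow> 'n vector_field \<Rightarrow> ('n::finite) tensor2_field" where
  "stress \<Omega> \<mu> lam v = (\<lambda>x. (2 * \<mu>) *\<^sub>R strain \<Omega> v x + (lam * divergence \<Omega> v x) *\<^sub>R mat 1)"

definition grad :: "(real ^ 'n) set \<Rightarrow> 'n tensor2_field \<Rightarrow> ('n::finite) tensor3_field" where
  "grad \<Omega> \<tau> = (\<lambda>x. \<chi> i j k. weak_deriv \<Omega> [k] (\<lambda>y. \<tau> y $ i $ j) x)"

definition tensor_prod :: "real ^ 'n ^ 'n \<Rightarrow> real ^ 'n \<Rightarrow> real ^ 'n ^ 'n ^ ('n::finite)" where
  "tensor_prod \<tau> v = (\<chi> i j k. \<tau> $ i $ j * v $ k)"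

definition trace3 :: "real ^ 'n ^ 'n ^ 'n \<Rightarrow> real ^ ('n::finite)" where
  "trace3 \<Psi> = (\<chi> k. \<Sum>i\<in>UNIV. \<Psi> $ i $ i $ k)"

definition compliance ::
    "real \<Rightarrow> real \<Rightarrow> real ^ 'n ^ 'n ^ 'n \<Rightarrow> real ^ 'n ^ 'n ^ ('n::finite)" where
  "compliance \<mu> lam \<Psi> =
     (1 / (2 * \<mu>)) *\<^sub>R (\<Psi> - (lam / (2 * \<mu> + real CARD('n) * lam)) *\<^sub>R tensor_prod (mat 1) (trace3 \<Psi>))"

definition mixed_formulation ::
    "(real ^ 'n) set \<Rightarrow> real \<Rightarrow> real \<Rightarrow> real \<Rightarrow> 'n vector_field
      \<Rightarrow> 'n tensor3_field \<Rightarrow> ('n::finite) vector_field \<Rightarrow> bool" where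
  "mixed_formulation \<Omega> \<mu> lam \<iota> f \<Phi> u \<longleftrightarrow>
     \<Phi> \<in> H_minus1_div_div \<Omega> \<and> u \<in> sobolev0_vec 1 \<Omega> \<and>
     (\<forall>\<Psi>\<in>H_minus1_div_div \<Omega>.
        (1 / \<iota>\<^sup>2) * L2_inner \<Omega> (\<lambda>x. compliance \<mu> lam (\<Phi> x)) \<Psi>
          - duality_pairing \<Omega> (div_div \<Omega> \<Psi>) u = 0) \<and>
     (\<forall>v\<in>sobolev0_vec 1 \<Omega>.
        - duality_pairing \<Omega> (div_div \<Omega> \<Phi>) v - L2_inner \<Omega> (stress \<Omega> \<mu> lam u) (strain \<Omega> v)
          = - L2_inner \<Omega> f v)"

definition weak_formulation ::
    "(real ^ 'n) set \<Rightarrow> real \<Rightarrow> real \<Rightarrow> real \<Rightarrow> 'n vector_field \<Rightarrow> ('n::finite) vector_field \<Rightarrow> bool" where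
  "weak_formulation \<Omega> \<mu> lam \<iota> f u \<longleftrightarrow>
     u \<in> sobolev0_vec 2 \<Omega> \<and>
     (\<forall>v\<in>sobolev0_vec 2 \<Omega>.
        \<iota>\<^sup>2 * L2_inner \<Omega> (grad \<Omega> (stress \<Omega> \<mu> lam u)) (grad \<Omega> (strain \<Omega> v))
          + L2_inner \<Omega> (stress \<Omega> \<mu> lam u) (strain \<Omega> v) = L2_inner \<Omega> f v)"

text \<open>
  The boundary value problem \<open>- div ((I - \<iota>\<^sup>2 \<Delta>) \<sigma>(u)) = f\<close> in \<open>\<Omega>\<close>, \<open>u = \<partial>\<^sub>n u = 0\<close> on \<open>\<partial>\<Omega>\<close>: the
  equation is read in the sense of distributions, the boundary conditions as \<open>u \<in> H\<^sub>0\<^sup>2\<close>.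
\<close>

definition strain_gradient_problem ::
    "(real ^ 'n) set \<Rightarrow> real \<Rightarrow> real \<Rightarrow> real \<Rightarrow> 'n vector_field \<Rightarrow> ('n::finite) vector_field \<Rightarrow> bool" where
  "strain_gradient_problem \<Omega> \<mu> lam \<iota> f u \<longleftrightarrow>
     u \<in> sobolev0_vec 2 \<Omega> \<and>
     (let S = (\<lambda>i j. distr \<Omega> (\<lambda>x. stress \<Omega> \<mu> lam u x $ i $ j)) in
      \<forall>i. \<forall>\<phi>\<in>test_functions \<Omega>.
        - distr_div2 (\<lambda>i j \<psi>. S i j \<psi> - \<iota>\<^sup>2 * distr_laplacian (S i j) \<psi>) i \<phi>
          = distr \<Omega> (\<lambda>x. f x $ i) \<phi>)"

end

theory Submission
  imports Defs
begin

text \<open>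
  That a solution \<open>(\<Phi>, u)\<close> of the mixed formulation has a displacement \<open>u\<close> in \<open>H\<^sub>0\<^sup>2\<close>, rather than only in
  \<open>H\<^sub>0\<^sup>1\<close>, is not proved by studying traces of \<open>u\<close> on the boundary. It follows from two facts about
  solutions.

  Existence: the weak formulation has a solution \<open>w\<close> in \<open>H\<^sub>0\<^sup>2\<close> (\<open>weak_solution_exists\<close>). The energy
  \<open>\<iota>\<^sup>2 (grad \<sigma>(v), grad \<epsilon>(v)) + (\<sigma>(v), \<epsilon>(v))\<close> controls the full \<open>H\<^sup>2\<close>-norm on test fields, by the inequality
  of Friedrichs and by Korn's first inequality applied to the field and to its partial derivatives
  (\<open>korn_H2_test\<close>). A sequence of test fields that minimises the energy minus the load is therefore
  Cauchy in \<open>H\<^sup>2\<close> (\<open>minimising_sequence\<close>), and its limit is \<open>w\<close>.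

  Uniqueness: the mixed formulation has at most one solution (\<open>mixed_unique\<close>). Let \<open>D\<close> and \<open>e\<close> be the
  differences of the two components of two solutions. Testing the first equations with \<open>D\<close> and the
  second ones with \<open>e\<close>, all duality pairings cancel, and what is left is that the sum of the two
  nonnegative terms \<open>\<iota>\<^sup>-\<^sup>2 (A D, D)\<close>, with \<open>A\<close> the compliance tensor, and \<open>(\<sigma>(e), \<epsilon>(e))\<close> vanishes. The
  compliance tensor is positive definite, and \<open>\<epsilon>(e) = 0\<close> implies \<open>e = 0\<close> by Korn's inequality in \<open>H\<^sub>0\<^sup>1\<close>.

  The link between the formulations is that the double divergence is adjoint to \<open>grad \<epsilon>\<close>: for a
  symmetric \<open>\<Psi>\<close> with \<open>div div \<Psi>\<close> in \<open>H\<^sup>-\<^sup>1\<close> and for \<open>w\<close> in \<open>H\<^sub>0\<^sup>2\<close>, the pairing of \<open>div div \<Psi>\<close> with \<open>w\<close> is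
  \<open>(\<Psi>, grad \<epsilon>(w))\<close>. This holds by definition for test fields and extends by density
  (\<open>duality_pairing_strain_grad\<close>). Since the compliance tensor inverts the elasticity tensor, a weak
  solution \<open>w\<close> together with \<open>\<Phi> = \<iota>\<^sup>2 grad \<sigma>(w)\<close> solves the mixed formulation (\<open>weak_imp_mixed\<close>). By
  uniqueness every mixed solution arises in this way (\<open>mixed_imp_weak\<close>). The boundary value problem is
  the weak formulation tested with smooth fields, after integration by parts.

  Weak derivatives are chosen only up to null sets, so all of this rests on their uniqueness, that is,
  on the fundamental lemma of the calculus of variations and on a supply of bump functions.
\<close>

section \<open>Square integrable functions\<close>

lemma L2_spaceD:
  assumes "f \<in> L2_space \<Omega>"
  shows "f \<in> borel_measurable (lebesgue_on \<Omega>)" "integrable (lebesgue_on \<Omega>) (\<lambda>x. (norm (f x))\<^sup>2)"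
  using assms by (auto simp: L2_space_def)

abbreviation L2_sq :: "(real ^ 'n) set \<Rightarrow> (real ^ 'n \<Rightarrow> 'b::euclidean_space) \<Rightarrow> real" where
  "L2_sq \<Omega> f \<equiv> L2_inner \<Omega> f f"

lemma L2_space_dominated:
  assumes "f \<in> borel_measurable (lebesgue_on \<Omega>)" "integrable (lebesgue_on \<Omega>) g"
    and "\<And>x. (norm (f x))\<^sup>2 \<le> g x"
  shows "f \<in> L2_space \<Omega>"
proof -
  have "norm ((norm (f x))\<^sup>2) \<le> norm (g x)" for x
    using assms(3)[of x] zero_le_power2[of "norm (f x)"] by auto
  then show ?thesis
    unfolding L2_space_def using assms(1)
    by (auto intro!: Bochner_Integration.integrable_bound[OF assms(2)])
qed

lemma L2_integrable_inner:
  assumes f: "f \<in> L2_space \<Omega>" and g: "g \<in> L2_space \<Omega>"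
  shows "integrable (lebesgue_on \<Omega>) (\<lambda>x. f x \<bullet> g x)"
proof (rule Bochner_Integration.integrable_bound)
  show "integrable (lebesgue_on \<Omega>) (\<lambda>x. (norm (f x))\<^sup>2 + (norm (g x))\<^sup>2)"
    using L2_spaceD[OF f] L2_spaceD[OF g] by auto
  show "(\<lambda>x. f x \<bullet> g x) \<in> borel_measurable (lebesgue_on \<Omega>)"
    using L2_spaceD[OF f] L2_spaceD[OF g] by auto
  show "AE x in lebesgue_on \<Omega>. norm (f x \<bullet> g x) \<le> norm ((norm (f x))\<^sup>2 + (norm (g x))\<^sup>2)"
  proof (rule AE_I2)
    fix x
    have "2 * (norm (f x) * norm (g x)) \<le> (norm (f x))\<^sup>2 + (norm (g x))\<^sup>2"
      using sum_squares_bound[of "norm (f x)" "norm (g x)"] by simp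
    moreover have "norm (f x \<bullet> g x) \<le> norm (f x) * norm (g x)"
      using Cauchy_Schwarz_ineq2 by simp
    moreover have "0 \<le> norm (f x) * norm (g x)" by simp
    ultimately show "norm (f x \<bullet> g x) \<le> norm ((norm (f x))\<^sup>2 + (norm (g x))\<^sup>2)"
      unfolding real_norm_def by linarith
  qed
qed

lemma L2_zero [simp]: "(\<lambda>x. 0) \<in> L2_space \<Omega>"
  by (simp add: L2_space_def)

lemma L2_scaleR:
  assumes "f \<in> L2_space \<Omega>"
  shows "(\<lambda>x. c *\<^sub>R f x) \<in> L2_space \<Omega>"
  using L2_spaceD[OF assms] by (auto simp: L2_space_def power_mult_distrib)

lemma L2_cmult:
  fixes f :: "('n::finite) scalar_field"
  shows "f \<in> L2_space \<Omega> \<Longrightarrow> (\<lambda>x. c * f x) \<in> L2_space \<Omega>"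
  using L2_scaleR[of f \<Omega> c] by simp

lemma L2_add:
  assumes f: "f \<in> L2_space \<Omega>" and g: "g \<in> L2_space \<Omega>"
  shows "(\<lambda>x. f x + g x) \<in> L2_space \<Omega>"
proof (rule L2_space_dominated)
  show "(\<lambda>x. f x + g x) \<in> borel_measurable (lebesgue_on \<Omega>)"
    using L2_spaceD[OF f] L2_spaceD[OF g] by auto
  show "integrable (lebesgue_on \<Omega>) (\<lambda>x. 2 * (norm (f x))\<^sup>2 + 2 * (norm (g x))\<^sup>2)"
    using L2_spaceD[OF f] L2_spaceD[OF g] by auto
  show "(norm (f x + g x))\<^sup>2 \<le> 2 * (norm (f x))\<^sup>2 + 2 * (norm (g x))\<^sup>2" for x
  proof -
    have "(norm (f x + g x))\<^sup>2 \<le> (norm (f x) + norm (g x))\<^sup>2"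
      by (simp add: norm_triangle_ineq power_mono)
    also have "\<dots> \<le> 2 * (norm (f x))\<^sup>2 + 2 * (norm (g x))\<^sup>2"
      using sum_squares_bound[of "norm (f x)" "norm (g x)"] by (simp add: power2_sum)
    finally show ?thesis .
  qed
qed

lemma L2_diff:
  assumes "f \<in> L2_space \<Omega>" "g \<in> L2_space \<Omega>"
  shows "(\<lambda>x. f x - g x) \<in> L2_space \<Omega>"
  using L2_add[OF assms(1) L2_scaleR[OF assms(2), of "-1"]] by simp

lemma L2_sum:
  "(\<And>i. i \<in> A \<Longrightarrow> F i \<in> L2_space \<Omega>) \<Longrightarrow> (\<lambda>x. \<Sum>i\<in>A. F i x) \<in> L2_space \<Omega>"
  by (induction A rule: infinite_finite_induct) (auto intro: L2_add)

lemma L2_inner_commute: "L2_inner \<Omega> f g = L2_inner \<Omega> g f"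
  by (simp add: L2_inner_def inner_commute)

lemma L2_inner_cong_AE:
  assumes "f \<in> L2_space \<Omega>" "f' \<in> L2_space \<Omega>" "g \<in> L2_space \<Omega>" "g' \<in> L2_space \<Omega>"
    and "AE x in lebesgue_on \<Omega>. f x = f' x" "AE x in lebesgue_on \<Omega>. g x = g' x"
  shows "L2_inner \<Omega> f g = L2_inner \<Omega> f' g'"
  unfolding L2_inner_def
proof (rule integral_cong_AE)
  show "AE x in lebesgue_on \<Omega>. f x \<bullet> g x = f' x \<bullet> g' x"
    using assms(5,6) by eventually_elim simp
qed (use L2_integrable_inner assms borel_measurable_integrable in blast)+

lemma L2_inner_add_left:
  assumes "f \<in> L2_space \<Omega>" "g \<in> L2_space \<Omega>" "h \<in> L2_space \<Omega>"
  shows "L2_inner \<Omega> (\<lambda>x. f x + g x) h = L2_inner \<Omega> f h + L2_inner \<Omega> g h"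
  using assms by (simp add: L2_inner_def inner_add_left L2_integrable_inner)

lemma L2_inner_add_right:
  assumes "f \<in> L2_space \<Omega>" "g \<in> L2_space \<Omega>" "h \<in> L2_space \<Omega>"
  shows "L2_inner \<Omega> h (\<lambda>x. f x + g x) = L2_inner \<Omega> h f + L2_inner \<Omega> h g"
  using assms by (simp add: L2_inner_def inner_add_right L2_integrable_inner)

lemma L2_inner_diff_left:
  assumes "f \<in> L2_space \<Omega>" "g \<in> L2_space \<Omega>" "h \<in> L2_space \<Omega>"
  shows "L2_inner \<Omega> (\<lambda>x. f x - g x) h = L2_inner \<Omega> f h - L2_inner \<Omega> g h"
  using assms by (simp add: L2_inner_def inner_diff_left L2_integrable_inner)

lemma L2_inner_diff_right:
  assumes "f \<in> L2_space \<Omega>" "g \<in> L2_space \<Omega>" "h \<in> L2_space \<Omega>"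
  shows "L2_inner \<Omega> h (\<lambda>x. f x - g x) = L2_inner \<Omega> h f - L2_inner \<Omega> h g"
  using assms by (simp add: L2_inner_def inner_diff_right L2_integrable_inner)

lemma L2_inner_scaleR_left: "L2_inner \<Omega> (\<lambda>x. c *\<^sub>R f x) g = c * L2_inner \<Omega> f g"
  by (simp add: L2_inner_def)

lemma L2_inner_scaleR_right: "L2_inner \<Omega> f (\<lambda>x. c *\<^sub>R g x) = c * L2_inner \<Omega> f g"
  by (simp add: L2_inner_def)

lemma L2_inner_cmult_left:
  fixes f :: "('n::finite) scalar_field"
  shows "L2_inner \<Omega> (\<lambda>x. c * f x) g = c * L2_inner \<Omega> f g"
  using L2_inner_scaleR_left[of \<Omega> c f g] by simp

lemma L2_inner_cmult_right:
  fixes f :: "('n::finite) scalar_field"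
  shows "L2_inner \<Omega> f (\<lambda>x. c * g x) = c * L2_inner \<Omega> f g"
  using L2_inner_scaleR_right[of \<Omega> f c g] by simp

lemma L2_inner_axpy_AE:
  assumes "h \<in> L2_space \<Omega>" "f \<in> L2_space \<Omega>" "g \<in> L2_space \<Omega>" "k \<in> L2_space \<Omega>"
    and "AE x in lebesgue_on \<Omega>. h x = f x + c *\<^sub>R g x"
  shows "L2_inner \<Omega> h k = L2_inner \<Omega> f k + c * L2_inner \<Omega> g k"
proof -
  have "L2_inner \<Omega> h k = L2_inner \<Omega> (\<lambda>x. f x + c *\<^sub>R g x) k"
    by (rule L2_inner_cong_AE) (use assms in \<open>auto intro: L2_add L2_scaleR\<close>)
  then show ?thesis using assms by (simp add: L2_inner_add_left L2_scaleR L2_inner_scaleR_left)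
qed

lemma L2_inner_sum_left:
  assumes "\<And>i. i \<in> A \<Longrightarrow> F i \<in> L2_space \<Omega>" "h \<in> L2_space \<Omega>"
  shows "L2_inner \<Omega> (\<lambda>x. \<Sum>i\<in>A. F i x) h = (\<Sum>i\<in>A. L2_inner \<Omega> (F i) h)"
  using assms by (simp add: L2_inner_def inner_sum_left L2_integrable_inner)

lemma L2_inner_self_nonneg: "0 \<le> L2_sq \<Omega> f"
  by (simp add: L2_inner_def)

lemma L2_inner_self_eq_0D:
  assumes "f \<in> L2_space \<Omega>" "L2_sq \<Omega> f = 0"
  shows "AE x in lebesgue_on \<Omega>. f x = 0"
  using assms integral_nonneg_eq_0_iff_AE[OF L2_integrable_inner[OF assms(1,1)]]
  by (simp add: L2_inner_def)

lemma L2_inner_mono: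
  assumes "f \<in> L2_space \<Omega>" "f' \<in> L2_space \<Omega>" "g \<in> L2_space \<Omega>" "g' \<in> L2_space \<Omega>"
    and "AE x in lebesgue_on \<Omega>. f x \<bullet> g x \<le> f' x \<bullet> g' x"
  shows "L2_inner \<Omega> f g \<le> L2_inner \<Omega> f' g'"
  unfolding L2_inner_def
  by (rule integral_mono_AE) (use L2_integrable_inner assms in blast)+

lemma discriminant_le:
  fixes A B C :: real
  assumes "\<And>t. 0 \<le> A + 2 * t * B + t\<^sup>2 * C" and "0 \<le> C"
  shows "B\<^sup>2 \<le> A * C"
proof (cases "C = 0")
  case True
  have "B = 0"
  proof (rule ccontr)
    assume "B \<noteq> 0"
    then show False
      using assms(1)[of "- (A + 1) / (2 * B)"] True by (simp add: field_simps)
  qed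
  then show ?thesis using True by simp
next
  case False
  then have "C > 0" using assms(2) by simp
  have "0 \<le> A + 2 * (- B / C) * B + (- B / C)\<^sup>2 * C" by (rule assms(1))
  also have "\<dots> = A - B\<^sup>2 / C"
    using \<open>C > 0\<close> by (simp add: field_simps power2_eq_square)
  finally show ?thesis using \<open>C > 0\<close> by (simp add: field_simps)
qed

lemma L2_inner_line:
  assumes f: "f \<in> L2_space \<Omega>" and g: "g \<in> L2_space \<Omega>"
  shows "L2_sq \<Omega> (\<lambda>x. f x + t *\<^sub>R g x)
         = L2_sq \<Omega> f + 2 * t * L2_inner \<Omega> f g + t\<^sup>2 * L2_sq \<Omega> g"
  using f g L2_scaleR[OF g, of t]
  by (simp add: L2_inner_add_left L2_inner_add_right L2_add L2_inner_scaleR_left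
        L2_inner_scaleR_right L2_inner_commute[of \<Omega> g f] power2_eq_square algebra_simps)

lemma L2_Cauchy_Schwarz:
  assumes "f \<in> L2_space \<Omega>" "g \<in> L2_space \<Omega>"
  shows "(L2_inner \<Omega> f g)\<^sup>2 \<le> L2_sq \<Omega> f * L2_sq \<Omega> g"
proof (rule discriminant_le)
  show "0 \<le> L2_sq \<Omega> f + 2 * t * L2_inner \<Omega> f g + t\<^sup>2 * L2_sq \<Omega> g" for t
    unfolding L2_inner_line[OF assms, symmetric] by (rule L2_inner_self_nonneg)
qed (rule L2_inner_self_nonneg)

definition L2_tendsto :: "(real ^ 'n) set \<Rightarrow> (nat \<Rightarrow> real ^ 'n \<Rightarrow> 'b::euclidean_space) \<Rightarrow> (real ^ 'n \<Rightarrow> 'b) \<Rightarrow> bool" where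
  "L2_tendsto \<Omega> F f \<longleftrightarrow> (\<forall>n. F n \<in> L2_space \<Omega>) \<and> f \<in> L2_space \<Omega> \<and>
     (\<lambda>n. L2_sq \<Omega> (\<lambda>x. F n x - f x)) \<longlonglongrightarrow> 0"

lemma tendsto_0_of_square_le:
  fixes x a :: "nat \<Rightarrow> real"
  assumes "\<And>n. (x n)\<^sup>2 \<le> a n" "a \<longlonglongrightarrow> 0"
  shows "x \<longlonglongrightarrow> 0"
proof -
  have "(\<lambda>n. (x n)\<^sup>2) \<longlonglongrightarrow> 0"
    by (rule tendsto_sandwich[OF _ _ tendsto_const assms(2)]) (use assms(1) in auto)
  then have "(\<lambda>n. sqrt ((x n)\<^sup>2)) \<longlonglongrightarrow> sqrt 0" by (rule tendsto_real_sqrt)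
  then show ?thesis by (simp add: tendsto_rabs_zero_iff)
qed

lemma L2_inner_tendsto:
  assumes F: "L2_tendsto \<Omega> F f" and G: "L2_tendsto \<Omega> G g"
  shows "(\<lambda>n. L2_inner \<Omega> (F n) (G n)) \<longlonglongrightarrow> L2_inner \<Omega> f g"
proof -
  have L: "F n \<in> L2_space \<Omega>" "f \<in> L2_space \<Omega>" "G n \<in> L2_space \<Omega>" "g \<in> L2_space \<Omega>" for n
    using F G by (auto simp: L2_tendsto_def)
  define P where "P n x = F n x - f x" for n x
  define Q where "Q n x = G n x - g x" for n x
  have PQ: "P n \<in> L2_space \<Omega>" "Q n \<in> L2_space \<Omega>" for n
    unfolding P_def[abs_def] Q_def[abs_def] using L by (auto intro: L2_diff)
  have p: "(\<lambda>n. L2_sq \<Omega> (P n)) \<longlonglongrightarrow> 0" and q: "(\<lambda>n. L2_sq \<Omega> (Q n)) \<longlonglongrightarrow> 0"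
    using F G by (simp_all add: L2_tendsto_def P_def[abs_def] Q_def[abs_def])
  have split: "L2_inner \<Omega> (F n) (G n)
      = L2_inner \<Omega> (P n) (Q n) + L2_inner \<Omega> (P n) g + L2_inner \<Omega> f (Q n) + L2_inner \<Omega> f g" for n
  proof -
    have "F n = (\<lambda>x. P n x + f x)" "G n = (\<lambda>x. Q n x + g x)" by (auto simp: P_def Q_def)
    then have "L2_inner \<Omega> (F n) (G n) = L2_inner \<Omega> (\<lambda>x. P n x + f x) (\<lambda>x. Q n x + g x)"
      by simp
    then show ?thesis
      using PQ L by (simp add: L2_inner_add_left L2_inner_add_right L2_add)
  qed
  have 1: "(\<lambda>n. L2_inner \<Omega> (P n) (Q n)) \<longlonglongrightarrow> 0"
    by (rule tendsto_0_of_square_le[OF L2_Cauchy_Schwarz[OF PQ(1) PQ(2)]])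
       (use tendsto_mult[OF p q] in simp)
  have 2: "(\<lambda>n. L2_inner \<Omega> (P n) g) \<longlonglongrightarrow> 0"
    by (rule tendsto_0_of_square_le[OF L2_Cauchy_Schwarz[OF PQ(1) L(4)]])
       (use tendsto_mult[OF p tendsto_const] in simp)
  have 3: "(\<lambda>n. L2_inner \<Omega> f (Q n)) \<longlonglongrightarrow> 0"
    by (rule tendsto_0_of_square_le[OF L2_Cauchy_Schwarz[OF L(2) PQ(2)]])
       (use tendsto_mult[OF tendsto_const q] in simp)
  show ?thesis
    unfolding split using tendsto_add[OF tendsto_add[OF tendsto_add[OF 1 2] 3] tendsto_const]
    by simp
qed

lemma L2_tendsto_const: "f \<in> L2_space \<Omega> \<Longrightarrow> L2_tendsto \<Omega> (\<lambda>n. f) f"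
  by (simp add: L2_tendsto_def L2_inner_def)

lemma L2_tendsto_scaleR:
  assumes "L2_tendsto \<Omega> F f"
  shows "L2_tendsto \<Omega> (\<lambda>n x. c *\<^sub>R F n x) (\<lambda>x. c *\<^sub>R f x)"
proof -
  have "(\<lambda>n. c * (c * L2_sq \<Omega> (\<lambda>x. F n x - f x))) \<longlonglongrightarrow> c * (c * 0)"
    using assms by (intro tendsto_intros) (simp add: L2_tendsto_def)
  then show ?thesis
    using assms
    by (simp add: L2_tendsto_def L2_scaleR scaleR_diff_right[symmetric] L2_inner_scaleR_left
        L2_inner_scaleR_right)
qed

lemma L2_tendsto_add:
  assumes F: "L2_tendsto \<Omega> F f" and G: "L2_tendsto \<Omega> G g"
  shows "L2_tendsto \<Omega> (\<lambda>n x. F n x + G n x) (\<lambda>x. f x + g x)"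
proof -
  have L: "F n \<in> L2_space \<Omega>" "f \<in> L2_space \<Omega>" "G n \<in> L2_space \<Omega>" "g \<in> L2_space \<Omega>" for n
    using F G by (auto simp: L2_tendsto_def)
  define P where "P n x = F n x - f x" for n x
  define Q where "Q n x = G n x - g x" for n x
  have PQ: "P n \<in> L2_space \<Omega>" "Q n \<in> L2_space \<Omega>" for n
    unfolding P_def[abs_def] Q_def[abs_def] using L by (auto intro: L2_diff)
  have 0: "L2_tendsto \<Omega> P (\<lambda>x. 0)" "L2_tendsto \<Omega> Q (\<lambda>x. 0)"
    using F G PQ by (simp_all add: L2_tendsto_def P_def[abs_def] Q_def[abs_def])
  have split: "L2_sq \<Omega> (\<lambda>x. P n x + Q n x)
     = L2_sq \<Omega> (P n) + 2 * L2_inner \<Omega> (P n) (Q n) + L2_sq \<Omega> (Q n)" for n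
    using L2_inner_line[OF PQ(1) PQ(2), of n 1 n] by simp
  have eq: "F n x + G n x - (f x + g x) = P n x + Q n x" for n x
    by (simp add: P_def Q_def)
  have z: "L2_inner \<Omega> (\<lambda>x. 0) (\<lambda>x. 0::'b) = 0" by (simp add: L2_inner_def)
  have "(\<lambda>n. L2_sq \<Omega> (P n) + 2 * L2_inner \<Omega> (P n) (Q n) + L2_sq \<Omega> (Q n)) \<longlonglongrightarrow> 0 + 2 * 0 + 0"
    using L2_inner_tendsto[OF 0(1) 0(1)] L2_inner_tendsto[OF 0] L2_inner_tendsto[OF 0(2) 0(2)]
    unfolding z by (intro tendsto_intros)
  then show ?thesis using L by (simp add: L2_tendsto_def L2_add eq split)
qed

lemma L2_tendsto_cong_AE:
  assumes F: "L2_tendsto \<Omega> F f" and G: "\<And>n. G n \<in> L2_space \<Omega>" "g \<in> L2_space \<Omega>"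
    and ae: "\<And>n. AE x in lebesgue_on \<Omega>. F n x = G n x" "AE x in lebesgue_on \<Omega>. f x = g x"
  shows "L2_tendsto \<Omega> G g"
proof -
  have "L2_sq \<Omega> (\<lambda>x. F n x - f x) = L2_sq \<Omega> (\<lambda>x. G n x - g x)" for n
  proof -
    have "AE x in lebesgue_on \<Omega>. F n x - f x = G n x - g x"
      using ae(1)[of n] ae(2) by eventually_elim simp
    then show ?thesis
      using F G by (intro L2_inner_cong_AE) (auto simp: L2_tendsto_def intro: L2_diff)
  qed
  then show ?thesis using F G by (simp add: L2_tendsto_def)
qed

lemma L2_space_vec_iff:
  fixes f :: "real ^ 'n \<Rightarrow> ('b::euclidean_space) ^ 'm"
  shows "f \<in> L2_space \<Omega> \<longleftrightarrow> (\<forall>i. (\<lambda>x. f x $ i) \<in> L2_space \<Omega>)"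
proof
  assume f: "f \<in> L2_space \<Omega>"
  show "\<forall>i. (\<lambda>x. f x $ i) \<in> L2_space \<Omega>"
  proof
    fix i
    show "(\<lambda>x. f x $ i) \<in> L2_space \<Omega>"
    proof (rule L2_space_dominated)
      show "(\<lambda>x. f x $ i) \<in> borel_measurable (lebesgue_on \<Omega>)"
        using L2_spaceD(1)[OF f]
        by (intro borel_measurable_continuous_on[where f="\<lambda>v. v $ i"] continuous_intros)
      show "integrable (lebesgue_on \<Omega>) (\<lambda>x. (norm (f x))\<^sup>2)" by (rule L2_spaceD(2)[OF f])
      show "(norm (f x $ i))\<^sup>2 \<le> (norm (f x))\<^sup>2" for x
        by (simp add: component_le_norm_cart Finite_Cartesian_Product.norm_nth_le power_mono)
    qed
  qed
next
  assume R: "\<forall>i. (\<lambda>x. f x $ i) \<in> L2_space \<Omega>"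
  have "f \<in> borel_measurable (lebesgue_on \<Omega>)"
    unfolding borel_measurable_euclidean_space[where 'c="'b ^ 'm"]
  proof
    fix b :: "'b ^ 'm" assume "b \<in> Basis"
    show "(\<lambda>x. f x \<bullet> b) \<in> borel_measurable (lebesgue_on \<Omega>)"
      unfolding inner_vec_def
      by (intro borel_measurable_sum borel_measurable_inner borel_measurable_const)
         (use R L2_spaceD(1) in blast)
  qed
  moreover have "(norm (f x))\<^sup>2 = (\<Sum>i\<in>UNIV. (norm (f x $ i))\<^sup>2)" for x
    by (simp add: norm_vec_def L2_set_def sum_nonneg)
  ultimately show "f \<in> L2_space \<Omega>"
    using R L2_spaceD(2)[where f="\<lambda>x. f x $ i" for i] by (auto simp: L2_space_def)
qed

lemma L2_inner_vec:
  fixes f g :: "real ^ 'n \<Rightarrow> ('b::euclidean_space) ^ 'm"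
  assumes "f \<in> L2_space \<Omega>" "g \<in> L2_space \<Omega>"
  shows "L2_inner \<Omega> f g = (\<Sum>i\<in>UNIV. L2_inner \<Omega> (\<lambda>x. f x $ i) (\<lambda>x. g x $ i))"
proof -
  have "integrable (lebesgue_on \<Omega>) (\<lambda>x. f x $ i \<bullet> g x $ i)" for i
    using assms L2_integrable_inner[of "\<lambda>x. f x $ i" \<Omega> "\<lambda>x. g x $ i"] by (simp add: L2_space_vec_iff)
  then show ?thesis by (simp add: L2_inner_def inner_vec_def)
qed

lemma L2_tendsto_vec:
  fixes f :: "real ^ 'n \<Rightarrow> ('b::euclidean_space) ^ 'm"
  assumes "\<And>i. L2_tendsto \<Omega> (\<lambda>n x. F n x $ i) (\<lambda>x. f x $ i)"
  shows "L2_tendsto \<Omega> F f"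
proof -
  have L: "F n \<in> L2_space \<Omega>" "f \<in> L2_space \<Omega>" for n
    using assms by (auto simp: L2_space_vec_iff L2_tendsto_def)
  have "(\<lambda>n. \<Sum>i\<in>UNIV. L2_sq \<Omega> (\<lambda>x. F n x $ i - f x $ i)) \<longlonglongrightarrow> (\<Sum>i\<in>(UNIV::'m set). 0)"
    using assms by (intro tendsto_sum) (simp add: L2_tendsto_def)
  then show ?thesis
    using L by (simp add: L2_tendsto_def L2_inner_vec L2_diff)
qed

lemma L2_imp_integrable:
  fixes f :: "('n::finite) scalar_field"
  assumes f: "f \<in> L2_space \<Omega>" and "\<Omega> \<in> lmeasurable"
  shows "integrable (lebesgue_on \<Omega>) f"
proof -
  interpret finite_measure "lebesgue_on \<Omega>" by (rule finite_measure_lebesgue_on[OF assms(2)])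
  have one: "(\<lambda>x. 1::real) \<in> L2_space \<Omega>" by (simp add: L2_space_def)
  show ?thesis using L2_integrable_inner[OF f one] by simp
qed

text \<open>
  On a set of finite measure an \<open>L\<^sup>2\<close>-Cauchy sequence is \<open>L\<^sup>1\<close>-Cauchy, so a subsequence converges
  almost everywhere. Fatou's lemma shows that its limit is the \<open>L\<^sup>2\<close>-limit.
\<close>

lemma L2_complete:
  fixes F :: "nat \<Rightarrow> ('n::finite) scalar_field"
  assumes \<Omega>: "\<Omega> \<in> lmeasurable" and F: "\<And>n. F n \<in> L2_space \<Omega>"
    and cauchy: "\<And>e. 0 < e \<Longrightarrow> \<exists>N. \<forall>m\<ge>N. \<forall>n\<ge>N. L2_sq \<Omega> (\<lambda>x. F m x - F n x) < e"
  shows "\<exists>g. L2_tendsto \<Omega> F g"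
proof -
  let ?M = "lebesgue_on \<Omega>"
  interpret finite_measure ?M by (rule finite_measure_lebesgue_on[OF \<Omega>])
  let ?c = "measure ?M (space ?M) + 1"
  have one: "(\<lambda>x. 1::real) \<in> L2_space \<Omega>" by (simp add: L2_space_def)
  have [measurable]: "F n \<in> borel_measurable ?M" for n using L2_spaceD(1)[OF F] .
  have L1: "\<exists>N. \<forall>m\<ge>N. \<forall>n\<ge>N. (LINT x|?M. norm (F m x - F n x)) < e" if "0 < e" for e
  proof -
    have c: "0 < ?c" by (simp add: add_nonneg_pos)
    have ec: "0 < e\<^sup>2 / ?c" using that by (intro divide_pos_pos c) simp
    obtain N where N: "\<And>m n. m \<ge> N \<Longrightarrow> n \<ge> N \<Longrightarrow> L2_sq \<Omega> (\<lambda>x. F m x - F n x) < e\<^sup>2 / ?c"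
      using cauchy[OF ec] by blast
    have "(LINT x|?M. norm (F m x - F n x)) < e" if mn: "m \<ge> N" "n \<ge> N" for m n
    proof -
      have D: "(\<lambda>x. F m x - F n x) \<in> L2_space \<Omega>" using F by (intro L2_diff)
      then have A: "(\<lambda>x. \<bar>F m x - F n x\<bar>) \<in> L2_space \<Omega>" by (simp add: L2_space_def)
      have "(L2_inner \<Omega> (\<lambda>x. \<bar>F m x - F n x\<bar>) (\<lambda>x. 1))\<^sup>2
           \<le> L2_sq \<Omega> (\<lambda>x. \<bar>F m x - F n x\<bar>) * L2_inner \<Omega> (\<lambda>x. 1::real) (\<lambda>x. 1)"
        by (rule L2_Cauchy_Schwarz[OF A one])
      also have "\<dots> = L2_sq \<Omega> (\<lambda>x. F m x - F n x) * measure ?M (space ?M)"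
        by (simp add: L2_inner_def)
      also have "\<dots> \<le> L2_sq \<Omega> (\<lambda>x. F m x - F n x) * ?c"
        by (intro mult_left_mono L2_inner_self_nonneg) simp
      also have "\<dots> < e\<^sup>2 / ?c * ?c" by (intro mult_strict_right_mono N mn c)
      also have "\<dots> = e\<^sup>2" using c by simp
      finally have "L2_inner \<Omega> (\<lambda>x. \<bar>F m x - F n x\<bar>) (\<lambda>x. 1) < e"
        using \<open>0 < e\<close> by (metis less_eq_real_def power2_less_imp_less)
      then show ?thesis by (simp add: L2_inner_def)
    qed
    then show ?thesis by blast
  qed
  obtain r where r: "strict_mono r" and ae: "AE x in ?M. Cauchy (\<lambda>i. F (r i) x)"
    using cauchy_L1_AE_cauchy_subseq[OF L2_imp_integrable[OF F \<Omega>] L1] by blast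
  define g where "g x = lim (\<lambda>i. F (r i) x)" for x
  have g[measurable]: "g \<in> borel_measurable ?M" unfolding g_def by measurable
  have lim: "AE x in ?M. (\<lambda>i. F (r i) x) \<longlonglongrightarrow> g x"
    using ae by eventually_elim (simp add: g_def Cauchy_convergent_iff convergent_LIMSEQ_iff)
  have fatou: "integrable ?M (\<lambda>x. (F n x - g x)\<^sup>2) \<and> (LINT x|?M. (F n x - g x)\<^sup>2) \<le> e"
    if e: "\<And>m. m \<ge> N \<Longrightarrow> L2_sq \<Omega> (\<lambda>x. F n x - F m x) < e" for n N e
  proof -
    have e0: "0 \<le> e" using e[of N] L2_inner_self_nonneg[of \<Omega> "\<lambda>x. F n x - F N x"] by simp
    have int: "(\<integral>\<^sup>+x. ennreal ((F n x - F m x)\<^sup>2) \<partial>?M) = ennreal (L2_sq \<Omega> (\<lambda>x. F n x - F m x))" for m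
      using L2_integrable_inner[OF L2_diff[OF F F, of n m] L2_diff[OF F F, of n m]]
      by (subst nn_integral_eq_integral) (auto simp: L2_inner_def power2_eq_square)
    have "(\<integral>\<^sup>+x. ennreal ((F n x - g x)\<^sup>2) \<partial>?M)
        = (\<integral>\<^sup>+x. liminf (\<lambda>i. ennreal ((F n x - F (r i) x)\<^sup>2)) \<partial>?M)"
    proof (rule nn_integral_cong_AE)
      show "AE x in ?M. ennreal ((F n x - g x)\<^sup>2) = liminf (\<lambda>i. ennreal ((F n x - F (r i) x)\<^sup>2))"
        using lim
      proof eventually_elim
        case (elim x)
        have "(\<lambda>i. ennreal ((F n x - F (r i) x)\<^sup>2)) \<longlonglongrightarrow> ennreal ((F n x - g x)\<^sup>2)"
          by (intro tendsto_ennrealI tendsto_intros elim)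
        from lim_imp_Liminf[OF _ this] show ?case by simp
      qed
    qed
    also have "\<dots> \<le> liminf (\<lambda>i. \<integral>\<^sup>+x. ennreal ((F n x - F (r i) x)\<^sup>2) \<partial>?M)"
      by (rule nn_integral_liminf) measurable
    also have "\<dots> \<le> ennreal e"
    proof (rule Liminf_le)
      show "\<forall>\<^sub>F i in sequentially. (\<integral>\<^sup>+x. ennreal ((F n x - F (r i) x)\<^sup>2) \<partial>?M) \<le> ennreal e"
        unfolding int eventually_sequentially
      proof (intro exI[of _ N] allI impI ennreal_leI)
        fix i assume "N \<le> i"
        then have "N \<le> r i" using seq_suble[OF r, of i] by simp
        from e[OF this] show "L2_sq \<Omega> (\<lambda>x. F n x - F (r i) x) \<le> e" by simp
      qed
    qed simp
    finally have le: "(\<integral>\<^sup>+x. ennreal ((F n x - g x)\<^sup>2) \<partial>?M) \<le> ennreal e" .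
    then have I: "integrable ?M (\<lambda>x. (F n x - g x)\<^sup>2)"
      by (intro integrableI_nonneg le_less_trans[OF le]) auto
    then have "ennreal (LINT x|?M. (F n x - g x)\<^sup>2) \<le> ennreal e"
      using le by (simp add: nn_integral_eq_integral)
    with I e0 show ?thesis by simp
  qed
  obtain N where N: "\<And>m n. m \<ge> N \<Longrightarrow> n \<ge> N \<Longrightarrow> L2_sq \<Omega> (\<lambda>x. F m x - F n x) < 1"
    using cauchy[of 1] by auto
  have "integrable ?M (\<lambda>x. (F N x - g x)\<^sup>2)"
    using fatou[of N N 1] N by auto
  then have "(\<lambda>x. F N x - g x) \<in> L2_space \<Omega>" by (simp add: L2_space_def)
  from L2_diff[OF F[of N] this] have gL: "g \<in> L2_space \<Omega>" by simp
  have "(\<lambda>n. L2_sq \<Omega> (\<lambda>x. F n x - g x)) \<longlonglongrightarrow> 0"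
  proof (rule LIMSEQ_I)
    fix e :: real assume "0 < e"
    then obtain N where N: "\<And>m n. m \<ge> N \<Longrightarrow> n \<ge> N \<Longrightarrow> L2_sq \<Omega> (\<lambda>x. F m x - F n x) < e/2"
      using cauchy[of "e/2"] by auto
    have "L2_sq \<Omega> (\<lambda>x. F n x - g x) \<le> e/2" if "n \<ge> N" for n
      using fatou[of N n "e/2"] N that by (auto simp: L2_inner_def power2_eq_square)
    then show "\<exists>N. \<forall>n\<ge>N. norm (L2_sq \<Omega> (\<lambda>x. F n x - g x) - 0) < e"
    proof (intro exI[of _ N] allI impI)
      fix n assume "N \<le> n"
      from this[THEN \<open>\<And>n. n \<ge> N \<Longrightarrow> L2_sq \<Omega> (\<lambda>x. F n x - g x) \<le> e/2\<close>]
      show "norm (L2_sq \<Omega> (\<lambda>x. F n x - g x) - 0) < e"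
        using \<open>0 < e\<close> L2_inner_self_nonneg[of \<Omega> "\<lambda>x. F n x - g x"] by simp
    qed
  qed
  then show ?thesis using F gL by (auto simp: L2_tendsto_def)
qed

section \<open>Smooth functions and bump functions\<close>

abbreviation "pd \<equiv> classical_partial"

lemma classical_partial_eqI:
  "(\<phi> has_derivative D) (at x) \<Longrightarrow> pd i \<phi> x = D (axis i 1)"
  by (simp add: classical_partial_def frechet_derivative_at[symmetric])

lemma has_derivative_frechet:
  fixes \<phi> :: "('n::finite) scalar_field"
  shows "\<phi> differentiable (at x) \<Longrightarrow> (\<phi> has_derivative frechet_derivative \<phi> (at x)) (at x)"
  by (simp add: frechet_derivative_works)

lemma classical_partial_add:
  assumes "\<phi> differentiable (at x)" "\<psi> differentiable (at x)"
  shows "pd i (\<lambda>x. \<phi> x + \<psi> x) x = pd i \<phi> x + pd i \<psi> x"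
  using classical_partial_eqI[OF has_derivative_add[OF assms[THEN has_derivative_frechet]]]
  by (simp add: classical_partial_def)

lemma classical_partial_mult:
  assumes "\<phi> differentiable (at x)" "\<psi> differentiable (at x)"
  shows "pd i (\<lambda>x. \<phi> x * \<psi> x) x
         = \<phi> x * pd i \<psi> x + pd i \<phi> x * \<psi> x"
  using classical_partial_eqI[OF has_derivative_mult[OF assms[THEN has_derivative_frechet]]]
  by (simp add: classical_partial_def)

lemma smooth_coinduct:
  assumes "\<phi> \<in> S"
    and "\<And>\<psi> x. \<psi> \<in> S \<Longrightarrow> \<psi> differentiable (at x)"
    and "\<And>\<psi> i. \<psi> \<in> S \<Longrightarrow> pd i \<psi> \<in> S"
  shows "smooth \<phi>"
proof -
  have "foldr pd is \<phi> \<in> S" for "is"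
    using assms(1,3) by (induction "is") auto
  then show ?thesis
    using assms(2) by (auto simp: smooth_def differentiable_on_def intro: differentiable_at_withinI)
qed

lemma smooth_differentiable:
  assumes "smooth \<phi>"
  shows "\<phi> differentiable (at x)"
  using assms[unfolded smooth_def, rule_format, of "[]"] by (simp add: differentiable_on_def)

lemma smooth_partial:
  assumes "smooth \<phi>"
  shows "smooth (pd i \<phi>)"
  unfolding smooth_def
proof
  fix "is"
  show "foldr pd is (pd i \<phi>) differentiable_on UNIV"
    using assms[unfolded smooth_def, rule_format, of "is @ [i]"] by simp
qed

lemma smooth_continuous: "smooth \<phi> \<Longrightarrow> continuous_on S \<phi>"
  by (meson continuous_at_imp_continuous_on differentiable_imp_continuous_within smooth_differentiable)

text \<open>
  Partial derivatives of a product are sums of products, so the induction behind closure under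
  multiplication has to run over the whole algebra generated by the smooth functions.
\<close>

inductive_set smooth_algebra :: "('n::finite) scalar_field set" where
  smooth: "smooth \<phi> \<Longrightarrow> \<phi> \<in> smooth_algebra"
| add: "\<phi> \<in> smooth_algebra \<Longrightarrow> \<psi> \<in> smooth_algebra \<Longrightarrow> (\<lambda>x. \<phi> x + \<psi> x) \<in> smooth_algebra"
| mult: "\<phi> \<in> smooth_algebra \<Longrightarrow> \<psi> \<in> smooth_algebra \<Longrightarrow> (\<lambda>x. \<phi> x * \<psi> x) \<in> smooth_algebra"

lemma smooth_algebra_differentiable: "\<phi> \<in> smooth_algebra \<Longrightarrow> \<phi> differentiable (at x)"
  by (induction rule: smooth_algebra.induct) (auto intro: smooth_differentiable)

lemma smooth_algebra_partial: "\<phi> \<in> smooth_algebra \<Longrightarrow> pd i \<phi> \<in> smooth_algebra"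
proof (induction rule: smooth_algebra.induct)
  case (smooth \<phi>)
  then show ?case by (intro smooth_algebra.smooth smooth_partial)
next
  case (add \<phi> \<psi>)
  have "pd i (\<lambda>x. \<phi> x + \<psi> x) = (\<lambda>x. pd i \<phi> x + pd i \<psi> x)"
    using add(1,2) by (intro ext classical_partial_add smooth_algebra_differentiable)
  with add show ?case by (simp add: smooth_algebra.add)
next
  case (mult \<phi> \<psi>)
  have "pd i (\<lambda>x. \<phi> x * \<psi> x)
        = (\<lambda>x. \<phi> x * pd i \<psi> x + pd i \<phi> x * \<psi> x)"
    using mult(1,2) by (intro ext classical_partial_mult smooth_algebra_differentiable)
  with mult show ?case by (simp add: smooth_algebra.add smooth_algebra.mult)
qed

lemma smooth_algebra_smooth: "\<phi> \<in> smooth_algebra \<Longrightarrow> smooth \<phi>"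
  by (rule smooth_coinduct[where S=smooth_algebra])
     (auto intro: smooth_algebra_differentiable smooth_algebra_partial)

lemma smooth_add: "smooth \<phi> \<Longrightarrow> smooth \<psi> \<Longrightarrow> smooth (\<lambda>x. \<phi> x + \<psi> x)"
  by (rule smooth_algebra_smooth) (rule smooth_algebra.add; erule smooth_algebra.smooth)

lemma smooth_mult: "smooth \<phi> \<Longrightarrow> smooth \<psi> \<Longrightarrow> smooth (\<lambda>x. \<phi> x * \<psi> x)"
  by (rule smooth_algebra_smooth) (rule smooth_algebra.mult; erule smooth_algebra.smooth)

lemma classical_partial_const: "pd i (\<lambda>x. c) = (\<lambda>x. 0)"
  by (intro ext classical_partial_eqI has_derivative_const)

lemma smooth_const: "smooth (\<lambda>x. c)"
  by (rule smooth_coinduct[where S="range (\<lambda>c x. c)"]) (auto simp: classical_partial_const)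

lemma classical_partial_coordinate: "pd i (\<lambda>x. x $ j) = (\<lambda>x. if i = j then 1 else 0)"
proof
  fix x :: "real ^ 'a"
  have "((\<lambda>x. x $ j) has_derivative (\<lambda>x. x $ j)) (at (x::real ^ 'a))"
    by (rule bounded_linear_imp_has_derivative[OF bounded_linear_vec_nth])
  from classical_partial_eqI[OF this, of i]
  show "pd i (\<lambda>x. x $ j) x = (if i = j then 1 else 0)"
    by (simp add: axis_def)
qed

lemma smooth_coordinate: "smooth (\<lambda>x. x $ j)"
  by (rule smooth_coinduct[where S="insert (\<lambda>x. x $ j) (range (\<lambda>c x. c))"])
     (auto simp: classical_partial_const classical_partial_coordinate
       intro: bounded_linear_imp_differentiable[OF bounded_linear_vec_nth])

lemma smooth_prod: "(\<And>i. i \<in> A \<Longrightarrow> smooth (F i)) \<Longrightarrow> smooth (\<lambda>x. \<Prod>i\<in>A. F i x)"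
  by (induction A rule: infinite_finite_induct) (auto intro: smooth_mult smooth_const)

text \<open>
  The functions \<open>p(1/t) exp(-1/t)\<close>, cut off at \<open>t = 0\<close>, with \<open>p\<close> a polynomial, form a class that is
  closed under differentiation. Hence each of them is smooth.
\<close>

definition flat_exp :: "real poly \<Rightarrow> real \<Rightarrow> real" where
  "flat_exp p t = (if 0 < t then poly p (1 / t) * exp (- (1 / t)) else 0)"

definition flat_exp_deriv :: "real poly \<Rightarrow> real poly" where
  "flat_exp_deriv p = [:0, 0, 1:] * (p - pderiv p)"

lemma poly_times_exp_minus_tendsto_0: "((\<lambda>s::real. poly p s * exp (- s)) \<longlongrightarrow> 0) at_top"
proof -
  have "((\<lambda>s::real. \<Sum>k\<le>degree p. coeff p k * (s ^ k / exp s)) \<longlongrightarrow> (\<Sum>k\<le>degree p. coeff p k * 0)) at_top"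
    by (intro tendsto_sum tendsto_mult tendsto_const tendsto_power_div_exp_0)
  then show ?thesis
    by (simp add: poly_altdef sum_distrib_right exp_minus divide_inverse mult.assoc)
qed

lemma flat_exp_has_derivative: "(flat_exp p has_real_derivative flat_exp (flat_exp_deriv p) t) (at t)"
proof -
  consider "0 < t" | "t < 0" | "t = 0" by linarith
  then show ?thesis
  proof cases
    case 1
    have "((\<lambda>t. poly p (1 / t) * exp (- (1 / t))) has_real_derivative flat_exp (flat_exp_deriv p) t) (at t)"
      using 1 by (auto intro!: derivative_eq_intros DERIV_chain2[OF poly_DERIV] simp: flat_exp_def flat_exp_deriv_def)
         (simp add: field_simps power2_eq_square)
    then show ?thesis
      by (rule has_field_derivative_transform_within_open[of _ _ _ "{0<..}"]) (use 1 in \<open>auto simp: flat_exp_def\<close>)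
  next
    case 2
    have "((\<lambda>t. 0) has_real_derivative flat_exp (flat_exp_deriv p) t) (at t)"
      using 2 by (simp add: flat_exp_def)
    then show ?thesis
      by (rule has_field_derivative_transform_within_open[of _ _ _ "{..<0}"]) (use 2 in \<open>auto simp: flat_exp_def\<close>)
  next
    case 3
    have "((\<lambda>h. flat_exp p h / h) \<longlongrightarrow> 0) (at_right 0)"
    proof -
      have "((\<lambda>h::real. poly (pCons 0 p) (inverse h) * exp (- inverse h)) \<longlongrightarrow> 0) (at_right 0)"
        by (rule filterlim_compose[OF poly_times_exp_minus_tendsto_0 filterlim_inverse_at_top_right])
      moreover have "\<forall>\<^sub>F h::real in at_right 0. poly (pCons 0 p) (inverse h) * exp (- inverse h) = flat_exp p h / h"
        using eventually_at_right_less[of 0] by eventually_elim (simp add: flat_exp_def field_simps)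
      ultimately show ?thesis by (rule Lim_transform_eventually)
    qed
    moreover have "((\<lambda>h. flat_exp p h / h) \<longlongrightarrow> 0) (at_left 0)"
    proof -
      have "\<forall>\<^sub>F h::real in at_left 0. 0 = flat_exp p h / h"
        using eventually_at_left_real[of "-1::real" 0] by (auto simp: flat_exp_def elim: eventually_mono)
      then show ?thesis by (rule Lim_transform_eventually[OF tendsto_const])
    qed
    ultimately have "((\<lambda>h. flat_exp p h / h) \<longlongrightarrow> 0) (at 0)"
      using filterlim_split_at[of _ "nhds 0" "0::real"] by blast
    then show ?thesis using 3 by (simp add: DERIV_def flat_exp_def)
  qed
qed

lemma flat_exp_coordinate_has_derivative:
  fixes x :: "real ^ 'n"
  shows "((\<lambda>x. flat_exp p (c * x $ i + d)) has_derivative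
           (\<lambda>v. flat_exp (flat_exp_deriv p) (c * x $ i + d) * (c * v $ i))) (at x)"
proof -
  have "((\<lambda>x. c * x $ i + d) has_derivative (\<lambda>v. c * v $ i)) (at x)"
    by (auto intro!: derivative_eq_intros bounded_linear_imp_has_derivative[OF bounded_linear_vec_nth])
  from has_derivative_compose[OF this flat_exp_has_derivative[unfolded has_field_derivative_def]]
  show ?thesis by simp
qed

lemma smooth_flat_exp_coordinate:
  fixes i :: "'n::finite"
  shows "smooth (\<lambda>x. flat_exp p (c * x $ i + d))"
proof (rule smooth_coinduct[where S="range (\<lambda>p x. flat_exp p (c * x $ i + d))"])
  fix \<psi> :: "'n scalar_field" and x k
  assume "\<psi> \<in> range (\<lambda>p x. flat_exp p (c * x $ i + d))"
  then obtain p where \<psi>: "\<psi> = (\<lambda>x. flat_exp p (c * x $ i + d))" by blast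
  show "\<psi> differentiable (at x)"
    unfolding \<psi> differentiable_def using flat_exp_coordinate_has_derivative by blast
  have "pd k \<psi> x
      = flat_exp (smult (if k = i then c else 0) (flat_exp_deriv p)) (c * x $ i + d)" for x
    using classical_partial_eqI[OF flat_exp_coordinate_has_derivative, of k p c i d x]
    unfolding \<psi> by (simp add: axis_def flat_exp_def)
  then show "pd k \<psi> \<in> range (\<lambda>p x. flat_exp p (c * x $ i + d))"
    by (intro range_eqI[of _ _ "smult (if k = i then c else 0) (flat_exp_deriv p)"]) auto
qed auto

text \<open>These bump functions increase to the indicator function of the open box as \<open>n\<close> grows.\<close>

definition box_bump :: "real ^ 'n \<Rightarrow> real ^ 'n \<Rightarrow> nat \<Rightarrow> ('n::finite) scalar_field" where
  "box_bump a b n x = (\<Prod>i\<in>UNIV. flat_exp 1 (real (Suc n) * (x $ i - a $ i)) * flat_exp 1 (real (Suc n) * (b $ i - x $ i)))"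

lemma flat_exp_1_bounds: "0 \<le> flat_exp 1 t" "flat_exp 1 t \<le> 1"
  by (auto simp: flat_exp_def)

lemma smooth_box_bump: "smooth (box_bump a b n)"
proof -
  have eq: "real (Suc n) * (x $ i - a $ i) = real (Suc n) * x $ i + - (real (Suc n) * a $ i)"
    "real (Suc n) * (b $ i - x $ i) = - real (Suc n) * x $ i + real (Suc n) * b $ i" for x i
    by (simp_all add: algebra_simps)
  show ?thesis
    unfolding box_bump_def[abs_def] eq
    by (intro smooth_prod smooth_mult smooth_flat_exp_coordinate)
qed

lemma box_bump_bounds: "0 \<le> box_bump a b n x" "box_bump a b n x \<le> 1"
  unfolding box_bump_def using flat_exp_1_bounds
  by (auto intro!: prod_nonneg prod_le_1 mult_le_one)

lemma box_bump_eq_0: "x \<notin> box a b \<Longrightarrow> box_bump a b n x = 0"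
  by (auto simp: box_bump_def mem_box_cart flat_exp_def zero_less_mult_iff)

lemma box_bump_tendsto: "(\<lambda>n. box_bump a b n x) \<longlonglongrightarrow> indicator (box a b) x"
proof (cases "x \<in> box a b")
  case True
  have *: "(\<lambda>n. flat_exp 1 (real (Suc n) * t)) \<longlonglongrightarrow> 1" if "0 < t" for t
  proof -
    have "(\<lambda>n. exp (- (inverse (real (Suc n)) * (1 / t)))) \<longlonglongrightarrow> exp (- (0 * (1 / t)))"
      by (intro tendsto_intros LIMSEQ_inverse_real_of_nat)
    moreover have "flat_exp 1 (real (Suc n) * t) = exp (- (inverse (real (Suc n)) * (1 / t)))" for n
      using that by (simp add: flat_exp_def divide_inverse del: of_nat_Suc)
    ultimately show ?thesis by (simp del: of_nat_Suc)
  qed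
  have "(\<lambda>n. box_bump a b n x) \<longlonglongrightarrow> (\<Prod>i\<in>(UNIV::'a set). 1 * 1)"
    unfolding box_bump_def using True
    by (intro tendsto_prod tendsto_mult *) (auto simp: mem_box_cart)
  then show ?thesis using True by simp
qed (simp add: box_bump_eq_0)

lemma box_bump_test_function:
  assumes "cbox a b \<subseteq> \<Omega>"
  shows "box_bump a b n \<in> test_functions \<Omega>"
proof -
  have "{x. box_bump a b n x \<noteq> 0} \<subseteq> cbox a b"
    using box_bump_eq_0 box_subset_cbox by blast
  then have sub: "closure {x. box_bump a b n x \<noteq> 0} \<subseteq> cbox a b"
    by (simp add: closure_minimal closed_cbox)
  then have "compact (closure {x. box_bump a b n x \<noteq> 0})"
    by (meson bounded_cbox bounded_subset closed_closure compact_eq_bounded_closed)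
  then show ?thesis
    using sub assms smooth_box_bump by (auto simp: test_functions_def)
qed

section \<open>Test functions\<close>

lemma test_function_smooth: "\<phi> \<in> test_functions \<Omega> \<Longrightarrow> smooth \<phi>"
  by (simp add: test_functions_def)

lemma test_functionI:
  assumes "smooth \<phi>" "\<psi> \<in> test_functions \<Omega>" "\<And>x. x \<notin> closure {x. \<psi> x \<noteq> 0} \<Longrightarrow> \<phi> x = 0"
  shows "\<phi> \<in> test_functions \<Omega>"
proof -
  have "closure {x. \<phi> x \<noteq> 0} \<subseteq> closure {x. \<psi> x \<noteq> 0}"
    using assms(3) by (intro closure_minimal) auto
  moreover from this have "compact (closure {x. \<phi> x \<noteq> 0})"
    using assms(2) compact_Int_closed[of "closure {x. \<psi> x \<noteq> 0}" "closure {x. \<phi> x \<noteq> 0}"]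
    by (simp add: test_functions_def Int_absorb1)
  ultimately show ?thesis using assms by (auto simp: test_functions_def)
qed

lemma test_function_zero_outside:
  "\<phi> \<in> test_functions \<Omega> \<Longrightarrow> x \<notin> \<Omega> \<Longrightarrow> \<phi> x = 0"
  using closure_subset[of "{x. \<phi> x \<noteq> 0}"] by (auto simp: test_functions_def)

lemma test_function_partial:
  assumes "\<phi> \<in> test_functions \<Omega>"
  shows "pd i \<phi> \<in> test_functions \<Omega>"
proof (rule test_functionI[OF _ assms])
  show "smooth (pd i \<phi>)" using assms by (intro smooth_partial test_function_smooth)
  fix x assume x: "x \<notin> closure {x. \<phi> x \<noteq> 0}"
  have "((\<lambda>x. 0) has_derivative (\<lambda>v. 0)) (at x)" by simp
  then have "(\<phi> has_derivative (\<lambda>v. 0)) (at x)"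
    by (rule has_derivative_transform_within_open[of _ _ _ _ "- closure {x. \<phi> x \<noteq> 0}"])
       (use x closure_subset[of "{x. \<phi> x \<noteq> 0}"] in auto)
  then show "pd i \<phi> x = 0" by (simp add: classical_partial_eqI)
qed

lemma test_function_zero: "(\<lambda>x. 0) \<in> test_functions \<Omega>"
  by (simp add: test_functions_def smooth_const)

lemma test_function_mult:
  assumes "smooth \<phi>" "\<psi> \<in> test_functions \<Omega>"
  shows "(\<lambda>x. \<phi> x * \<psi> x) \<in> test_functions \<Omega>"
  using closure_subset[of "{x. \<psi> x \<noteq> 0}"]
  by (intro test_functionI[OF _ assms(2)] smooth_mult assms test_function_smooth[OF assms(2)]) auto

lemma test_function_cmult: "\<phi> \<in> test_functions \<Omega> \<Longrightarrow> (\<lambda>x. c * \<phi> x) \<in> test_functions \<Omega>"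
  by (intro test_function_mult smooth_const)

lemma test_function_add:
  assumes "\<phi> \<in> test_functions \<Omega>" "\<psi> \<in> test_functions \<Omega>"
  shows "(\<lambda>x. \<phi> x + \<psi> x) \<in> test_functions \<Omega>"
proof -
  let ?K = "closure {x. \<phi> x \<noteq> 0} \<union> closure {x. \<psi> x \<noteq> 0}"
  have K: "compact ?K" "?K \<subseteq> \<Omega>" using assms by (auto simp: test_functions_def)
  have sub: "closure {x. \<phi> x + \<psi> x \<noteq> 0} \<subseteq> ?K"
    unfolding closure_Un[symmetric] by (rule closure_mono) auto
  then have "compact (closure {x. \<phi> x + \<psi> x \<noteq> 0})"
    using compact_Int_closed[OF K(1), of "closure {x. \<phi> x + \<psi> x \<noteq> 0}"] by (simp add: Int_absorb1)
  then show ?thesis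
    using sub K smooth_add assms by (auto simp: test_functions_def)
qed

lemma test_function_bounded:
  assumes "\<phi> \<in> test_functions \<Omega>"
  shows "\<exists>C. \<forall>x. \<bar>\<phi> x\<bar> \<le> C"
proof -
  let ?K = "closure {x. \<phi> x \<noteq> 0}"
  have "compact (\<phi> ` ?K)"
    using assms by (intro compact_continuous_image smooth_continuous) (auto simp: test_functions_def)
  then obtain C where C: "\<And>x. x \<in> ?K \<Longrightarrow> \<bar>\<phi> x\<bar> \<le> C"
    using compact_imp_bounded bounded_iff by (metis imageI real_norm_def)
  have "\<bar>\<phi> x\<bar> \<le> max C 0" for x
    using C[of x] closure_subset[of "{x. \<phi> x \<noteq> 0}"] by (cases "\<phi> x = 0") auto
  then show ?thesis by blast
qed

lemma test_function_borel: "\<phi> \<in> test_functions \<Omega> \<Longrightarrow> \<phi> \<in> borel_measurable borel"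
  by (intro borel_measurable_continuous_onI smooth_continuous test_function_smooth)

lemma test_function_measurable: "\<phi> \<in> test_functions \<Omega> \<Longrightarrow> \<phi> \<in> borel_measurable (lebesgue_on S)"
  using test_function_borel by (auto intro!: measurable_restrict_space1 measurable_completion)

lemma classical_partial_line:
  assumes "smooth \<phi>"
  shows "((\<lambda>s. \<phi> (x + s *\<^sub>R axis i 1)) has_real_derivative pd i \<phi> (x + s *\<^sub>R axis i 1)) (at s)"
proof -
  let ?D = "frechet_derivative \<phi> (at (x + s *\<^sub>R axis i 1))"
  have D: "(\<phi> has_derivative ?D) (at (x + s *\<^sub>R axis i 1))"
    by (intro has_derivative_frechet smooth_differentiable assms)
  have "((\<lambda>s. x + s *\<^sub>R axis i 1) has_derivative (\<lambda>h. h *\<^sub>R axis i 1)) (at s)"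
    by (auto intro!: derivative_eq_intros)
  from has_derivative_compose[OF this D]
  show ?thesis
    unfolding has_field_derivative_def classical_partial_def
    by (rule has_derivative_eq_rhs) (simp add: linear_cmul[OF has_derivative_linear[OF D]] mult.commute fun_eq_iff)
qed

lemma smooth_mvt:
  assumes "smooth \<phi>" "0 < h"
  obtains \<xi> where "0 < \<xi>" "\<xi> < h" "\<phi> (x + h *\<^sub>R axis i 1) - \<phi> x = h * pd i \<phi> (x + \<xi> *\<^sub>R axis i 1)"
  using MVT2[of 0 h "\<lambda>s. \<phi> (x + s *\<^sub>R axis i 1)" "\<lambda>s. pd i \<phi> (x + s *\<^sub>R axis i 1)"]
    classical_partial_line[OF assms(1)] assms(2) by auto

text \<open>Two applications of the mean value theorem to a second difference.\<close>

lemma second_difference: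
  assumes "smooth \<phi>" "0 < h"
  obtains y where "dist x y < 2 * h"
    "\<phi> (x + h *\<^sub>R axis i 1 + h *\<^sub>R axis j 1) - \<phi> (x + h *\<^sub>R axis i 1) - (\<phi> (x + h *\<^sub>R axis j 1) - \<phi> x)
     = h\<^sup>2 * pd j (pd i \<phi>) y"
proof -
  let ?s = "\<lambda>t. \<phi> (x + t *\<^sub>R axis i 1 + h *\<^sub>R axis j 1) - \<phi> (x + t *\<^sub>R axis i 1)"
  let ?s' = "\<lambda>t. pd i \<phi> (x + t *\<^sub>R axis i 1 + h *\<^sub>R axis j 1) - pd i \<phi> (x + t *\<^sub>R axis i 1)"
  have "(?s has_real_derivative ?s' t) (at t)" for t
    using classical_partial_line[OF assms(1), of "x + h *\<^sub>R axis j 1" i t] classical_partial_line[OF assms(1), of x i t]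
    by (auto intro!: derivative_eq_intros simp: add_ac)
  then obtain \<xi> where \<xi>: "0 < \<xi>" "\<xi> < h" "?s h - ?s 0 = h * ?s' \<xi>"
    using MVT2[of 0 h ?s ?s'] assms(2) by auto
  obtain \<eta> where \<eta>: "0 < \<eta>" "\<eta> < h" "?s' \<xi> = h * pd j (pd i \<phi>) (x + \<xi> *\<^sub>R axis i 1 + \<eta> *\<^sub>R axis j 1)"
    using smooth_mvt[OF smooth_partial[OF assms(1)] assms(2)] by metis
  let ?y = "x + \<xi> *\<^sub>R axis i 1 + \<eta> *\<^sub>R axis j 1"
  have "dist x ?y = norm (\<xi> *\<^sub>R axis i 1 + \<eta> *\<^sub>R axis j (1::real))"
    unfolding dist_commute[of x] by (simp add: dist_norm add.assoc)
  also have "\<dots> \<le> \<xi> + \<eta>"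
    using norm_triangle_ineq[of "\<xi> *\<^sub>R axis i 1" "\<eta> *\<^sub>R axis j (1::real)"] \<xi> \<eta> by simp
  also have "\<dots> < 2 * h" using \<xi> \<eta> by simp
  finally have "dist x ?y < 2 * h" .
  moreover have "?s h - ?s 0 = h\<^sup>2 * pd j (pd i \<phi>) ?y"
    using \<xi> \<eta> by (simp add: power2_eq_square)
  ultimately show ?thesis using that[of ?y] by simp
qed

text \<open>
  The second difference in the directions \<open>i\<close> and \<open>j\<close> does not depend on their order. By
  \<open>second_difference\<close>, divided by \<open>h\<^sup>2\<close>, it is a value of either iterated derivative near \<open>x\<close>, and both
  are continuous.
\<close>

lemma classical_partial_commute:
  assumes "smooth \<phi>"
  shows "pd i (pd j \<phi>) = pd j (pd i \<phi>)"
proof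
  fix x
  let ?f = "pd j (pd i \<phi>)" and ?g = "pd i (pd j \<phi>)"
  show "?g x = ?f x"
  proof (rule ccontr)
    assume "?g x \<noteq> ?f x"
    then have e: "0 < \<bar>?g x - ?f x\<bar> / 2" by simp
    have "continuous_on UNIV ?f" "continuous_on UNIV ?g"
      by (intro smooth_continuous smooth_partial assms)+
    then obtain d1 d2 where d: "0 < d1" "\<And>y. dist y x < d1 \<Longrightarrow> dist (?f y) (?f x) < \<bar>?g x - ?f x\<bar> / 2"
        "0 < d2" "\<And>y. dist y x < d2 \<Longrightarrow> dist (?g y) (?g x) < \<bar>?g x - ?f x\<bar> / 2"
      using e unfolding continuous_on_iff by (metis UNIV_I)
    define h where "h = min d1 d2 / 2"
    have h: "0 < h" using d by (simp add: h_def)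
    obtain y where y: "dist x y < 2 * h"
      "\<phi> (x + h *\<^sub>R axis i 1 + h *\<^sub>R axis j 1) - \<phi> (x + h *\<^sub>R axis i 1) - (\<phi> (x + h *\<^sub>R axis j 1) - \<phi> x) = h\<^sup>2 * ?f y"
      using second_difference[OF assms h] .
    obtain z where z: "dist x z < 2 * h"
      "\<phi> (x + h *\<^sub>R axis j 1 + h *\<^sub>R axis i 1) - \<phi> (x + h *\<^sub>R axis j 1) - (\<phi> (x + h *\<^sub>R axis i 1) - \<phi> x) = h\<^sup>2 * ?g z"
      using second_difference[OF assms h] .
    have "h\<^sup>2 * ?f y = h\<^sup>2 * ?g z"
      using y(2) z(2) by (simp add: algebra_simps)
    then have "?f y = ?g z" using h by simp
    moreover have "dist (?f y) (?f x) < \<bar>?g x - ?f x\<bar> / 2" "dist (?g z) (?g x) < \<bar>?g x - ?f x\<bar> / 2"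
      using y(1) z(1) by (intro d(2,4); simp add: h_def dist_commute)+
    moreover have False if "p = q" "\<bar>p - b\<bar> < \<bar>a - b\<bar> / 2" "\<bar>q - a\<bar> < \<bar>a - b\<bar> / 2" for p q a b :: real
      using that by (auto simp: abs_if split: if_splits)
    ultimately show False unfolding dist_real_def by blast
  qed
qed

section \<open>Integration by parts\<close>

lemma test_function_integrable_lborel:
  assumes "\<phi> \<in> test_functions \<Omega>"
  shows "integrable lborel \<phi>"
proof -
  let ?K = "closure {x. \<phi> x \<noteq> 0}"
  have "integrable lborel (\<lambda>x. indicator ?K x *\<^sub>R \<phi> x)"
    using assms by (intro borel_integrable_compact smooth_continuous) (auto simp: test_functions_def)
  moreover have "(\<lambda>x. indicator ?K x *\<^sub>R \<phi> x) = \<phi>"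
    using closure_subset[of "{x. \<phi> x \<noteq> 0}"] by (auto simp: indicator_def fun_eq_iff)
  ultimately show ?thesis by (simp only:)
qed

lemma test_function_integral_lborel:
  assumes "\<phi> \<in> test_functions \<Omega>" "\<Omega> \<in> sets lebesgue"
  shows "integrable (lebesgue_on \<Omega>) \<phi>" "(\<integral>x. \<phi> x \<partial>lebesgue_on \<Omega>) = (\<integral>x. \<phi> x \<partial>lborel)"
proof -
  have eq: "(\<lambda>x. indicator \<Omega> x *\<^sub>R \<phi> x) = \<phi>"
    using test_function_zero_outside[OF assms(1)] by (auto simp: indicator_def fun_eq_iff)
  have "integrable lebesgue \<phi>"
    using test_function_integrable_lborel[OF assms(1)] test_function_borel[OF assms(1)]
    by (simp add: integrable_completion)
  then show "integrable (lebesgue_on \<Omega>) \<phi>"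
    using assms(2) by (subst integrable_restrict_space) (simp_all only: eq space_completion space_lborel space_borel Int_UNIV_right)
  have "(\<integral>x. \<phi> x \<partial>lebesgue_on \<Omega>) = (\<integral>x. \<phi> x \<partial>lebesgue)"
    using assms(2) by (subst integral_restrict_space) (simp_all only: eq space_completion space_lborel space_borel Int_UNIV_right)
  also have "\<dots> = (\<integral>x. \<phi> x \<partial>lborel)"
    using test_function_borel[OF assms(1)] by (simp add: integral_completion)
  finally show "(\<integral>x. \<phi> x \<partial>lebesgue_on \<Omega>) = (\<integral>x. \<phi> x \<partial>lborel)" .
qed

text \<open>
  By translation invariance all difference quotients of \<open>\<phi>\<close> have integral zero. They are uniformly
  bounded, supported in a fixed ball and converge to the partial derivative.
\<close>

lemma integral_partial_eq_0_lborel: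
  assumes \<phi>: "\<phi> \<in> test_functions \<Omega>"
  shows "(\<integral>x. pd i \<phi> x \<partial>lborel) = 0"
proof -
  let ?e = "axis i 1 :: real ^ 'a" and ?K = "closure {x. \<phi> x \<noteq> 0}"
  define q where "q n x = real (Suc n) * (\<phi> (x + inverse (real (Suc n)) *\<^sub>R ?e) - \<phi> x)" for n x
  have [measurable]: "\<phi> \<in> borel_measurable borel" "pd i \<phi> \<in> borel_measurable borel"
    using test_function_borel[OF \<phi>] test_function_borel[OF test_function_partial[OF \<phi>]] by auto
  obtain C where C: "\<And>x. \<bar>pd i \<phi> x\<bar> \<le> C"
    using test_function_bounded[OF test_function_partial[OF \<phi>]] by blast
  have "bounded ?K" using \<phi> by (auto simp: test_functions_def compact_imp_bounded)
  then obtain R where R: "\<And>x. x \<in> ?K \<Longrightarrow> norm x \<le> R" unfolding bounded_iff by blast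
  have z: "\<phi> x = 0" if "R < norm x" for x
    using R[of x] that closure_subset[of "{x. \<phi> x \<noteq> 0}"] by (cases "\<phi> x = 0") auto
  have q0: "(\<integral>x. q n x \<partial>lborel) = 0" for n
  proof -
    let ?c = "inverse (real (Suc n)) *\<^sub>R ?e"
    have "integrable lborel \<phi>" by (rule test_function_integrable_lborel[OF \<phi>])
    then have "integrable (Measure_Space.distr lborel borel ((+) ?c)) \<phi>"
      "(\<integral>x. \<phi> x \<partial>Measure_Space.distr lborel borel ((+) ?c)) = (\<integral>x. \<phi> x \<partial>lborel)"
      by (simp_all only: lborel_distr_plus)
    then have "integrable lborel (\<lambda>x. \<phi> (x + ?c))" "(\<integral>x. \<phi> (x + ?c) \<partial>lborel) = (\<integral>x. \<phi> x \<partial>lborel)"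
      by (simp_all add: integrable_distr_eq integral_distr add.commute)
    then show ?thesis
      using \<open>integrable lborel \<phi>\<close> by (simp add: q_def del: of_nat_Suc)
  qed
  have qlim: "(\<lambda>n. q n x) \<longlonglongrightarrow> pd i \<phi> x" for x
  proof -
    have "((\<lambda>h. (\<phi> (x + (0 + h) *\<^sub>R ?e) - \<phi> (x + 0 *\<^sub>R ?e)) / h) \<longlongrightarrow> pd i \<phi> (x + 0 *\<^sub>R ?e)) (at 0)"
      using classical_partial_line[OF test_function_smooth[OF \<phi>], of x i 0] by (simp only: DERIV_def)
    moreover have "filterlim (\<lambda>n. inverse (real (Suc n))) (at 0) sequentially"
      unfolding filterlim_at using LIMSEQ_inverse_real_of_nat by (auto simp del: of_nat_Suc)
    ultimately have "(\<lambda>n. (\<phi> (x + (0 + inverse (real (Suc n))) *\<^sub>R ?e) - \<phi> (x + 0 *\<^sub>R ?e)) / inverse (real (Suc n)))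
        \<longlonglongrightarrow> pd i \<phi> (x + 0 *\<^sub>R ?e)"
      by (rule filterlim_compose)
    then show ?thesis by (simp add: q_def divide_inverse mult.commute del: of_nat_Suc)
  qed
  \<comment> \<open>The steps of the difference quotients have length at most \<open>1\<close>, hence the radius \<open>R + 1\<close>.\<close>
  have qbound: "\<bar>q n x\<bar> \<le> C * indicator (cball 0 (R + 1)) x" for n x
  proof (cases "x \<in> cball 0 (R + 1)")
    case True
    have h: "0 < inverse (real (Suc n))" by simp
    obtain \<xi> where "\<phi> (x + inverse (real (Suc n)) *\<^sub>R ?e) - \<phi> x = inverse (real (Suc n)) * pd i \<phi> (x + \<xi> *\<^sub>R ?e)"
      using smooth_mvt[OF test_function_smooth[OF \<phi>] h] by metis
    then have "q n x = pd i \<phi> (x + \<xi> *\<^sub>R ?e)"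
      by (simp add: q_def mult.assoc[symmetric] del: of_nat_Suc)
    then show ?thesis using True C by simp
  next
    case False
    let ?c = "inverse (real (Suc n)) *\<^sub>R ?e"
    have "norm ?c \<le> 1" by (simp add: field_simps)
    moreover have "norm x \<le> norm (x + ?c) + norm ?c"
      using norm_triangle_ineq4[of "x + ?c" ?c] by simp
    ultimately have "R < norm (x + ?c)" "R < norm x" using False by auto
    then show ?thesis using z False by (simp add: q_def)
  qed
  have "(\<lambda>n. \<integral>x. q n x \<partial>lborel) \<longlonglongrightarrow> (\<integral>x. pd i \<phi> x \<partial>lborel)"
  proof (rule integral_dominated_convergence[where w="\<lambda>x. C * indicator (cball 0 (R + 1)) x"])
    show "q n \<in> borel_measurable lborel" for n unfolding q_def[abs_def] by measurable
    show "integrable lborel (\<lambda>x. C * indicator (cball 0 (R + 1)) x :: real)"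
      by (intro integrable_mult_right integrable_real_indicator) (use emeasure_bounded_finite[of "cball 0 (R + 1)"] in auto)
  qed (use qlim qbound in auto)
  then show ?thesis unfolding q0 by (simp add: LIMSEQ_const_iff)
qed

lemma integral_partial_eq_0:
  assumes "\<phi> \<in> test_functions \<Omega>" "\<Omega> \<in> sets lebesgue"
  shows "(\<integral>x. pd i \<phi> x \<partial>lebesgue_on \<Omega>) = 0"
  using integral_partial_eq_0_lborel[OF assms(1)]
    test_function_integral_lborel(2)[OF test_function_partial[OF assms(1)] assms(2)] by simp

lemma test_function_L2:
  assumes "\<phi> \<in> test_functions \<Omega>" "\<Omega> \<in> sets lebesgue"
  shows "\<phi> \<in> L2_space \<Omega>"
  using test_function_integral_lborel(1)[OF test_function_mult[OF test_function_smooth[OF assms(1)] assms(1)] assms(2)]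
    test_function_measurable[OF assms(1)]
  by (simp add: L2_space_def power2_eq_square)

lemma integral_by_parts:
  assumes "\<phi> \<in> test_functions \<Omega>" "\<psi> \<in> test_functions \<Omega>" "\<Omega> \<in> sets lebesgue"
  shows "L2_inner \<Omega> (pd i \<phi>) \<psi> = - L2_inner \<Omega> \<phi> (pd i \<psi>)"
proof -
  note L2 = test_function_L2[OF _ assms(3)]
  have d: "\<phi> differentiable (at x)" "\<psi> differentiable (at x)" for x
    using assms smooth_differentiable test_function_smooth by blast+
  have "0 = (\<integral>x. pd i (\<lambda>x. \<phi> x * \<psi> x) x \<partial>lebesgue_on \<Omega>)"
    using assms by (intro integral_partial_eq_0[symmetric] test_function_mult test_function_smooth)
  also have "\<dots> = (\<integral>x. \<phi> x * pd i \<psi> x + pd i \<phi> x * \<psi> x \<partial>lebesgue_on \<Omega>)"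
    by (simp add: classical_partial_mult[OF d])
  also have "\<dots> = L2_inner \<Omega> \<phi> (pd i \<psi>) + L2_inner \<Omega> (pd i \<phi>) \<psi>"
    using L2_integrable_inner[OF L2 L2, OF assms(1) test_function_partial[OF assms(2)]]
      L2_integrable_inner[OF L2 L2, OF test_function_partial[OF assms(1)] assms(2)]
    by (simp add: L2_inner_def)
  finally show ?thesis by simp
qed

section \<open>The fundamental lemma of the calculus of variations\<close>

lemma locally_integrable_times_test_function:
  assumes f: "locally_integrable \<Omega> f" and \<phi>: "\<phi> \<in> test_functions \<Omega>" and \<Omega>: "\<Omega> \<in> sets lebesgue"
  shows "integrable (lebesgue_on \<Omega>) (\<lambda>x. f x * \<phi> x)"
proof -
  let ?K = "closure {x. \<phi> x \<noteq> 0}"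
  have K: "compact ?K" "?K \<subseteq> \<Omega>" using \<phi> by (auto simp: test_functions_def)
  then have Ks: "?K \<in> sets lebesgue" by (simp add: compact_imp_closed)
  obtain C where C: "\<And>x. \<bar>\<phi> x\<bar> \<le> C" using test_function_bounded[OF \<phi>] by blast
  have int: "integrable (lebesgue_on ?K) f" using f K by (simp add: locally_integrable_def)
  have "integrable (lebesgue_on ?K) (\<lambda>x. f x * \<phi> x)"
  proof (rule Bochner_Integration.integrable_bound)
    show "integrable (lebesgue_on ?K) (\<lambda>x. C * f x)" using int by simp
    show "(\<lambda>x. f x * \<phi> x) \<in> borel_measurable (lebesgue_on ?K)"
      using int test_function_measurable[OF \<phi>] by auto
    have "\<bar>f x\<bar> * \<bar>\<phi> x\<bar> \<le> \<bar>f x\<bar> * \<bar>C\<bar>" for x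
      using C[of x] by (intro mult_left_mono) auto
    then show "AE x in lebesgue_on ?K. norm (f x * \<phi> x) \<le> norm (C * f x)"
      by (simp add: abs_mult mult.commute)
  qed
  then have "integrable lebesgue (\<lambda>x. indicator ?K x *\<^sub>R (f x * \<phi> x))"
    using Ks by (simp add: integrable_restrict_space)
  moreover have "(\<lambda>x. indicator ?K x *\<^sub>R (f x * \<phi> x)) = (\<lambda>x. indicator \<Omega> x *\<^sub>R (f x * \<phi> x))"
    using closure_subset[of "{x. \<phi> x \<noteq> 0}"] K by (auto simp: indicator_def fun_eq_iff)
  ultimately show ?thesis using \<Omega> by (simp add: integrable_restrict_space)
qed

text \<open>
  Test with the bump functions of the box and pass to the limit by dominated convergence.
\<close>

lemma integral_cbox_eq_0:
  assumes \<Omega>: "open \<Omega>" and g: "locally_integrable \<Omega> g"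
    and 0: "\<And>\<phi>. \<phi> \<in> test_functions \<Omega> \<Longrightarrow> distr \<Omega> g \<phi> = 0"
    and sub: "cbox a b \<subseteq> \<Omega>"
  shows "integral (cbox a b) g = 0"
proof -
  have \<Omega>s: "\<Omega> \<in> sets lebesgue" using \<Omega> by simp
  have int: "integrable (lebesgue_on (cbox a b)) g"
    using g sub by (simp add: locally_integrable_def)
  then have "integrable lebesgue (\<lambda>x. indicator (cbox a b) x *\<^sub>R g x)"
    by (simp add: integrable_restrict_space)
  moreover have "(\<lambda>x. indicator (cbox a b) x *\<^sub>R g x) = (\<lambda>x. indicator \<Omega> x *\<^sub>R (indicator (cbox a b) x *\<^sub>R g x))"
    using sub by (auto simp: indicator_def fun_eq_iff)
  ultimately have dom: "integrable (lebesgue_on \<Omega>) (\<lambda>x. indicator (cbox a b) x *\<^sub>R g x)"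
    using \<Omega>s by (subst integrable_restrict_space) (simp_all only: space_completion space_lborel space_borel Int_UNIV_right)
  have meas: "(\<lambda>x. g x * box_bump a b n x) \<in> borel_measurable (lebesgue_on \<Omega>)" for n
    using locally_integrable_times_test_function[OF g box_bump_test_function[OF sub] \<Omega>s] by auto
  have lim: "(\<lambda>n. g x * box_bump a b n x) \<longlonglongrightarrow> g x * indicator (box a b) x" for x
    by (intro tendsto_intros box_bump_tendsto)
  have "(\<lambda>n. \<integral>x. g x * box_bump a b n x \<partial>lebesgue_on \<Omega>) \<longlonglongrightarrow> (\<integral>x. g x * indicator (box a b) x \<partial>lebesgue_on \<Omega>)"
  proof (rule integral_dominated_convergence[where w="\<lambda>x. \<bar>indicator (cbox a b) x *\<^sub>R g x\<bar>"])
    show "(\<lambda>x. g x * indicator (box a b) x) \<in> borel_measurable (lebesgue_on \<Omega>)"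
      by (rule borel_measurable_LIMSEQ_real[OF lim meas])
    show "AE x in lebesgue_on \<Omega>. norm (g x * box_bump a b n x) \<le> \<bar>indicator (cbox a b) x *\<^sub>R g x\<bar>" for n
    proof (rule AE_I2)
      fix x
      show "norm (g x * box_bump a b n x) \<le> \<bar>indicator (cbox a b) x *\<^sub>R g x\<bar>"
        using box_bump_bounds[of a b n x] box_bump_eq_0[of x a b n] box_subset_cbox[of a b]
        by (cases "x \<in> box a b") (auto simp: abs_mult mult_left_le)
    qed
  qed (use meas lim dom in auto)
  moreover have "(\<integral>x. g x * box_bump a b n x \<partial>lebesgue_on \<Omega>) = 0" for n
    using 0[OF box_bump_test_function[OF sub]] by (simp add: distr_def)
  ultimately have "(\<integral>x. g x * indicator (box a b) x \<partial>lebesgue_on \<Omega>) = 0"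
    by (simp add: LIMSEQ_const_iff)
  moreover have "(\<integral>x. g x * indicator (box a b) x \<partial>lebesgue_on \<Omega>) = (\<integral>x. g x \<partial>lebesgue_on (box a b))"
    using integral_restrict[of "box a b" \<Omega> g] sub box_subset_cbox[of a b] \<Omega>s
    by (simp add: indicator_def if_distrib[of "\<lambda>t. g _ * t"] of_bool_def cong: if_cong)
  moreover have "integrable (lebesgue_on (box a b)) g"
  proof -
    have "integrable lebesgue (\<lambda>x. indicator (box a b) x *\<^sub>R (indicator (cbox a b) x *\<^sub>R g x))"
      by (rule integrable_mult_indicator) (use \<open>integrable lebesgue (\<lambda>x. indicator (cbox a b) x *\<^sub>R g x)\<close> in auto)
    moreover have "(\<lambda>x. indicator (box a b) x *\<^sub>R (indicator (cbox a b) x *\<^sub>R g x)) = (\<lambda>x. indicator (box a b) x *\<^sub>R g x)"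
      using box_subset_cbox[of a b] by (auto simp: indicator_def fun_eq_iff)
    ultimately show ?thesis by (simp add: integrable_restrict_space)
  qed
  ultimately have "integral (box a b) g = 0"
    by (simp add: lebesgue_integral_eq_integral)
  then show ?thesis by (simp add: integral_open_interval)
qed

text \<open>
  The integral over each small box vanishes, so by Lebesgue differentiation the function vanishes
  almost everywhere.
\<close>

lemma negligible_nonzero_cbox:
  assumes \<Omega>: "open \<Omega>" and g: "locally_integrable \<Omega> g"
    and 0: "\<And>\<phi>. \<phi> \<in> test_functions \<Omega> \<Longrightarrow> distr \<Omega> g \<phi> = 0"
    and sub: "cbox c d \<subseteq> \<Omega>"
  shows "negligible {x \<in> cbox c d. g x \<noteq> 0}"
proof -
  define f where "f x = (if x \<in> cbox c d then g x else 0)" for x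
  have "integrable (lebesgue_on (cbox c d)) g"
    using g sub by (simp add: locally_integrable_def)
  then have "g integrable_on cbox c d" by (simp add: integrable_on_lebesgue_on)
  then have "f integrable_on UNIV" unfolding f_def[abs_def] integrable_restrict_UNIV .
  then have "f integrable_on cbox a b" for a b
    by (rule integrable_on_subcbox) simp
  then obtain N where N: "negligible N"
    "\<And>x e. x \<notin> N \<Longrightarrow> 0 < e \<Longrightarrow> \<exists>d>0. \<forall>h. 0 < h \<and> h < d \<longrightarrow>
        norm (integral (cbox x (x + h *\<^sub>R One)) f /\<^sub>R h ^ DIM(real ^ 'a) - f x) < e"
    using integrable_ccontinuous_explicit[of f] by metis
  \<comment> \<open>The limit of the averages over boxes with lower corner \<open>x\<close> is \<open>f x\<close>, and they are \<open>0\<close> once the boxes fit.\<close>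
  have "f x = 0" if x: "x \<in> box c d" "x \<notin> N" for x
  proof (rule ccontr)
    assume "f x \<noteq> 0"
    then have "0 < \<bar>f x\<bar>" by simp
    from N(2)[OF x(2) this] obtain \<delta> where \<delta>: "0 < \<delta>"
      "\<And>h. 0 < h \<Longrightarrow> h < \<delta> \<Longrightarrow> norm (integral (cbox x (x + h *\<^sub>R One)) f /\<^sub>R h ^ DIM(real ^ 'a) - f x) < \<bar>f x\<bar>"
      by blast
    have "((\<lambda>h. x + h *\<^sub>R One) \<longlongrightarrow> x + 0 *\<^sub>R One) (at_right 0)"
      by (intro tendsto_intros)
    then have "\<forall>\<^sub>F h in at_right 0. x + h *\<^sub>R One \<in> box c d"
      using x(1) topological_tendstoD[OF _ open_box] by fastforce
    moreover have "\<forall>\<^sub>F h in at_right 0. 0 < h \<and> h < \<delta>"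
      using \<delta>(1) by (auto simp: eventually_at_right intro!: exI[of _ \<delta>])
    ultimately have "\<forall>\<^sub>F h in at_right (0::real). x + h *\<^sub>R One \<in> box c d \<and> 0 < h \<and> h < \<delta>"
      by eventually_elim simp
    then obtain h where h: "x + h *\<^sub>R One \<in> box c d" "0 < h" "h < \<delta>"
      using eventually_happens[of _ "at_right (0::real)"] by auto
    have small: "cbox x (x + h *\<^sub>R One) \<subseteq> cbox c d"
      using x(1) h(1) by (auto simp: mem_box) (meson less_imp_le order.trans)+
    then have "integral (cbox x (x + h *\<^sub>R One)) f = integral (cbox x (x + h *\<^sub>R One)) g"
      by (intro integral_cong) (auto simp: f_def)
    also have "\<dots> = 0" using small sub by (intro integral_cbox_eq_0[OF \<Omega> g 0]) auto
    finally show False using \<delta>(2)[OF h(2,3)] by simp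
  qed
  then have "g x = 0" if "x \<in> box c d" "x \<notin> N" for x
    using that box_subset_cbox[of c d] by (fastforce simp: f_def)
  then have "{x \<in> cbox c d. g x \<noteq> 0} \<subseteq> N \<union> (cbox c d - box c d)" by blast
  then show ?thesis
    using N(1) negligible_frontier_interval[of c d] negligible_Un negligible_subset by blast
qed

lemma fundamental_lemma:
  assumes \<Omega>: "open \<Omega>" and g: "locally_integrable \<Omega> g"
    and 0: "\<And>\<phi>. \<phi> \<in> test_functions \<Omega> \<Longrightarrow> distr \<Omega> g \<phi> = 0"
  shows "AE x in lebesgue_on \<Omega>. g x = 0"
proof -
  obtain D where D: "countable D" "D \<subseteq> Pow \<Omega>" "\<And>X. X \<in> D \<Longrightarrow> \<exists>a b. X = cbox a b" "\<Union>D = \<Omega>"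
    using open_countable_Union_open_cbox[OF \<Omega>] by metis
  have "negligible (\<Union>X\<in>D. {x \<in> X. g x \<noteq> 0})"
  proof (rule negligible_countable_Union)
    show "countable ((\<lambda>X. {x \<in> X. g x \<noteq> 0}) ` D)" using D(1) by simp
    fix T assume "T \<in> (\<lambda>X. {x \<in> X. g x \<noteq> 0}) ` D"
    then obtain a b where "T = {x \<in> cbox a b. g x \<noteq> 0}" "cbox a b \<subseteq> \<Omega>" using D(2,3) by fastforce
    then show "negligible T" using negligible_nonzero_cbox[OF \<Omega> g 0] by simp
  qed
  moreover have "(\<Union>X\<in>D. {x \<in> X. g x \<noteq> 0}) = {x \<in> \<Omega>. g x \<noteq> 0}" using D(4) by blast
  ultimately have "{x \<in> \<Omega>. g x \<noteq> 0} \<in> null_sets lebesgue" by (simp add: negligible_iff_null_sets)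
  then have "AE x in lebesgue. x \<notin> {x \<in> \<Omega>. g x \<noteq> 0}" by (rule AE_not_in)
  then have "AE x in lebesgue. x \<in> \<Omega> \<longrightarrow> g x = 0" by eventually_elim auto
  then show ?thesis using \<Omega> by (simp add: AE_restrict_space_iff)
qed

section \<open>The elasticity tensor\<close>

definition elasticity2 :: "real \<Rightarrow> real \<Rightarrow> real ^ 'n ^ 'n \<Rightarrow> real ^ 'n ^ ('n::finite)" where
  "elasticity2 \<mu> lam E = (2 * \<mu>) *\<^sub>R E + (lam * trace E) *\<^sub>R mat 1"

definition elasticity3 :: "real \<Rightarrow> real \<Rightarrow> real ^ 'n ^ 'n ^ 'n \<Rightarrow> real ^ 'n ^ 'n ^ ('n::finite)" where
  "elasticity3 \<mu> lam E = (2 * \<mu>) *\<^sub>R E + lam *\<^sub>R tensor_prod (mat 1) (trace3 E)"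

lemma inner_mat_1: "mat 1 \<bullet> (F :: real ^ 'n ^ 'n) = trace F"
  by (simp add: inner_vec_def mat_def trace_def if_distrib[of "\<lambda>a. a * _"] cong: if_cong)

lemma inner_tensor_prod_mat_1: "tensor_prod (mat 1) t \<bullet> (F :: real ^ 'n ^ 'n ^ 'n) = t \<bullet> trace3 F"
proof -
  have "tensor_prod (mat 1) t \<bullet> F = (\<Sum>i\<in>UNIV. \<Sum>j\<in>UNIV. \<Sum>k\<in>UNIV. (if i = j then t $ k * F $ i $ j $ k else 0))"
    by (simp add: inner_vec_def tensor_prod_def mat_def if_distrib[of "\<lambda>a. a * _"] cong: if_cong)
  also have "\<dots> = (\<Sum>i\<in>UNIV. \<Sum>j\<in>UNIV. (if i = j then \<Sum>k\<in>UNIV. t $ k * F $ i $ j $ k else 0))"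
    by (intro sum.cong) auto
  also have "\<dots> = (\<Sum>i\<in>UNIV. \<Sum>k\<in>UNIV. t $ k * F $ i $ i $ k)" by simp
  also have "\<dots> = (\<Sum>k\<in>UNIV. t $ k * (\<Sum>i\<in>UNIV. F $ i $ i $ k))"
    by (subst sum.swap) (simp add: sum_distrib_left)
  finally show ?thesis by (simp add: inner_vec_def trace3_def)
qed

lemma elasticity2_inner: "elasticity2 \<mu> lam E \<bullet> F = 2 * \<mu> * (E \<bullet> F) + lam * (trace E * trace F)"
  by (simp add: elasticity2_def inner_add_left inner_mat_1)

lemma elasticity3_inner:
  "elasticity3 \<mu> lam E \<bullet> F = 2 * \<mu> * (E \<bullet> F) + lam * (trace3 E \<bullet> trace3 F)"
  by (simp add: elasticity3_def inner_add_left inner_tensor_prod_mat_1)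

lemma trace3_tensor_prod: "trace3 (tensor_prod (mat 1) t) = real CARD('n) *\<^sub>R (t :: real ^ 'n::finite)"
  by (simp add: vec_eq_iff trace3_def tensor_prod_def mat_def)

lemma trace3_add: "trace3 (A + B) = trace3 A + trace3 B"
  by (simp add: vec_eq_iff trace3_def sum.distrib)

lemma trace3_scaleR: "trace3 (c *\<^sub>R A) = c *\<^sub>R trace3 A"
  by (simp add: vec_eq_iff trace3_def sum_distrib_left)

text \<open>
  Applying the elasticity tensor multiplies the trace by \<open>2\<mu> + d \<lambda>\<close>, the denominator in the
  definition of the compliance tensor.
\<close>

lemma compliance_elasticity3:
  fixes E :: "real ^ 'n ^ 'n ^ ('n::finite)"
  assumes "\<mu> > 0" "lam > 0"
  shows "compliance \<mu> lam (elasticity3 \<mu> lam E) = E"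
proof -
  have pos: "0 < 2 * \<mu> + real CARD('n) * lam" using assms by (simp add: add_pos_nonneg)
  have tr: "trace3 (elasticity3 \<mu> lam E) = (2 * \<mu> + real CARD('n) * lam) *\<^sub>R trace3 E"
    by (simp add: elasticity3_def trace3_add trace3_scaleR trace3_tensor_prod scaleR_add_left mult.commute)
  have "tensor_prod (mat 1) (c *\<^sub>R t) = c *\<^sub>R tensor_prod (mat 1) t" for c and t :: "real ^ 'n"
    by (simp add: vec_eq_iff tensor_prod_def)
  then show ?thesis
    using assms pos by (simp add: compliance_def tr) (simp add: elasticity3_def)
qed

text \<open>Cauchy-Schwarz for \<open>E\<close> and the tensor \<open>I \<otimes> tr E\<close>, whose squared norm is \<open>d |tr E|\<^sup>2\<close>.\<close>

lemma trace3_bound: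
  fixes E :: "real ^ 'n ^ 'n ^ ('n::finite)"
  shows "trace3 E \<bullet> trace3 E \<le> real CARD('n) * (E \<bullet> E)"
proof -
  have "tensor_prod (mat 1) (trace3 E) \<bullet> E = trace3 E \<bullet> trace3 E"
    by (rule inner_tensor_prod_mat_1)
  moreover have "tensor_prod (mat 1) (trace3 E) \<bullet> tensor_prod (mat 1) (trace3 E) = real CARD('n) * (trace3 E \<bullet> trace3 E)"
    by (simp add: inner_tensor_prod_mat_1 trace3_tensor_prod)
  ultimately have "(trace3 E \<bullet> trace3 E)\<^sup>2 \<le> real CARD('n) * (trace3 E \<bullet> trace3 E) * (E \<bullet> E)"
    using Cauchy_Schwarz_ineq[of "tensor_prod (mat 1) (trace3 E)" E] by simp
  then have "(trace3 E \<bullet> trace3 E) * (trace3 E \<bullet> trace3 E) \<le> (trace3 E \<bullet> trace3 E) * (real CARD('n) * (E \<bullet> E))"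
    by (simp add: power2_eq_square mult_ac)
  then show ?thesis
    using mult_le_cancel_left_pos[of "trace3 E \<bullet> trace3 E"] inner_ge_zero[of "trace3 E"]
    by (cases "trace3 E \<bullet> trace3 E = 0") (auto simp: less_le)
qed

lemma compliance_inner:
  fixes E F :: "real ^ 'n ^ 'n ^ ('n::finite)"
  shows "compliance \<mu> lam E \<bullet> F
    = (1 / (2 * \<mu>)) * (E \<bullet> F - lam / (2 * \<mu> + real CARD('n) * lam) * (trace3 E \<bullet> trace3 F))"
  by (simp add: compliance_def inner_diff_left inner_tensor_prod_mat_1)

text \<open>
  By \<open>trace3_bound\<close> the trace term takes away at most the fraction \<open>d \<lambda> / (2\<mu> + d \<lambda>) < 1\<close> of \<open>|E|\<^sup>2\<close>.
\<close>

lemma compliance_positive: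
  fixes E :: "real ^ 'n ^ 'n ^ ('n::finite)"
  assumes "\<mu> > 0" "lam > 0"
  shows "E \<bullet> E \<le> (2 * \<mu> + real CARD('n) * lam) * (compliance \<mu> lam E \<bullet> E)"
proof -
  let ?s = "2 * \<mu> + real CARD('n) * lam"
  have s: "0 < ?s" using assms by (simp add: add_pos_nonneg)
  have "2 * \<mu> * (E \<bullet> E) \<le> ?s * (E \<bullet> E) - lam * (trace3 E \<bullet> trace3 E)"
    using mult_left_mono[OF trace3_bound[of E], of lam] assms by (simp add: algebra_simps)
  also have "\<dots> = 2 * \<mu> * (?s * (compliance \<mu> lam E \<bullet> E))"
  proof -
    have "s * X - lam * Y = 2 * \<mu> * (s * (1 / (2 * \<mu>) * (X - lam / s * Y)))" if "0 < s" for s X Y :: real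
      using that assms by (simp add: field_simps)
    from this[OF s] show ?thesis unfolding compliance_inner .
  qed
  finally show ?thesis using assms by simp
qed

lemma L2_vec3D: "\<Psi> \<in> L2_space \<Omega> \<Longrightarrow> (\<lambda>x. \<Psi> x $ i $ j $ k) \<in> L2_space \<Omega>"
  for \<Psi> :: "'n::finite tensor3_field"
  by (simp add: L2_space_vec_iff)

lemma L2_trace3: "\<Psi> \<in> L2_space \<Omega> \<Longrightarrow> (\<lambda>x. trace3 (\<Psi> x)) \<in> L2_space \<Omega>"
  for \<Psi> :: "'n::finite tensor3_field"
  by (simp add: L2_space_vec_iff[where 'm='n] trace3_def L2_sum)

lemma L2_tensor_prod_mat_1: "t \<in> L2_space \<Omega> \<Longrightarrow> (\<lambda>x. tensor_prod (mat 1) (t x)) \<in> L2_space \<Omega>"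
  for t :: "'n::finite vector_field"
  by (simp add: L2_space_vec_iff tensor_prod_def L2_cmult)

lemma L2_elasticity3: "\<Psi> \<in> L2_space \<Omega> \<Longrightarrow> (\<lambda>x. elasticity3 \<mu> lam (\<Psi> x)) \<in> L2_space \<Omega>"
  for \<Psi> :: "'n::finite tensor3_field"
  unfolding elasticity3_def by (intro L2_add L2_scaleR L2_tensor_prod_mat_1 L2_trace3)

lemma L2_compliance: "\<Psi> \<in> L2_space \<Omega> \<Longrightarrow> (\<lambda>x. compliance \<mu> lam (\<Psi> x)) \<in> L2_space \<Omega>"
  for \<Psi> :: "'n::finite tensor3_field"
  unfolding compliance_def by (intro L2_diff L2_scaleR L2_tensor_prod_mat_1 L2_trace3)

lemma L2_elasticity2: "\<tau> \<in> L2_space \<Omega> \<Longrightarrow> (\<lambda>x. elasticity2 \<mu> lam (\<tau> x)) \<in> L2_space \<Omega>"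
  for \<tau> :: "'n::finite tensor2_field"
proof -
  assume \<tau>: "\<tau> \<in> L2_space \<Omega>"
  have tr: "(\<lambda>x. trace (\<tau> x)) \<in> L2_space \<Omega>"
    unfolding trace_def using \<tau> by (intro L2_sum) (simp add: L2_space_vec_iff)
  have "(\<lambda>x. (lam * trace (\<tau> x)) *\<^sub>R (mat 1 :: real ^ 'n ^ 'n)) \<in> L2_space \<Omega>"
    using L2_cmult[OF L2_cmult[OF tr], of _ lam] by (simp add: L2_space_vec_iff mult.commute[of "_ * _" "mat 1 $ _ $ _"])
  then show ?thesis
    unfolding elasticity2_def by (intro L2_add L2_scaleR \<tau>)
qed

lemma L2_inner_elasticity3_commute:
  "L2_inner \<Omega> (\<lambda>x. elasticity3 \<mu> lam (\<Psi> x)) \<Theta> = L2_inner \<Omega> (\<lambda>x. elasticity3 \<mu> lam (\<Theta> x)) \<Psi>"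
  by (simp add: L2_inner_def elasticity3_inner inner_commute[of "\<Theta> _"] inner_commute[of "trace3 (\<Theta> _)"])

lemma L2_inner_elasticity2_commute:
  "L2_inner \<Omega> (\<lambda>x. elasticity2 \<mu> lam (\<sigma> x)) \<tau> = L2_inner \<Omega> (\<lambda>x. elasticity2 \<mu> lam (\<tau> x)) \<sigma>"
  by (simp add: L2_inner_def elasticity2_inner inner_commute[of "\<tau> _"] mult.commute[of "trace (\<tau> _)"])

lemma elasticity3_axpy: "elasticity3 \<mu> lam (A + c *\<^sub>R B) = elasticity3 \<mu> lam A + c *\<^sub>R elasticity3 \<mu> lam B"
  by (simp add: vec_eq_iff elasticity3_def tensor_prod_def trace3_add trace3_scaleR algebra_simps)

lemma elasticity2_axpy: "elasticity2 \<mu> lam (A + c *\<^sub>R B) = elasticity2 \<mu> lam A + c *\<^sub>R elasticity2 \<mu> lam B"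
  by (simp add: vec_eq_iff elasticity2_def trace_def sum.distrib sum_distrib_left[symmetric] algebra_simps)

lemma L2_inner_elasticity3_coercive:
  fixes \<Psi> :: "'n::finite tensor3_field"
  assumes "\<Psi> \<in> L2_space \<Omega>" "0 \<le> lam"
  shows "2 * \<mu> * L2_inner \<Omega> \<Psi> \<Psi> \<le> L2_inner \<Omega> (\<lambda>x. elasticity3 \<mu> lam (\<Psi> x)) \<Psi>"
proof -
  have "L2_inner \<Omega> (\<lambda>x. (2 * \<mu>) *\<^sub>R \<Psi> x) \<Psi> \<le> L2_inner \<Omega> (\<lambda>x. elasticity3 \<mu> lam (\<Psi> x)) \<Psi>"
    using assms by (intro L2_inner_mono L2_scaleR L2_elasticity3) (simp_all add: elasticity3_inner)
  then show ?thesis by (simp add: L2_inner_scaleR_left)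
qed

lemma L2_inner_elasticity2_coercive:
  fixes \<tau> :: "'n::finite tensor2_field"
  assumes "\<tau> \<in> L2_space \<Omega>" "0 \<le> lam"
  shows "2 * \<mu> * L2_sq \<Omega> \<tau> \<le> L2_inner \<Omega> (\<lambda>x. elasticity2 \<mu> lam (\<tau> x)) \<tau>"
proof -
  have "L2_inner \<Omega> (\<lambda>x. (2 * \<mu>) *\<^sub>R \<tau> x) \<tau> \<le> L2_inner \<Omega> (\<lambda>x. elasticity2 \<mu> lam (\<tau> x)) \<tau>"
    using assms by (intro L2_inner_mono L2_scaleR L2_elasticity2) (simp_all add: elasticity2_inner)
  then show ?thesis by (simp add: L2_inner_scaleR_left)
qed

section \<open>Minimising sequences of quadratic functionals\<close>

text \<open>
  The quadratic functional \<open>J v = a v v - 2 L v\<close> is bounded below. The parallelogram identity makes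
  a minimising sequence Cauchy for \<open>a\<close>, and along it the first variation of \<open>J\<close> tends to \<open>0\<close>.
\<close>

lemma minimising_sequence:
  fixes T :: "('a \<Rightarrow> 'b::real_vector) set" and a :: "('a \<Rightarrow> 'b) \<Rightarrow> ('a \<Rightarrow> 'b) \<Rightarrow> real"
  assumes "T \<noteq> {}"
    and T: "\<And>v w c. v \<in> T \<Longrightarrow> w \<in> T \<Longrightarrow> (\<lambda>x. v x + c *\<^sub>R w x) \<in> T"
    and a_lin: "\<And>u v w c. u \<in> T \<Longrightarrow> v \<in> T \<Longrightarrow> w \<in> T \<Longrightarrow> a (\<lambda>x. v x + c *\<^sub>R w x) u = a v u + c * a w u"
    and a_sym: "\<And>v w. v \<in> T \<Longrightarrow> w \<in> T \<Longrightarrow> a v w = a w v"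
    and L_lin: "\<And>v w c. v \<in> T \<Longrightarrow> w \<in> T \<Longrightarrow> L (\<lambda>x. v x + c *\<^sub>R w x) = L v + c * L w"
    and a_nonneg: "\<And>v. v \<in> T \<Longrightarrow> 0 \<le> a v v"
    and bound: "\<And>v. v \<in> T \<Longrightarrow> (L v)\<^sup>2 \<le> C * a v v" and "0 \<le> C"
  obtains V where "\<And>n. V n \<in> T"
    "\<And>e. 0 < e \<Longrightarrow> \<exists>N. \<forall>m\<ge>N. \<forall>n\<ge>N. a (\<lambda>x. V m x - V n x) (\<lambda>x. V m x - V n x) < e"
    "\<And>\<phi>. \<phi> \<in> T \<Longrightarrow> (\<lambda>n. a (V n) \<phi>) \<longlonglongrightarrow> L \<phi>"
proof -
  define J where "J v = a v v - 2 * L v" for v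
  have line: "J (\<lambda>x. v x + c *\<^sub>R w x) = J v + 2 * c * (a v w - L w) + c\<^sup>2 * a w w"
    if "v \<in> T" "w \<in> T" for v w c
  proof -
    note vw = T[OF that, of c]
    have "a (\<lambda>x. v x + c *\<^sub>R w x) (\<lambda>x. v x + c *\<^sub>R w x)
        = a v (\<lambda>x. v x + c *\<^sub>R w x) + c * a w (\<lambda>x. v x + c *\<^sub>R w x)"
      by (rule a_lin[OF vw that])
    also have "\<dots> = (a v v + c * a w v) + c * (a v w + c * a w w)"
      using a_sym[OF that(1) vw] a_sym[OF that(2) vw] a_lin[OF that(1) that] a_lin[OF that(2) that] by simp
    finally show ?thesis
      using L_lin[OF that] a_sym[OF that] by (simp add: J_def power2_eq_square algebra_simps)
  qed
  have lower: "- C \<le> J v" if "v \<in> T" for v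
  proof -
    have "(2 * L v)\<^sup>2 \<le> 4 * (C * a v v)" using bound[OF that] by (simp add: power_mult_distrib)
    also have "\<dots> \<le> (a v v + C)\<^sup>2"
      using zero_le_power2[of "a v v - C"] by (simp add: power2_eq_square algebra_simps)
    finally have "2 * L v \<le> a v v + C"
      by (rule power2_le_imp_le) (use a_nonneg[OF that] \<open>0 \<le> C\<close> in simp)
    then show ?thesis by (simp add: J_def)
  qed
  define j where "j = Inf (J ` T)"
  have bdd: "bdd_below (J ` T)" using lower by (intro bdd_belowI2)
  have j: "j \<le> J v" if "v \<in> T" for v unfolding j_def using bdd that by (intro cInf_lower) auto
  define \<delta> where "\<delta> n = inverse (real (Suc n))" for n
  have \<delta>: "0 < \<delta> n" for n by (simp add: \<delta>_def)
  have \<delta>0: "\<delta> \<longlonglongrightarrow> 0" unfolding \<delta>_def[abs_def] by (rule LIMSEQ_inverse_real_of_nat)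
  have "\<exists>v\<in>T. J v < j + \<delta> n" for n
    using cInf_lessD[of "J ` T" "j + \<delta> n"] \<open>T \<noteq> {}\<close> \<delta>[of n] by (auto simp: j_def)
  then obtain V where V: "\<And>n. V n \<in> T" "\<And>n. J (V n) < j + \<delta> n" by metis
  show thesis
  proof (rule that[of V])
    show "V n \<in> T" for n by (rule V(1))
    have quad: "a (\<lambda>x. V m x - V n x) (\<lambda>x. V m x - V n x) \<le> 2 * (\<delta> m + \<delta> n)" for m n
    proof -
      \<comment> \<open>Compare \<open>J\<close> at \<open>V m\<close>, at \<open>V n = V m - D\<close> and at their midpoint \<open>V m - D / 2\<close>.\<close>
      define D where "D = (\<lambda>x. V m x + (-1) *\<^sub>R V n x)"
      have D: "D \<in> T" unfolding D_def by (rule T[OF V(1) V(1)])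
      have "j \<le> J (\<lambda>x. V m x + (- 1 / 2) *\<^sub>R D x)" by (intro j T V(1) D)
      then have "j \<le> J (V m) - (a (V m) D - L D) + a D D / 4"
        unfolding line[OF V(1) D] by (simp add: power2_eq_square)
      moreover have "J (V n) = J (V m) - 2 * (a (V m) D - L D) + a D D"
        using line[OF V(1) D, of m "-1"] by (simp add: D_def)
      moreover have "A \<le> 2 * (dm + dn)" if "j \<le> x - r + A / 4" "y = x - 2 * r + A" "x < j + dm" "y < j + dn"
        for A dm dn x y r :: real
      proof -
        have "2 * j \<le> 2 * x - 2 * r + A / 2" using that(1) by argo
        moreover have "x + y < 2 * j + (dm + dn)" using that(3,4) by argo
        ultimately show ?thesis using that(2) by argo
      qed
      ultimately have "a D D \<le> 2 * (\<delta> m + \<delta> n)" using V(2)[of m] V(2)[of n] by blast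
      then show ?thesis by (simp add: D_def)
    qed
    fix e :: real assume "0 < e"
    then have "\<forall>\<^sub>F n in sequentially. \<delta> n < e / 4" using order_tendstoD(2)[OF \<delta>0, of "e / 4"] by simp
    then obtain N where N: "\<And>n. n \<ge> N \<Longrightarrow> \<delta> n < e / 4" unfolding eventually_sequentially by blast
    have "a (\<lambda>x. V m x - V n x) (\<lambda>x. V m x - V n x) < e" if "m \<ge> N" "n \<ge> N" for m n
      using quad[of m n] N[OF that(1)] N[OF that(2)] by argo
    then show "\<exists>N. \<forall>m\<ge>N. \<forall>n\<ge>N. a (\<lambda>x. V m x - V n x) (\<lambda>x. V m x - V n x) < e" by blast
  next
    fix \<phi> assume \<phi>: "\<phi> \<in> T"
    have "(a (V n) \<phi> - L \<phi>)\<^sup>2 \<le> \<delta> n * a \<phi> \<phi>" for n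
    proof (rule discriminant_le[OF _ a_nonneg[OF \<phi>]])
      fix t
      have "j \<le> J (V n) + 2 * t * (a (V n) \<phi> - L \<phi>) + t\<^sup>2 * a \<phi> \<phi>"
        using j[OF T[OF V(1) \<phi>]] line[OF V(1) \<phi>] by metis
      then show "0 \<le> \<delta> n + 2 * t * (a (V n) \<phi> - L \<phi>) + t\<^sup>2 * a \<phi> \<phi>" using V(2)[of n] by linarith
    qed
    then have "(\<lambda>n. a (V n) \<phi> - L \<phi>) \<longlonglongrightarrow> 0"
      by (rule tendsto_0_of_square_le) (use tendsto_mult[OF \<delta>0 tendsto_const] in simp)
    then show "(\<lambda>n. a (V n) \<phi>) \<longlonglongrightarrow> L \<phi>" by (simp add: LIM_zero_iff)
  qed
qed

section \<open>Weak derivatives\<close>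

lemma distr_eq_L2_inner: "distr \<Omega> f \<phi> = L2_inner \<Omega> f \<phi>"
  by (simp add: distr_def L2_inner_def)

text \<open>
  Differentiating a distribution in the order given by a list differentiates the test function in the
  opposite order, whence \<open>fold\<close> instead of \<open>foldr\<close>.
\<close>

lemma foldr_distr_partial:
  "foldr distr_partial is T \<phi> = (- 1) ^ length is * T (fold pd is \<phi>)"
  by (induction "is" arbitrary: \<phi>) (simp_all add: distr_partial_def)

lemma test_function_fold_partial:
  "\<phi> \<in> test_functions \<Omega> \<Longrightarrow> fold pd is \<phi> \<in> test_functions \<Omega>"
  by (induction "is" arbitrary: \<phi>) (simp_all add: test_function_partial)

lemma test_function_foldr_partial:
  "\<phi> \<in> test_functions \<Omega> \<Longrightarrow> foldr pd is \<phi> \<in> test_functions \<Omega>"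
  by (induction "is") (simp_all add: test_function_partial)

lemma has_weak_deriv_iff:
  "has_weak_deriv \<Omega> is f g \<longleftrightarrow> locally_integrable \<Omega> f \<and> locally_integrable \<Omega> g \<and>
     (\<forall>\<phi>\<in>test_functions \<Omega>. (- 1) ^ length is * distr \<Omega> f (fold pd is \<phi>) = distr \<Omega> g \<phi>)"
  by (simp add: has_weak_deriv_def foldr_distr_partial)

lemma locally_integrable_add:
  "locally_integrable \<Omega> f \<Longrightarrow> locally_integrable \<Omega> g \<Longrightarrow> locally_integrable \<Omega> (\<lambda>x. f x + g x)"
  by (simp add: locally_integrable_def)

lemma locally_integrable_cmult:
  "locally_integrable \<Omega> f \<Longrightarrow> locally_integrable \<Omega> (\<lambda>x. c * f x)"
  by (simp add: locally_integrable_def)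

text \<open>Modifying a square integrable function on a null set keeps it measurable, as Lebesgue measure is complete.\<close>

lemma L2_cong_AE:
  fixes f g :: "('n::finite) scalar_field"
  assumes f: "f \<in> L2_space \<Omega>" and ae: "AE x in lebesgue_on \<Omega>. f x = g x" and \<Omega>: "\<Omega> \<in> sets lebesgue"
  shows "g \<in> L2_space \<Omega>"
proof -
  let ?N = "{x \<in> \<Omega>. f x \<noteq> g x}"
  have "AE x in lebesgue. x \<in> \<Omega> \<longrightarrow> f x = g x"
    using ae \<Omega> by (simp add: AE_restrict_space_iff)
  then have "{x \<in> space lebesgue. \<not> (x \<in> \<Omega> \<longrightarrow> f x = g x)} \<in> null_sets lebesgue"
    by (simp only: completion.AE_iff_null_sets)
  moreover have "{x \<in> space lebesgue. \<not> (x \<in> \<Omega> \<longrightarrow> f x = g x)} = ?N" by auto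
  ultimately have N: "?N \<in> null_sets (lebesgue_on \<Omega>)"
    using \<Omega> by (simp add: null_sets_restrict_space)
  have "f \<in> borel_measurable (lebesgue_on (\<Omega> - ?N))"
    using borel_measurable_diff_null[OF N \<Omega>] L2_spaceD(1)[OF f] by blast
  then have "g \<in> borel_measurable (lebesgue_on (\<Omega> - ?N))"
    by (subst measurable_lebesgue_cong[of _ _ f]) auto
  then have g: "g \<in> borel_measurable (lebesgue_on \<Omega>)"
    using borel_measurable_diff_null[OF N \<Omega>] by blast
  have "AE x in lebesgue_on \<Omega>. (norm (f x))\<^sup>2 = (norm (g x))\<^sup>2"
    using ae by eventually_elim simp
  then have "integrable (lebesgue_on \<Omega>) (\<lambda>x. (norm (g x))\<^sup>2)"
    using L2_spaceD[OF f] g by (subst integrable_cong_AE[symmetric]) auto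
  with g show ?thesis by (simp add: L2_space_def)
qed

locale bounded_open =
  fixes \<Omega> :: "(real ^ 'n) set"
  assumes open_domain: "open \<Omega>" and bounded_domain: "bounded \<Omega>"
begin

abbreviation ip where "ip \<equiv> L2_inner \<Omega>"
abbreviation nsq where "nsq f \<equiv> L2_inner \<Omega> f f"
abbreviation wd where "wd \<equiv> weak_deriv \<Omega>"
abbreviation \<epsilon> where "\<epsilon> \<equiv> strain \<Omega>"

lemma domain_sets: "\<Omega> \<in> sets lebesgue"
  using open_domain by simp

lemma domain_lmeasurable: "\<Omega> \<in> lmeasurable"
  using open_domain bounded_domain by (simp add: lmeasurable_open)

lemma test_L2: "\<phi> \<in> test_functions \<Omega> \<Longrightarrow> \<phi> \<in> L2_space \<Omega>"
  by (rule test_function_L2[OF _ domain_sets])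

lemma L2_locally_integrable:
  assumes "f \<in> L2_space \<Omega>"
  shows "locally_integrable \<Omega> f"
  unfolding locally_integrable_def
proof (intro allI impI)
  fix K assume K: "compact K \<and> K \<subseteq> \<Omega>"
  then have Ks: "K \<in> sets lebesgue" by (simp add: compact_imp_closed)
  have "integrable (lebesgue_on \<Omega>) f" by (rule L2_imp_integrable[OF assms domain_lmeasurable])
  then have "integrable lebesgue (\<lambda>x. if x \<in> \<Omega> then f x else 0)"
    by (simp add: Lebesgue_Measure.integrable_restrict_UNIV domain_sets)
  then have "integrable lebesgue (\<lambda>x. indicator K x *\<^sub>R (if x \<in> \<Omega> then f x else 0))"
    by (rule integrable_mult_indicator[OF Ks])
  moreover have "(\<lambda>x. indicator K x *\<^sub>R (if x \<in> \<Omega> then f x else 0)) = (\<lambda>x. if x \<in> K then f x else 0)"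
    using K by (auto simp: indicator_def fun_eq_iff)
  ultimately show "integrable (lebesgue_on K) f"
    using Lebesgue_Measure.integrable_restrict_UNIV[OF Ks, of f] by (simp only:)
qed

lemma distr_add:
  assumes "locally_integrable \<Omega> f" "locally_integrable \<Omega> g" "\<phi> \<in> test_functions \<Omega>"
  shows "distr \<Omega> (\<lambda>x. f x + g x) \<phi> = distr \<Omega> f \<phi> + distr \<Omega> g \<phi>"
  using assms locally_integrable_times_test_function[OF _ _ domain_sets]
  by (simp add: distr_def distrib_right)

lemma distr_cmult: "distr \<Omega> (\<lambda>x. c * f x) \<phi> = c * distr \<Omega> f \<phi>"
  by (simp add: distr_def mult.assoc)

lemma has_weak_deriv_add:
  assumes "has_weak_deriv \<Omega> is f g" "has_weak_deriv \<Omega> is f' g'"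
  shows "has_weak_deriv \<Omega> is (\<lambda>x. f x + f' x) (\<lambda>x. g x + g' x)"
  using assms
  by (auto simp: has_weak_deriv_iff locally_integrable_add distr_add test_function_fold_partial distrib_left)

lemma has_weak_deriv_cmult:
  assumes "has_weak_deriv \<Omega> is f g"
  shows "has_weak_deriv \<Omega> is (\<lambda>x. c * f x) (\<lambda>x. c * g x)"
  using assms by (auto simp: has_weak_deriv_iff locally_integrable_cmult distr_cmult)

lemma has_weak_deriv_diff:
  assumes "has_weak_deriv \<Omega> is f g" "has_weak_deriv \<Omega> is f' g'"
  shows "has_weak_deriv \<Omega> is (\<lambda>x. f x - f' x) (\<lambda>x. g x - g' x)"
  using has_weak_deriv_add[OF assms(1) has_weak_deriv_cmult[OF assms(2), of "-1"]] by simp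

lemma has_weak_deriv_zero: "has_weak_deriv \<Omega> is (\<lambda>x. 0) (\<lambda>x. 0)"
  by (simp add: has_weak_deriv_iff locally_integrable_def distr_def)

lemma has_weak_deriv_sum:
  assumes "\<And>k. k \<in> A \<Longrightarrow> has_weak_deriv \<Omega> is (F k) (G k)"
  shows "has_weak_deriv \<Omega> is (\<lambda>x. \<Sum>k\<in>A. F k x) (\<lambda>x. \<Sum>k\<in>A. G k x)"
  using assms
  by (induction A rule: infinite_finite_induct) (auto intro: has_weak_deriv_add simp: has_weak_deriv_zero)

lemma has_weak_deriv_unique:
  assumes "has_weak_deriv \<Omega> is f g" "has_weak_deriv \<Omega> is f g'"
  shows "AE x in lebesgue_on \<Omega>. g x = g' x"
proof -
  have "has_weak_deriv \<Omega> is (\<lambda>x. f x - f x) (\<lambda>x. g x - g' x)" by (rule has_weak_deriv_diff[OF assms])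
  then have "AE x in lebesgue_on \<Omega>. g x - g' x = 0"
    by (intro fundamental_lemma[OF open_domain]) (simp_all add: has_weak_deriv_iff, simp add: distr_def)
  then show ?thesis by eventually_elim simp
qed

lemma has_weak_deriv_weak_deriv:
  "has_weak_deriv \<Omega> is f g \<Longrightarrow> has_weak_deriv \<Omega> is f (wd is f)"
  unfolding weak_deriv_def by (rule someI[of "has_weak_deriv \<Omega> is f"])

lemma weak_deriv_AE:
  "has_weak_deriv \<Omega> is f g \<Longrightarrow> AE x in lebesgue_on \<Omega>. wd is f x = g x"
  by (rule has_weak_deriv_unique[OF has_weak_deriv_weak_deriv])

lemma has_weak_deriv_Cons:
  assumes "has_weak_deriv \<Omega> is f g"
  shows "has_weak_deriv \<Omega> (k # is) f h \<longleftrightarrow> has_weak_deriv \<Omega> [k] g h"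
  using assms by (auto simp: has_weak_deriv_iff test_function_partial)

text \<open>
  Moving the derivatives one at a time back from the test function to \<open>\<phi>\<close> reverses their order a second
  time, so the weak derivative along a list is the classical one along the same list.
\<close>

lemma has_weak_deriv_test:
  assumes "\<phi> \<in> test_functions \<Omega>"
  shows "has_weak_deriv \<Omega> is \<phi> (foldr pd is \<phi>)"
proof (induction "is")
  case Nil
  show ?case using assms by (simp add: has_weak_deriv_iff L2_locally_integrable test_L2)
next
  case (Cons i "is")
  let ?g = "foldr pd is \<phi>"
  have g: "?g \<in> test_functions \<Omega>" by (rule test_function_foldr_partial[OF assms])
  have "has_weak_deriv \<Omega> [i] ?g (pd i ?g)"
    using integral_by_parts[OF g _ domain_sets] g
    by (simp add: has_weak_deriv_iff L2_locally_integrable test_L2 test_function_partial distr_eq_L2_inner)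
  then show ?case using has_weak_deriv_Cons[OF Cons.IH] by simp
qed

lemma has_weak_deriv_limit:
  assumes F: "L2_tendsto \<Omega> F f" and G: "L2_tendsto \<Omega> G g" and d: "\<And>n. has_weak_deriv \<Omega> is (F n) (G n)"
  shows "has_weak_deriv \<Omega> is f g"
proof -
  have "(- 1) ^ length is * distr \<Omega> f (fold pd is \<phi>) = distr \<Omega> g \<phi>" if \<phi>: "\<phi> \<in> test_functions \<Omega>" for \<phi>
  proof -
    have "(\<lambda>n. (- 1) ^ length is * ip (F n) (fold pd is \<phi>))
        \<longlonglongrightarrow> (- 1) ^ length is * ip f (fold pd is \<phi>)"
      by (intro tendsto_intros L2_inner_tendsto F L2_tendsto_const test_L2 test_function_fold_partial \<phi>)
    moreover have "(\<lambda>n. ip (G n) \<phi>) \<longlonglongrightarrow> ip g \<phi>"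
      by (intro L2_inner_tendsto G L2_tendsto_const test_L2 \<phi>)
    moreover have "(- 1) ^ length is * ip (F n) (fold pd is \<phi>) = ip (G n) \<phi>" for n
      using d[of n] \<phi> by (simp add: has_weak_deriv_iff distr_eq_L2_inner)
    ultimately show ?thesis unfolding distr_eq_L2_inner by (simp add: LIMSEQ_unique)
  qed
  then show ?thesis
    using F G by (simp add: has_weak_deriv_iff L2_locally_integrable L2_tendsto_def)
qed

text \<open>
  The two predicates are equal, so the choice operator in \<open>weak_deriv\<close> picks the same function for \<open>f\<close> and
  \<open>f'\<close>, and not only functions that agree almost everywhere.
\<close>

lemma has_weak_deriv_cong_AE:
  assumes "locally_integrable \<Omega> f" "locally_integrable \<Omega> f'" "AE x in lebesgue_on \<Omega>. f x = f' x"
  shows "has_weak_deriv \<Omega> is f = has_weak_deriv \<Omega> is f'"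
proof -
  have "distr \<Omega> f \<phi> = distr \<Omega> f' \<phi>" if "\<phi> \<in> test_functions \<Omega>" for \<phi>
    unfolding distr_def
  proof (rule integral_cong_AE)
    show "AE x in lebesgue_on \<Omega>. f x * \<phi> x = f' x * \<phi> x" using assms(3) by eventually_elim simp
  qed (use assms that in \<open>auto dest: locally_integrable_times_test_function[OF _ _ domain_sets]\<close>)
  then show ?thesis
    using assms by (auto simp: has_weak_deriv_iff test_function_fold_partial fun_eq_iff)
qed

section \<open>Sobolev spaces\<close>

lemma sobolevI:
  assumes "\<And>is. length is \<le> m \<Longrightarrow> has_weak_deriv \<Omega> is f (G is)" "\<And>is. length is \<le> m \<Longrightarrow> G is \<in> L2_space \<Omega>"
  shows "f \<in> sobolev m \<Omega>"
  using assms by (auto simp: sobolev_def)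

lemma sobolevD:
  assumes "f \<in> sobolev m \<Omega>" "length is \<le> m"
  shows "has_weak_deriv \<Omega> is f (wd is f)" "wd is f \<in> L2_space \<Omega>"
proof -
  obtain g where g: "g \<in> L2_space \<Omega>" "has_weak_deriv \<Omega> is f g"
    using assms by (auto simp: sobolev_def)
  show "has_weak_deriv \<Omega> is f (wd is f)" by (rule has_weak_deriv_weak_deriv[OF g(2)])
  have "AE x in lebesgue_on \<Omega>. g x = wd is f x"
    using weak_deriv_AE[OF g(2)] by eventually_elim simp
  then show "wd is f \<in> L2_space \<Omega>" by (rule L2_cong_AE[OF g(1) _ domain_sets])
qed

lemma sobolev_locally_integrable: "f \<in> sobolev m \<Omega> \<Longrightarrow> locally_integrable \<Omega> f"
  using sobolevD(1)[of f m "[]"] by (simp add: has_weak_deriv_iff)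

lemma sobolev_AE_Nil:
  assumes "f \<in> sobolev m \<Omega>"
  shows "AE x in lebesgue_on \<Omega>. wd [] f x = f x"
proof -
  have "has_weak_deriv \<Omega> [] f f" using sobolev_locally_integrable[OF assms] by (simp add: has_weak_deriv_iff)
  then show ?thesis by (rule weak_deriv_AE)
qed

lemma sobolev_L2: "f \<in> sobolev m \<Omega> \<Longrightarrow> f \<in> L2_space \<Omega>"
  using L2_cong_AE[OF sobolevD(2)[of f m "[]"] sobolev_AE_Nil domain_sets] by simp

lemma sobolev_mono: "k \<le> m \<Longrightarrow> f \<in> sobolev m \<Omega> \<Longrightarrow> f \<in> sobolev k \<Omega>"
  by (simp add: sobolev_def)

lemma sobolev_add:
  assumes "f \<in> sobolev m \<Omega>" "g \<in> sobolev m \<Omega>"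
  shows "(\<lambda>x. f x + g x) \<in> sobolev m \<Omega>"
  by (rule sobolevI[where G="\<lambda>is x. wd is f x + wd is g x"])
     (intro has_weak_deriv_add L2_add sobolevD[OF assms(1)] sobolevD[OF assms(2)]; assumption)+

lemma sobolev_cmult:
  assumes "f \<in> sobolev m \<Omega>"
  shows "(\<lambda>x. c * f x) \<in> sobolev m \<Omega>"
  by (rule sobolevI[where G="\<lambda>is x. c * wd is f x"])
     (intro has_weak_deriv_cmult L2_cmult sobolevD[OF assms]; assumption)+

lemma weak_deriv_add_AE:
  assumes "f \<in> sobolev m \<Omega>" "g \<in> sobolev m \<Omega>" "length is \<le> m"
  shows "AE x in lebesgue_on \<Omega>. wd is (\<lambda>x. f x + g x) x = wd is f x + wd is g x"
  by (intro weak_deriv_AE has_weak_deriv_add sobolevD(1)[of _ m] assms)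

lemma weak_deriv_diff_AE:
  assumes "f \<in> sobolev m \<Omega>" "g \<in> sobolev m \<Omega>" "length is \<le> m"
  shows "AE x in lebesgue_on \<Omega>. wd is (\<lambda>x. f x - g x) x = wd is f x - wd is g x"
  by (intro weak_deriv_AE has_weak_deriv_diff sobolevD(1)[of _ m] assms)

lemma weak_deriv_cmult_AE:
  assumes "f \<in> sobolev m \<Omega>" "length is \<le> m"
  shows "AE x in lebesgue_on \<Omega>. wd is (\<lambda>x. c * f x) x = c * wd is f x"
  by (intro weak_deriv_AE has_weak_deriv_cmult sobolevD(1)[of _ m] assms)

lemma sobolev_diff:
  assumes "f \<in> sobolev m \<Omega>" "g \<in> sobolev m \<Omega>"
  shows "(\<lambda>x. f x - g x) \<in> sobolev m \<Omega>"
  using sobolev_add[OF assms(1) sobolev_cmult[OF assms(2), of "-1"]] by simp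

lemma test_sobolev: "\<phi> \<in> test_functions \<Omega> \<Longrightarrow> \<phi> \<in> sobolev m \<Omega>"
  by (rule sobolevI[where G="\<lambda>is. foldr pd is \<phi>"])
     (simp_all add: has_weak_deriv_test test_L2 test_function_foldr_partial)

lemma weak_deriv_test_AE:
  "\<phi> \<in> test_functions \<Omega> \<Longrightarrow> AE x in lebesgue_on \<Omega>. wd is \<phi> x = foldr pd is \<phi> x"
  by (intro weak_deriv_AE has_weak_deriv_test)

definition sobolev_tendsto :: "nat \<Rightarrow> (nat \<Rightarrow> 'n scalar_field) \<Rightarrow> 'n scalar_field \<Rightarrow> bool" where
  "sobolev_tendsto m F f \<longleftrightarrow>
     (\<forall>is. length is \<le> m \<longrightarrow> L2_tendsto \<Omega> (\<lambda>n. wd is (F n)) (wd is f))"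

lemma L2_sq_minus_commute: "nsq (\<lambda>x. f x - g x) = nsq (\<lambda>x. g x - f x)"
  by (simp add: L2_inner_def inner_diff_left inner_diff_right algebra_simps)

lemma finite_multi_indices: "finite {is :: 'n list. length is \<le> m}"
  using finite_lists_length_le[of "UNIV :: 'n set" m] by simp

lemma sobolev_norm_square:
  "(sobolev_norm m \<Omega> f)\<^sup>2 = (\<Sum>is | length is \<le> m. nsq (wd is f))"
  by (simp add: sobolev_norm_def sum_nonneg L2_inner_self_nonneg)

lemma L2_inner_weak_deriv_diff:
  assumes "f \<in> sobolev m \<Omega>" "g \<in> sobolev m \<Omega>" "length is \<le> m"
  shows "nsq (wd is (\<lambda>x. f x - g x))
    = nsq (\<lambda>x. wd is f x - wd is g x)"
  by (intro L2_inner_cong_AE weak_deriv_diff_AE[of _ m] L2_diff sobolevD(2)[of _ m] sobolev_diff assms)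

lemma sobolev_norm_diff_tendsto:
  assumes "sobolev_tendsto m F f" "\<And>n. F n \<in> sobolev m \<Omega>" "f \<in> sobolev m \<Omega>"
  shows "(\<lambda>n. (sobolev_norm m \<Omega> (\<lambda>x. f x - F n x))\<^sup>2) \<longlonglongrightarrow> 0"
proof -
  have "(\<lambda>n. \<Sum>is | length is \<le> m. nsq (wd is (\<lambda>x. f x - F n x))) \<longlonglongrightarrow> (\<Sum>is \<in> {is::'n list. length is \<le> m}. 0)"
  proof (rule tendsto_sum)
    fix "is" :: "'n list" assume "is \<in> {is. length is \<le> m}"
    then have l: "length is \<le> m" by simp
    show "(\<lambda>n. nsq (wd is (\<lambda>x. f x - F n x))) \<longlonglongrightarrow> 0"
      unfolding L2_inner_weak_deriv_diff[OF assms(3,2) l] L2_sq_minus_commute[of "wd is f"]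
      using assms(1) l by (simp add: sobolev_tendsto_def L2_tendsto_def)
  qed
  then show ?thesis by (simp add: sobolev_norm_square)
qed

text \<open>
  An approximating sequence with all its derivatives is what the later arguments use: they prove an
  identity or an estimate for test functions and let the \<open>L\<^sup>2\<close>-inner products converge.
\<close>

lemma sobolev0_iff_limit:
  "f \<in> sobolev0 m \<Omega> \<longleftrightarrow>
     f \<in> sobolev m \<Omega> \<and> (\<exists>F. (\<forall>n. F n \<in> test_functions \<Omega>) \<and> sobolev_tendsto m F f)"
proof (intro iffI conjI)
  assume f: "f \<in> sobolev0 m \<Omega>"
  then show fs: "f \<in> sobolev m \<Omega>" by (simp add: sobolev0_def)
  have "\<forall>n. \<exists>\<phi>\<in>test_functions \<Omega>. sobolev_norm m \<Omega> (\<lambda>x. f x - \<phi> x) < inverse (real (Suc n))"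
    using f by (simp add: sobolev0_def)
  then obtain F where F: "\<And>n. F n \<in> test_functions \<Omega>" "\<And>n. sobolev_norm m \<Omega> (\<lambda>x. f x - F n x) < inverse (real (Suc n))"
    by metis
  have Fs: "F n \<in> sobolev m \<Omega>" for n by (rule test_sobolev[OF F(1)])
  have "sobolev_tendsto m F f"
    unfolding sobolev_tendsto_def
  proof (intro allI impI)
    fix "is" :: "'n list" assume l: "length is \<le> m"
    let ?D = "\<lambda>n x. wd is (F n) x - wd is f x"
    have le: "nsq (?D n) \<le> (inverse (real (Suc n)))\<^sup>2" for n
    proof -
      have "nsq (?D n) = nsq (wd is (\<lambda>x. f x - F n x))"
        unfolding L2_inner_weak_deriv_diff[OF fs Fs l] by (rule L2_sq_minus_commute)
      also have "\<dots> \<le> (sobolev_norm m \<Omega> (\<lambda>x. f x - F n x))\<^sup>2"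
        unfolding sobolev_norm_square using l
        by (intro member_le_sum finite_multi_indices) (auto simp: L2_inner_self_nonneg)
      also have "\<dots> \<le> (inverse (real (Suc n)))\<^sup>2"
        using F(2)[of n] by (intro power_mono) (auto simp: sobolev_norm_def sum_nonneg L2_inner_self_nonneg)
      finally show ?thesis .
    qed
    have inv: "(\<lambda>n. (inverse (real (Suc n)))\<^sup>2) \<longlonglongrightarrow> 0"
      using tendsto_power[OF LIMSEQ_inverse_real_of_nat, of 2] by simp
    have "(\<lambda>n. nsq (?D n)) \<longlonglongrightarrow> 0"
      by (rule tendsto_sandwich[OF always_eventually always_eventually tendsto_const inv])
         (rule allI, rule L2_inner_self_nonneg, rule allI, rule le)
    then show "L2_tendsto \<Omega> (\<lambda>n. wd is (F n)) (wd is f)"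
      using sobolevD(2)[OF fs l] sobolevD(2)[OF Fs l] by (simp add: L2_tendsto_def)
  qed
  with F(1) show "\<exists>F. (\<forall>n. F n \<in> test_functions \<Omega>) \<and> sobolev_tendsto m F f" by blast
next
  assume "f \<in> sobolev m \<Omega> \<and> (\<exists>F. (\<forall>n. F n \<in> test_functions \<Omega>) \<and> sobolev_tendsto m F f)"
  then obtain F where fs: "f \<in> sobolev m \<Omega>" and F: "\<And>n. F n \<in> test_functions \<Omega>" "sobolev_tendsto m F f" by blast
  have lim: "(\<lambda>n. (sobolev_norm m \<Omega> (\<lambda>x. f x - F n x))\<^sup>2) \<longlonglongrightarrow> 0"
    by (rule sobolev_norm_diff_tendsto[OF F(2) test_sobolev[OF F(1)] fs])
  have "\<exists>\<phi>\<in>test_functions \<Omega>. sobolev_norm m \<Omega> (\<lambda>x. f x - \<phi> x) < e" if "0 < e" for e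
  proof -
    have "\<forall>\<^sub>F n in sequentially. (sobolev_norm m \<Omega> (\<lambda>x. f x - F n x))\<^sup>2 < e\<^sup>2"
      using that by (intro order_tendstoD(2)[OF lim]) simp
    then obtain n where "(sobolev_norm m \<Omega> (\<lambda>x. f x - F n x))\<^sup>2 < e\<^sup>2"
      by (auto simp: eventually_sequentially)
    then have "sobolev_norm m \<Omega> (\<lambda>x. f x - F n x) < e"
      by (rule power2_less_imp_less) (use that in simp)
    then show ?thesis using F(1) by blast
  qed
  then show "f \<in> sobolev0 m \<Omega>" using fs by (simp add: sobolev0_def)
qed

lemma sobolev0_sobolev: "f \<in> sobolev0 m \<Omega> \<Longrightarrow> f \<in> sobolev m \<Omega>"
  by (simp add: sobolev0_def)

lemma sobolev_tendsto_const: "f \<in> sobolev m \<Omega> \<Longrightarrow> sobolev_tendsto m (\<lambda>n. f) f"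
  by (auto simp: sobolev_tendsto_def intro: L2_tendsto_const sobolevD)

lemma test_sobolev0: "\<phi> \<in> test_functions \<Omega> \<Longrightarrow> \<phi> \<in> sobolev0 m \<Omega>"
  unfolding sobolev0_iff_limit using test_sobolev[of \<phi> m] sobolev_tendsto_const[of \<phi> m]
  by (intro conjI exI[of _ "\<lambda>n. \<phi>"]) auto

lemma sobolev0_mono:
  assumes "k \<le> m" "f \<in> sobolev0 m \<Omega>"
  shows "f \<in> sobolev0 k \<Omega>"
proof -
  have "sobolev_tendsto m F f \<Longrightarrow> sobolev_tendsto k F f" for F
    using assms(1) by (auto simp: sobolev_tendsto_def)
  then show ?thesis using assms(2) sobolev_mono[OF assms(1)] unfolding sobolev0_iff_limit by meson
qed

lemma sobolev_tendsto_add: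
  assumes "sobolev_tendsto m F f" "sobolev_tendsto m G g"
    and "\<And>n. F n \<in> sobolev m \<Omega>" "f \<in> sobolev m \<Omega>" "\<And>n. G n \<in> sobolev m \<Omega>" "g \<in> sobolev m \<Omega>"
  shows "sobolev_tendsto m (\<lambda>n x. F n x + G n x) (\<lambda>x. f x + g x)"
  unfolding sobolev_tendsto_def
proof (intro allI impI)
  fix "is" :: "'n list" assume l: "length is \<le> m"
  have "L2_tendsto \<Omega> (\<lambda>n x. wd is (F n) x + wd is (G n) x) (\<lambda>x. wd is f x + wd is g x)"
    using assms(1,2) l by (intro L2_tendsto_add) (auto simp: sobolev_tendsto_def)
  then show "L2_tendsto \<Omega> (\<lambda>n. wd is (\<lambda>x. F n x + G n x)) (wd is (\<lambda>x. f x + g x))"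
    by (rule L2_tendsto_cong_AE)
       (intro sobolevD(2)[of _ m] sobolev_add assms l weak_deriv_add_AE[of _ m, THEN AE_symmetric])+
qed

lemma sobolev_tendsto_cmult:
  assumes "sobolev_tendsto m F f" and "\<And>n. F n \<in> sobolev m \<Omega>" "f \<in> sobolev m \<Omega>"
  shows "sobolev_tendsto m (\<lambda>n x. c * F n x) (\<lambda>x. c * f x)"
  unfolding sobolev_tendsto_def
proof (intro allI impI)
  fix "is" :: "'n list" assume l: "length is \<le> m"
  have "L2_tendsto \<Omega> (\<lambda>n x. c * wd is (F n) x) (\<lambda>x. c * wd is f x)"
    using L2_tendsto_scaleR[of \<Omega> "\<lambda>n. wd is (F n)" "wd is f" c] assms(1) l
    by (simp add: sobolev_tendsto_def)
  then show "L2_tendsto \<Omega> (\<lambda>n. wd is (\<lambda>x. c * F n x)) (wd is (\<lambda>x. c * f x))"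
    by (rule L2_tendsto_cong_AE)
       (intro sobolevD(2)[of _ m] sobolev_cmult assms l weak_deriv_cmult_AE[of _ m, THEN AE_symmetric])+
qed

lemma sobolev0_add:
  assumes "f \<in> sobolev0 m \<Omega>" "g \<in> sobolev0 m \<Omega>"
  shows "(\<lambda>x. f x + g x) \<in> sobolev0 m \<Omega>"
proof -
  obtain F G where F: "\<And>n. F n \<in> test_functions \<Omega>" "sobolev_tendsto m F f"
    and G: "\<And>n. G n \<in> test_functions \<Omega>" "sobolev_tendsto m G g"
    using assms unfolding sobolev0_iff_limit by blast
  have "sobolev_tendsto m (\<lambda>n x. F n x + G n x) (\<lambda>x. f x + g x)"
    by (intro sobolev_tendsto_add F G test_sobolev assms sobolev0_sobolev)
  moreover have "(\<lambda>x. F n x + G n x) \<in> test_functions \<Omega>" for n by (intro test_function_add F G)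
  ultimately show ?thesis
    using sobolev_add[OF sobolev0_sobolev[OF assms(1)] sobolev0_sobolev[OF assms(2)]]
    unfolding sobolev0_iff_limit by (intro conjI exI[of _ "\<lambda>n x. F n x + G n x"] allI)
qed

lemma sobolev0_cmult:
  assumes "f \<in> sobolev0 m \<Omega>"
  shows "(\<lambda>x. c * f x) \<in> sobolev0 m \<Omega>"
proof -
  obtain F where F: "\<And>n. F n \<in> test_functions \<Omega>" "sobolev_tendsto m F f"
    using assms unfolding sobolev0_iff_limit by blast
  have "sobolev_tendsto m (\<lambda>n x. c * F n x) (\<lambda>x. c * f x)"
    by (intro sobolev_tendsto_cmult F test_sobolev assms sobolev0_sobolev)
  moreover have "(\<lambda>x. c * F n x) \<in> test_functions \<Omega>" for n by (intro test_function_cmult F)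
  ultimately show ?thesis
    using sobolev_cmult[OF sobolev0_sobolev[OF assms(1)]]
    unfolding sobolev0_iff_limit by (intro conjI exI[of _ "\<lambda>n x. c * F n x"] allI)
qed

section \<open>Strains of Sobolev vector fields\<close>

definition sobolev_vec :: "nat \<Rightarrow> 'n vector_field set" where
  "sobolev_vec m = {v. \<forall>i. (\<lambda>x. v x $ i) \<in> sobolev m \<Omega>}"

definition vec_tendsto :: "nat \<Rightarrow> (nat \<Rightarrow> 'n vector_field) \<Rightarrow> 'n vector_field \<Rightarrow> bool" where
  "vec_tendsto m V v \<longleftrightarrow> (\<forall>i. sobolev_tendsto m (\<lambda>n x. V n x $ i) (\<lambda>x. v x $ i))"

lemma sobolev_vecD: "v \<in> sobolev_vec m \<Longrightarrow> (\<lambda>x. v x $ i) \<in> sobolev m \<Omega>"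
  by (simp add: sobolev_vec_def)

lemma sobolev_vec_mono: "k \<le> m \<Longrightarrow> v \<in> sobolev_vec m \<Longrightarrow> v \<in> sobolev_vec k"
  by (simp add: sobolev_vec_def sobolev_mono)

lemma sobolev_vec_L2: "v \<in> sobolev_vec m \<Longrightarrow> v \<in> L2_space \<Omega>"
  by (auto simp: sobolev_vec_def L2_space_vec_iff intro: sobolev_L2)

lemma sobolev0_vec_sobolev_vec: "v \<in> sobolev0_vec m \<Omega> \<Longrightarrow> v \<in> sobolev_vec m"
  by (simp add: sobolev_vec_def sobolev0_vec_def sobolev0_sobolev)

lemma sobolev0_vec_mono: "k \<le> m \<Longrightarrow> v \<in> sobolev0_vec m \<Omega> \<Longrightarrow> v \<in> sobolev0_vec k \<Omega>"
  by (simp add: sobolev0_vec_def sobolev0_mono)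

lemma vec_tendsto_mono: "k \<le> m \<Longrightarrow> vec_tendsto m V v \<Longrightarrow> vec_tendsto k V v"
  by (auto simp: vec_tendsto_def sobolev_tendsto_def)

lemma test_vec_sobolev0_vec: "\<phi> \<in> test_vector_fields \<Omega> \<Longrightarrow> \<phi> \<in> sobolev0_vec m \<Omega>"
  by (simp add: sobolev0_vec_def test_vector_fields_def test_sobolev0)

lemma test_vec_sobolev_vec: "\<phi> \<in> test_vector_fields \<Omega> \<Longrightarrow> \<phi> \<in> sobolev_vec m"
  by (intro sobolev0_vec_sobolev_vec test_vec_sobolev0_vec)

lemma sobolev_vec_axpy:
  assumes "v \<in> sobolev_vec m" "w \<in> sobolev_vec m"
  shows "(\<lambda>x. v x + c *\<^sub>R w x) \<in> sobolev_vec m"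
  using assms by (simp add: sobolev_vec_def sobolev_add sobolev_cmult)

lemma sobolev0_vec_axpy:
  assumes "v \<in> sobolev0_vec m \<Omega>" "w \<in> sobolev0_vec m \<Omega>"
  shows "(\<lambda>x. v x + c *\<^sub>R w x) \<in> sobolev0_vec m \<Omega>"
  using assms by (simp add: sobolev0_vec_def sobolev0_add sobolev0_cmult)

lemma test_vec_axpy:
  assumes "\<phi> \<in> test_vector_fields \<Omega>" "\<psi> \<in> test_vector_fields \<Omega>"
  shows "(\<lambda>x. \<phi> x + c *\<^sub>R \<psi> x) \<in> test_vector_fields \<Omega>"
  using assms by (simp add: test_vector_fields_def test_function_add test_function_cmult)

lemma sobolev0_vec_approx:
  assumes "v \<in> sobolev0_vec m \<Omega>"
  obtains V where "\<And>n. V n \<in> test_vector_fields \<Omega>" "vec_tendsto m V v"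
proof -
  have "\<forall>i. \<exists>F. (\<forall>n. F n \<in> test_functions \<Omega>) \<and> sobolev_tendsto m F (\<lambda>x. v x $ i)"
    using assms by (simp add: sobolev0_vec_def sobolev0_iff_limit)
  then obtain F where F: "\<And>i n. F i n \<in> test_functions \<Omega>" "\<And>i. sobolev_tendsto m (F i) (\<lambda>x. v x $ i)"
    by metis
  show thesis
  proof (rule that[of "\<lambda>n x. \<chi> i. F i n x"])
    show "(\<lambda>x. \<chi> i. F i n x) \<in> test_vector_fields \<Omega>" for n
      using F(1) by (simp add: test_vector_fields_def)
    show "vec_tendsto m (\<lambda>n x. \<chi> i. F i n x) v"
      using F(2) by (simp add: vec_tendsto_def)
  qed
qed

lemma vec_tendsto_L2:
  assumes "vec_tendsto m V v" "\<And>n. V n \<in> sobolev_vec m" "v \<in> sobolev_vec m"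
  shows "L2_tendsto \<Omega> V v"
proof (rule L2_tendsto_vec)
  fix i
  have "L2_tendsto \<Omega> (\<lambda>n. wd [] (\<lambda>x. V n x $ i)) (wd [] (\<lambda>x. v x $ i))"
    using assms(1) by (simp add: vec_tendsto_def sobolev_tendsto_def)
  then show "L2_tendsto \<Omega> (\<lambda>n x. V n x $ i) (\<lambda>x. v x $ i)"
    by (rule L2_tendsto_cong_AE)
       (use assms(2,3) in \<open>auto simp: sobolev_vec_def intro: sobolev_L2 sobolev_AE_Nil\<close>)
qed

lemma weak_deriv_axpy_AE:
  assumes "v \<in> sobolev_vec m" "w \<in> sobolev_vec m" "length is \<le> m"
  shows "AE x in lebesgue_on \<Omega>. wd is (\<lambda>x. (v x + c *\<^sub>R w x) $ i) x
    = wd is (\<lambda>x. v x $ i) x + c * wd is (\<lambda>x. w x $ i) x"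
  using weak_deriv_add_AE[OF sobolev_vecD[OF assms(1), of i] sobolev_cmult[OF sobolev_vecD[OF assms(2), of i], of c] assms(3)]
    weak_deriv_cmult_AE[OF sobolev_vecD[OF assms(2), of i] assms(3), of c]
  by eventually_elim simp

text \<open>
  It agrees almost everywhere with \<open>grad \<Omega> (strain \<Omega> v)\<close> by \<open>grad_strain_AE\<close>. Being built from weak
  derivatives of \<open>v\<close> itself, and not of another weak derivative, it is directly accessible to the
  convergence and the estimates of these derivatives.
\<close>

definition strain_grad :: "'n vector_field \<Rightarrow> 'n tensor3_field" where
  "strain_grad v = (\<lambda>x. \<chi> i j k.
     (wd [k, j] (\<lambda>y. v y $ i) x + wd [k, i] (\<lambda>y. v y $ j) x) / 2)"

lemma L2_average:
  fixes f g :: "('k::finite) scalar_field"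
  shows "f \<in> L2_space A \<Longrightarrow> g \<in> L2_space A \<Longrightarrow> (\<lambda>x. (f x + g x) / 2) \<in> L2_space A"
  using L2_cmult[OF L2_add, of f A g "1 / 2"] by simp

lemma L2_tendsto_average:
  fixes f g :: "('k::finite) scalar_field"
  shows "L2_tendsto A F f \<Longrightarrow> L2_tendsto A G g \<Longrightarrow> L2_tendsto A (\<lambda>n x. (F n x + G n x) / 2) (\<lambda>x. (f x + g x) / 2)"
  using L2_tendsto_scaleR[OF L2_tendsto_add, of A F f G g "1 / 2"] by simp

lemma strain_L2: "v \<in> sobolev_vec 1 \<Longrightarrow> \<epsilon> v \<in> L2_space \<Omega>"
  by (simp add: strain_def L2_space_vec_iff L2_average sobolevD(2)[OF sobolev_vecD])

lemma strain_grad_L2: "v \<in> sobolev_vec 2 \<Longrightarrow> strain_grad v \<in> L2_space \<Omega>"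
  by (simp add: strain_grad_def L2_space_vec_iff L2_average sobolevD(2)[OF sobolev_vecD])

lemma strain_tendsto: "vec_tendsto 1 V v \<Longrightarrow> L2_tendsto \<Omega> (\<lambda>n. \<epsilon> (V n)) (\<epsilon> v)"
  by (intro L2_tendsto_vec) (simp add: strain_def L2_tendsto_average vec_tendsto_def sobolev_tendsto_def)

lemma strain_grad_tendsto: "vec_tendsto 2 V v \<Longrightarrow> L2_tendsto \<Omega> (\<lambda>n. strain_grad (V n)) (strain_grad v)"
  by (intro L2_tendsto_vec) (simp add: strain_grad_def L2_tendsto_average vec_tendsto_def sobolev_tendsto_def)

lemma strain_axpy_AE:
  assumes "v \<in> sobolev_vec 1" "w \<in> sobolev_vec 1"
  shows "AE x in lebesgue_on \<Omega>. \<epsilon> (\<lambda>x. v x + c *\<^sub>R w x) x = \<epsilon> v x + c *\<^sub>R \<epsilon> w x"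
proof -
  have "AE x in lebesgue_on \<Omega>. \<forall>i j. wd [j] (\<lambda>x. (v x + c *\<^sub>R w x) $ i) x
    = wd [j] (\<lambda>x. v x $ i) x + c * wd [j] (\<lambda>x. w x $ i) x"
    by (intro eventually_all_finite weak_deriv_axpy_AE[OF assms]) simp
  then show ?thesis by eventually_elim (simp only: strain_def vec_eq_iff, simp add: field_simps)
qed

lemma strain_grad_axpy_AE:
  assumes "v \<in> sobolev_vec 2" "w \<in> sobolev_vec 2"
  shows "AE x in lebesgue_on \<Omega>. strain_grad (\<lambda>x. v x + c *\<^sub>R w x) x = strain_grad v x + c *\<^sub>R strain_grad w x"
proof -
  have "AE x in lebesgue_on \<Omega>. \<forall>i j k. wd [k, j] (\<lambda>x. (v x + c *\<^sub>R w x) $ i) x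
    = wd [k, j] (\<lambda>x. v x $ i) x + c * wd [k, j] (\<lambda>x. w x $ i) x"
    by (intro eventually_all_finite weak_deriv_axpy_AE[OF assms]) simp
  then show ?thesis by eventually_elim (simp only: strain_grad_def vec_eq_iff, simp add: field_simps)
qed

text \<open>
  A first weak derivative has the second weak derivatives of the original function as its own weak
  derivatives.
\<close>

lemma has_weak_deriv_strain:
  assumes "v \<in> sobolev_vec 2"
  shows "has_weak_deriv \<Omega> [k] (\<lambda>y. \<epsilon> v y $ i $ j) (\<lambda>x. strain_grad v x $ i $ j $ k)"
proof -
  have *: "has_weak_deriv \<Omega> [k] (wd [b] (\<lambda>y. v y $ a)) (wd [k, b] (\<lambda>y. v y $ a))" for a b
    using has_weak_deriv_Cons[OF sobolevD(1)[OF sobolev_vecD[OF assms, of a], of "[b]"], of k]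
      sobolevD(1)[OF sobolev_vecD[OF assms, of a], of "[k, b]"] by simp
  from has_weak_deriv_cmult[OF has_weak_deriv_add[OF *[of j i] *[of i j]], of "1 / 2"]
  show ?thesis by (simp add: strain_def strain_grad_def)
qed

lemma stress_eq_elasticity2: "stress \<Omega> \<mu> lam v x = elasticity2 \<mu> lam (\<epsilon> v x)"
  by (simp add: stress_def elasticity2_def divergence_def trace_def strain_def)

lemma has_weak_deriv_stress:
  assumes "v \<in> sobolev_vec 2"
  shows "has_weak_deriv \<Omega> [k] (\<lambda>y. stress \<Omega> \<mu> lam v y $ i $ j) (\<lambda>x. elasticity3 \<mu> lam (strain_grad v x) $ i $ j $ k)"
proof -
  note d = has_weak_deriv_strain[OF assms]
  have "has_weak_deriv \<Omega> [k]
     (\<lambda>y. 2 * \<mu> * \<epsilon> v y $ i $ j + (lam * (mat 1 :: real ^ 'n ^ 'n) $ i $ j) * (\<Sum>m\<in>UNIV. \<epsilon> v y $ m $ m))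
     (\<lambda>x. 2 * \<mu> * strain_grad v x $ i $ j $ k + (lam * (mat 1 :: real ^ 'n ^ 'n) $ i $ j) * (\<Sum>m\<in>UNIV. strain_grad v x $ m $ m $ k))"
    by (intro has_weak_deriv_add has_weak_deriv_cmult has_weak_deriv_sum d)
  then show ?thesis
    unfolding stress_eq_elasticity2
    by (simp add: elasticity2_def elasticity3_def trace_def tensor_prod_def trace3_def mult_ac)
qed

lemma grad_strain_AE:
  assumes "v \<in> sobolev_vec 2"
  shows "AE x in lebesgue_on \<Omega>. grad \<Omega> (\<epsilon> v) x = strain_grad v x"
proof -
  have "AE x in lebesgue_on \<Omega>. \<forall>i j k. wd [k] (\<lambda>y. \<epsilon> v y $ i $ j) x = strain_grad v x $ i $ j $ k"
    by (intro eventually_all_finite weak_deriv_AE has_weak_deriv_strain assms)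
  then show ?thesis by eventually_elim (simp add: grad_def vec_eq_iff)
qed

lemma grad_stress_AE:
  assumes "v \<in> sobolev_vec 2"
  shows "AE x in lebesgue_on \<Omega>. grad \<Omega> (stress \<Omega> \<mu> lam v) x = elasticity3 \<mu> lam (strain_grad v x)"
proof -
  have "AE x in lebesgue_on \<Omega>. \<forall>i j k. wd [k] (\<lambda>y. stress \<Omega> \<mu> lam v y $ i $ j) x = elasticity3 \<mu> lam (strain_grad v x) $ i $ j $ k"
    by (intro eventually_all_finite weak_deriv_AE has_weak_deriv_stress assms)
  then show ?thesis by eventually_elim (simp add: grad_def vec_eq_iff)
qed

lemma L2_vec_cong_AE:
  fixes f g :: "real ^ 'n \<Rightarrow> real ^ 'n ^ 'n ^ 'n"
  assumes "f \<in> L2_space \<Omega>" "AE x in lebesgue_on \<Omega>. f x = g x"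
  shows "g \<in> L2_space \<Omega>"
  unfolding L2_space_vec_iff
proof (intro allI)
  fix i j k
  have "AE x in lebesgue_on \<Omega>. f x $ i $ j $ k = g x $ i $ j $ k" using assms(2) by eventually_elim simp
  then show "(\<lambda>x. g x $ i $ j $ k) \<in> L2_space \<Omega>"
    by (rule L2_cong_AE[OF L2_vec3D[OF assms(1)] _ domain_sets])
qed

lemma grad_strain_L2: "v \<in> sobolev_vec 2 \<Longrightarrow> grad \<Omega> (\<epsilon> v) \<in> L2_space \<Omega>"
  by (rule L2_vec_cong_AE[OF strain_grad_L2 AE_symmetric[OF grad_strain_AE]])

lemma grad_stress_L2: "v \<in> sobolev_vec 2 \<Longrightarrow> grad \<Omega> (stress \<Omega> \<mu> lam v) \<in> L2_space \<Omega>"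
  by (rule L2_vec_cong_AE[OF L2_elasticity3[OF strain_grad_L2] AE_symmetric[OF grad_stress_AE]])

section \<open>The inequalities of Friedrichs and Korn\<close>

lemma L2_inner_components2:
  fixes \<tau> \<theta> :: "'n tensor2_field"
  assumes "\<tau> \<in> L2_space \<Omega>" "\<theta> \<in> L2_space \<Omega>"
    and h: "\<And>i j. AE x in lebesgue_on \<Omega>. \<tau> x $ i $ j = h i j x"
    and g: "\<And>i j. AE x in lebesgue_on \<Omega>. \<theta> x $ i $ j = g i j x"
  shows "ip \<tau> \<theta> = (\<Sum>i\<in>UNIV. \<Sum>j\<in>UNIV. ip (h i j) (g i j))"
proof -
  have L: "(\<lambda>x. \<tau> x $ i $ j) \<in> L2_space \<Omega>" "(\<lambda>x. \<theta> x $ i $ j) \<in> L2_space \<Omega>" for i j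
    using assms(1,2) by (simp_all add: L2_space_vec_iff)
  have "ip \<tau> \<theta> = (\<Sum>i\<in>UNIV. \<Sum>j\<in>UNIV. ip (\<lambda>x. \<tau> x $ i $ j) (\<lambda>x. \<theta> x $ i $ j))"
    using assms(1,2) by (simp add: L2_inner_vec L2_space_vec_iff)
  also have "\<dots> = (\<Sum>i\<in>UNIV. \<Sum>j\<in>UNIV. ip (h i j) (g i j))"
    by (intro sum.cong refl L2_inner_cong_AE h g L L2_cong_AE[OF L(1) h domain_sets] L2_cong_AE[OF L(2) g domain_sets])
  finally show ?thesis .
qed

lemma L2_inner_components3:
  fixes \<Psi> \<Theta> :: "'n tensor3_field"
  assumes "\<Psi> \<in> L2_space \<Omega>" "\<Theta> \<in> L2_space \<Omega>"
    and h: "\<And>i j k. AE x in lebesgue_on \<Omega>. \<Psi> x $ i $ j $ k = h i j k x"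
    and g: "\<And>i j k. AE x in lebesgue_on \<Omega>. \<Theta> x $ i $ j $ k = g i j k x"
  shows "ip \<Psi> \<Theta> = (\<Sum>i\<in>UNIV. \<Sum>j\<in>UNIV. \<Sum>k\<in>UNIV. ip (h i j k) (g i j k))"
proof -
  note L = L2_vec3D[OF assms(1)] L2_vec3D[OF assms(2)]
  have "ip \<Psi> \<Theta> = (\<Sum>i\<in>UNIV. \<Sum>j\<in>UNIV. \<Sum>k\<in>UNIV. ip (\<lambda>x. \<Psi> x $ i $ j $ k) (\<lambda>x. \<Theta> x $ i $ j $ k))"
    using assms(1,2) by (simp add: L2_inner_vec L2_space_vec_iff)
  also have "\<dots> = (\<Sum>i\<in>UNIV. \<Sum>j\<in>UNIV. \<Sum>k\<in>UNIV. ip (h i j k) (g i j k))"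
    by (intro sum.cong refl L2_inner_cong_AE h g L L2_cong_AE[OF L(1) h domain_sets] L2_cong_AE[OF L(2) g domain_sets])
  finally show ?thesis .
qed

lemma test_vec_component: "\<phi> \<in> test_vector_fields \<Omega> \<Longrightarrow> (\<lambda>x. \<phi> x $ i) \<in> test_functions \<Omega>"
  by (simp add: test_vector_fields_def)

lemma strain_test_AE:
  assumes "\<phi> \<in> test_vector_fields \<Omega>"
  shows "AE x in lebesgue_on \<Omega>. \<epsilon> \<phi> x $ i $ j = (pd j (\<lambda>y. \<phi> y $ i) x + pd i (\<lambda>y. \<phi> y $ j) x) / 2"
  using weak_deriv_test_AE[OF test_vec_component[OF assms], of "[j]" i]
    weak_deriv_test_AE[OF test_vec_component[OF assms], of "[i]" j]
  by eventually_elim (simp add: strain_def)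

lemma strain_grad_test_AE:
  assumes "\<phi> \<in> test_vector_fields \<Omega>"
  shows "AE x in lebesgue_on \<Omega>. strain_grad \<phi> x $ i $ j $ k
    = (pd k (pd j (\<lambda>y. \<phi> y $ i)) x + pd k (pd i (\<lambda>y. \<phi> y $ j)) x) / 2"
  using weak_deriv_test_AE[OF test_vec_component[OF assms], of "[k, j]" i]
    weak_deriv_test_AE[OF test_vec_component[OF assms], of "[k, i]" j]
  by eventually_elim (simp add: strain_grad_def)

lemma L2_sq_test_strain:
  assumes "\<phi> \<in> test_vector_fields \<Omega>"
  shows "nsq (\<epsilon> \<phi>) = (\<Sum>i\<in>UNIV. \<Sum>j\<in>UNIV. nsq (\<lambda>x. (pd j (\<lambda>y. \<phi> y $ i) x + pd i (\<lambda>y. \<phi> y $ j) x) / 2))"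
  by (intro L2_inner_components2 strain_L2 test_vec_sobolev_vec strain_test_AE assms)

lemma L2_sq_test_strain_grad:
  assumes "\<phi> \<in> test_vector_fields \<Omega>"
  shows "nsq (strain_grad \<phi>) = (\<Sum>i\<in>UNIV. \<Sum>j\<in>UNIV. \<Sum>k\<in>UNIV.
     nsq (\<lambda>x. (pd j (pd k (\<lambda>y. \<phi> y $ i)) x + pd i (pd k (\<lambda>y. \<phi> y $ j)) x) / 2))"
proof -
  have comm: "pd j (pd k (\<lambda>y. \<phi> y $ i)) = pd k (pd j (\<lambda>y. \<phi> y $ i))" for i j k
    by (intro classical_partial_commute test_function_smooth[OF test_vec_component[OF assms]])
  have ae: "AE x in lebesgue_on \<Omega>. strain_grad \<phi> x $ i $ j $ k
      = (pd j (pd k (\<lambda>y. \<phi> y $ i)) x + pd i (pd k (\<lambda>y. \<phi> y $ j)) x) / 2" for i j k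
    using strain_grad_test_AE[OF assms, of i j k] by (simp only: comm[of j k] comm[of i k])
  show ?thesis
    by (intro L2_inner_components3 strain_grad_L2 test_vec_sobolev_vec ae assms)
qed

text \<open>
  Korn's first inequality. Two integrations by parts turn the integral of \<open>\<partial>\<^sub>j \<phi>\<^sub>i \<partial>\<^sub>i \<phi>\<^sub>j\<close> into that of
  \<open>\<partial>\<^sub>i \<phi>\<^sub>i \<partial>\<^sub>j \<phi>\<^sub>j\<close>. Summed over \<open>i\<close> and \<open>j\<close>, the mixed terms are the squared norm of the divergence.
\<close>

lemma korn_test_functions:
  fixes \<phi> :: "'n \<Rightarrow> 'n scalar_field"
  assumes t: "\<And>i. \<phi> i \<in> test_functions \<Omega>"
  defines "e \<equiv> \<lambda>i j x. (pd j (\<phi> i) x + pd i (\<phi> j) x) / 2"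
  shows "(\<Sum>i\<in>UNIV. \<Sum>j\<in>UNIV. nsq (pd j (\<phi> i)))
    \<le> 2 * (\<Sum>i\<in>UNIV. \<Sum>j\<in>UNIV. nsq (e i j))"
proof -
  define p where "p i j = pd j (\<phi> i)" for i j
  have pt: "p i j \<in> test_functions \<Omega>" for i j unfolding p_def by (intro test_function_partial t)
  have pL: "p i j \<in> L2_space \<Omega>" for i j by (intro test_L2 pt)
  have mixed: "ip (p i j) (p j i) = ip (p i i) (p j j)" for i j
  proof -
    have "ip (p i j) (p j i) = - ip (\<phi> i) (pd j (p j i))"
      unfolding p_def by (intro integral_by_parts test_function_partial t domain_sets)
    also have "pd j (p j i) = pd i (p j j)"
      unfolding p_def by (intro classical_partial_commute test_function_smooth[OF t])
    also have "- ip (\<phi> i) (pd i (p j j)) = ip (p i i) (p j j)"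
      unfolding p_def by (intro integral_by_parts[symmetric] test_function_partial t domain_sets)
    finally show ?thesis .
  qed
  have ee: "nsq (e i j)
      = (nsq (p i j) + 2 * ip (p i i) (p j j) + nsq (p j i)) / 4" for i j
  proof -
    have "e i j = (\<lambda>x. (1 / 2) * (p i j x + 1 *\<^sub>R p j i x))" by (simp add: e_def p_def fun_eq_iff)
    then show ?thesis
      using L2_inner_line[OF pL[of i j] pL[of j i], of 1] mixed[of i j]
      by (simp only: L2_inner_cmult_left L2_inner_cmult_right) simp
  qed
  have "(\<Sum>i\<in>UNIV. \<Sum>j\<in>UNIV. ip (p i i) (p j j))
      = nsq (\<lambda>x. \<Sum>i\<in>UNIV. p i i x)"
    by (simp add: L2_inner_sum_left L2_inner_commute[of \<Omega> "p _ _" "\<lambda>x. \<Sum>i\<in>UNIV. p i i x"] pL L2_sum)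
       (simp add: L2_inner_commute)
  also have "\<dots> \<ge> 0" by (rule L2_inner_self_nonneg)
  finally have "0 \<le> (\<Sum>i\<in>UNIV. \<Sum>j\<in>UNIV. ip (p i i) (p j j))" .
  moreover have "(\<Sum>i\<in>UNIV. \<Sum>j\<in>UNIV. nsq (p j i)) = (\<Sum>i\<in>UNIV. \<Sum>j\<in>UNIV. nsq (p i j))"
    by (rule sum.swap)
  moreover have "2 * (\<Sum>i\<in>UNIV. \<Sum>j\<in>UNIV. nsq (e i j))
    = ((\<Sum>i\<in>UNIV. \<Sum>j\<in>UNIV. nsq (p i j)) + 2 * (\<Sum>i\<in>UNIV. \<Sum>j\<in>UNIV. ip (p i i) (p j j))
       + (\<Sum>i\<in>UNIV. \<Sum>j\<in>UNIV. nsq (p j i))) / 2"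
    unfolding ee by (simp add: sum.distrib sum_divide_distrib[symmetric] sum_distrib_left[symmetric])
  ultimately show ?thesis by (simp add: p_def)
qed

text \<open>Friedrichs' inequality: integrate \<open>\<partial>\<^sub>i (x\<^sub>i \<phi>\<^sup>2)\<close>, where \<open>x\<^sub>i\<close> is bounded on the domain.\<close>

lemma friedrichs:
  obtains K where "0 \<le> K" "\<And>\<phi> i. \<phi> \<in> test_functions \<Omega> \<Longrightarrow>
     nsq \<phi> \<le> K * nsq (pd i \<phi>)"
proof -
  obtain R where R: "\<And>x. x \<in> \<Omega> \<Longrightarrow> norm x \<le> R"
    using bounded_domain unfolding bounded_iff by blast
  show thesis
  proof (rule that[of "4 * R\<^sup>2"])
    fix \<phi> :: "'n scalar_field" and i
    assume t: "\<phi> \<in> test_functions \<Omega>"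
    let ?p = "pd i \<phi>" and ?m = "\<lambda>x. x $ i * \<phi> x"
    have mt: "?m \<in> test_functions \<Omega>" by (intro test_function_mult smooth_coordinate t)
    have pt: "?p \<in> test_functions \<Omega>" by (rule test_function_partial[OF t])
    have xpt: "(\<lambda>x. x $ i * ?p x) \<in> test_functions \<Omega>" by (intro test_function_mult smooth_coordinate pt)
    have dm: "pd i ?m = (\<lambda>x. x $ i * ?p x + \<phi> x)"
      using classical_partial_mult[OF smooth_differentiable[OF smooth_coordinate] smooth_differentiable[OF test_function_smooth[OF t]], of i i]
      by (simp add: fun_eq_iff classical_partial_coordinate)
    have "ip ?p ?m = - ip \<phi> (\<lambda>x. x $ i * ?p x + \<phi> x)"
      using integral_by_parts[OF t mt domain_sets, of i] by (simp add: dm)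
    also have "\<dots> = - ip \<phi> (\<lambda>x. x $ i * ?p x) - nsq \<phi>"
      by (simp add: L2_inner_add_right test_L2 t xpt)
    also have "ip \<phi> (\<lambda>x. x $ i * ?p x) = ip ?p ?m"
      by (simp add: L2_inner_def mult_ac)
    finally have eq: "nsq \<phi> = - 2 * ip ?p ?m" by simp
    have "nsq ?m \<le> ip (\<lambda>x. R\<^sup>2 * \<phi> x) \<phi>"
    proof (intro L2_inner_mono AE_I2 L2_cmult test_L2[OF mt] test_L2[OF t])
      fix x assume "x \<in> space (lebesgue_on \<Omega>)"
      then have "\<bar>x $ i\<bar> \<le> R" using R component_le_norm_cart[of x i] by fastforce
      then have "(x $ i)\<^sup>2 \<le> R\<^sup>2" using power_mono[of "\<bar>x $ i\<bar>" R 2] by simp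
      from mult_right_mono[OF this, of "(\<phi> x)\<^sup>2"]
      show "?m x \<bullet> ?m x \<le> (R\<^sup>2 * \<phi> x) \<bullet> \<phi> x" by (simp add: power2_eq_square mult_ac)
    qed
    then have m: "nsq ?m \<le> R\<^sup>2 * nsq \<phi>" by (simp add: L2_inner_cmult_left)
    let ?a = "nsq \<phi>" and ?b = "nsq ?p"
    have "?a * ?a = 4 * (ip ?p ?m)\<^sup>2" by (simp add: eq power2_eq_square)
    also have "\<dots> \<le> 4 * (?b * nsq ?m)"
      by (intro mult_left_mono L2_Cauchy_Schwarz test_L2 pt mt) simp
    also have "\<dots> \<le> 4 * (?b * (R\<^sup>2 * ?a))"
      by (intro mult_left_mono m L2_inner_self_nonneg) simp
    finally have "?a * ?a \<le> ?a * (4 * R\<^sup>2 * ?b)" by (simp add: mult_ac)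
    then show "?a \<le> 4 * R\<^sup>2 * ?b"
      using L2_inner_self_nonneg[of \<Omega> \<phi>] L2_inner_self_nonneg[of \<Omega> ?p]
      by (cases "?a = 0") (auto simp: mult_le_cancel_left less_le)
  qed simp
qed

lemma member_le_double_sum:
  fixes f :: "'n \<Rightarrow> 'n \<Rightarrow> real"
  assumes "\<And>i j. 0 \<le> f i j"
  shows "f a b \<le> (\<Sum>i\<in>UNIV. \<Sum>j\<in>UNIV. f i j)"
proof -
  have "f a b \<le> (\<Sum>j\<in>UNIV. f a j)" by (rule member_le_sum) (simp_all add: assms)
  also have "\<dots> \<le> (\<Sum>i\<in>UNIV. \<Sum>j\<in>UNIV. f i j)" by (rule member_le_sum) (simp_all add: assms sum_nonneg)
  finally show ?thesis .
qed

lemma test_first_derivative_bound: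
  assumes "\<phi> \<in> test_vector_fields \<Omega>"
  shows "nsq (pd j (\<lambda>y. \<phi> y $ i))
    \<le> 2 * nsq (\<epsilon> \<phi>)"
proof -
  have t: "(\<lambda>y. \<phi> y $ i) \<in> test_functions \<Omega>" for i using assms by (simp add: test_vector_fields_def)
  have "nsq (pd j (\<lambda>y. \<phi> y $ i))
    \<le> (\<Sum>i\<in>UNIV. \<Sum>j\<in>UNIV. nsq (pd j (\<lambda>y. \<phi> y $ i)))"
    by (rule member_le_double_sum) (rule L2_inner_self_nonneg)
  also have "\<dots> \<le> 2 * nsq (\<epsilon> \<phi>)"
    unfolding L2_sq_test_strain[OF assms] by (rule korn_test_functions[OF t])
  finally show ?thesis .
qed

text \<open>Korn's inequality applied to \<open>\<partial>\<^sub>k \<phi>\<close>, whose strain is a slice of the gradient of the strain of \<open>\<phi>\<close>.\<close>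

lemma test_second_derivative_bound:
  assumes "\<phi> \<in> test_vector_fields \<Omega>"
  shows "nsq (pd j (pd k (\<lambda>y. \<phi> y $ i)))
    \<le> 2 * nsq (strain_grad \<phi>)"
proof -
  have t: "pd k (\<lambda>y. \<phi> y $ i) \<in> test_functions \<Omega>" for i k
    using assms by (simp add: test_vector_fields_def test_function_partial)
  let ?q = "\<lambda>i k. pd k (\<lambda>y. \<phi> y $ i)"
  let ?e = "\<lambda>i j k x. (pd j (?q i k) x + pd i (?q j k) x) / 2"
  have "nsq (pd j (?q i k))
    \<le> (\<Sum>i\<in>UNIV. \<Sum>j\<in>UNIV. nsq (pd j (?q i k)))"
    by (rule member_le_double_sum) (rule L2_inner_self_nonneg)
  also have "\<dots> \<le> 2 * (\<Sum>i\<in>UNIV. \<Sum>j\<in>UNIV. nsq (?e i j k))"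
    by (rule korn_test_functions[OF t])
  also have "\<dots> \<le> 2 * (\<Sum>i\<in>UNIV. \<Sum>j\<in>UNIV. \<Sum>k\<in>UNIV. nsq (?e i j k))"
    by (intro mult_left_mono sum_mono member_le_sum[of k UNIV]) (simp_all add: L2_inner_self_nonneg)
  also have "\<dots> = 2 * nsq (strain_grad \<phi>)"
    unfolding L2_sq_test_strain_grad[OF assms] ..
  finally show ?thesis .
qed

text \<open>
  Friedrichs' inequality bounds \<open>\<phi>\<^sub>i\<close> by \<open>\<partial>\<^sub>i \<phi>\<^sub>i\<close>, which Korn's inequality bounds by the strain. The estimate
  passes to the closure of the test fields.
\<close>

lemma korn_H1:
  obtains K where "0 \<le> K" "\<And>v. v \<in> sobolev0_vec 1 \<Omega> \<Longrightarrow>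
    nsq v \<le> K * nsq (\<epsilon> v)"
proof -
  obtain K where K: "0 \<le> K" "\<And>\<phi> i. \<phi> \<in> test_functions \<Omega> \<Longrightarrow>
     nsq \<phi> \<le> K * nsq (pd i \<phi>)"
    using friedrichs by blast
  have test: "nsq \<phi> \<le> (real CARD('n) * (K * 2)) * nsq (\<epsilon> \<phi>)"
    if \<phi>: "\<phi> \<in> test_vector_fields \<Omega>" for \<phi>
  proof -
    have "nsq \<phi> = (\<Sum>i\<in>UNIV. nsq (\<lambda>x. \<phi> x $ i))"
      by (intro L2_inner_vec sobolev_vec_L2[OF test_vec_sobolev_vec[OF \<phi>]])
    also have "\<dots> \<le> (\<Sum>i\<in>(UNIV::'n set). K * (2 * nsq (\<epsilon> \<phi>)))"
    proof (rule sum_mono)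
      fix i
      have "(\<lambda>x. \<phi> x $ i) \<in> test_functions \<Omega>" using \<phi> by (simp add: test_vector_fields_def)
      from K(2)[OF this, of i] mult_left_mono[OF test_first_derivative_bound[OF \<phi>, of i i] K(1)]
      show "nsq (\<lambda>x. \<phi> x $ i) \<le> K * (2 * nsq (\<epsilon> \<phi>))"
        by (rule order_trans)
    qed
    finally show ?thesis by (simp add: mult.assoc)
  qed
  show thesis
  proof (rule that)
    show "0 \<le> real CARD('n) * (K * 2)" using K(1) by simp
    fix v assume v: "v \<in> sobolev0_vec 1 \<Omega>"
    obtain V where V: "\<And>n. V n \<in> test_vector_fields \<Omega>" "vec_tendsto 1 V v"
      using sobolev0_vec_approx[OF v] by blast
    have 1: "L2_tendsto \<Omega> V v"
      by (rule vec_tendsto_L2[OF V(2) test_vec_sobolev_vec[OF V(1)] sobolev0_vec_sobolev_vec[OF v]])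
    have 2: "L2_tendsto \<Omega> (\<lambda>n. \<epsilon> (V n)) (\<epsilon> v)" by (rule strain_tendsto[OF V(2)])
    show "nsq v \<le> real CARD('n) * (K * 2) * nsq (\<epsilon> v)"
      by (rule LIMSEQ_le[OF L2_inner_tendsto[OF 1 1] tendsto_mult[OF tendsto_const L2_inner_tendsto[OF 2 2]]])
         (use test[OF V(1)] in blast)
  qed
qed

text \<open>
  Derivatives of order two and one are bounded by Korn's inequality for \<open>\<partial>\<^sub>k \<phi>\<close> and for \<open>\<phi>\<close>, and \<open>\<phi>\<close> itself by
  Friedrichs' inequality.
\<close>

lemma korn_H2_test:
  obtains K where "0 \<le> K" "\<And>\<phi> is i. \<phi> \<in> test_vector_fields \<Omega> \<Longrightarrow> length is \<le> 2 \<Longrightarrow>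
    nsq (wd is (\<lambda>x. \<phi> x $ i))
    \<le> K * (nsq (\<epsilon> \<phi>) + nsq (strain_grad \<phi>))"
proof -
  obtain K where K: "0 \<le> K" "\<And>\<phi> i. \<phi> \<in> test_functions \<Omega> \<Longrightarrow>
     nsq \<phi> \<le> K * nsq (pd i \<phi>)"
    using friedrichs by blast
  show thesis
  proof (rule that[of "2 * K + 2"])
    show "0 \<le> 2 * K + 2" using K(1) by simp
    fix \<phi> :: "'n vector_field" and "is" :: "'n list" and i
    assume \<phi>: "\<phi> \<in> test_vector_fields \<Omega>" and l: "length is \<le> (2::nat)"
    let ?S = "nsq (\<epsilon> \<phi>)" and ?G = "nsq (strain_grad \<phi>)"
    let ?c = "foldr pd is (\<lambda>x. \<phi> x $ i)"
    have t: "(\<lambda>x. \<phi> x $ i) \<in> test_functions \<Omega>" using \<phi> by (simp add: test_vector_fields_def)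
    have eq: "nsq (wd is (\<lambda>x. \<phi> x $ i)) = nsq ?c"
      by (intro L2_inner_cong_AE weak_deriv_test_AE t test_L2 test_function_foldr_partial sobolevD(2)[OF test_sobolev[OF t] l])
    have SG: "0 \<le> ?S" "0 \<le> ?G" by (simp_all add: L2_inner_self_nonneg)
    have KS: "0 \<le> K * ?S" "0 \<le> K * ?G" using K(1) SG by simp_all
    have exp: "(2 * K + 2) * (?S + ?G) = 2 * (K * ?S) + 2 * (K * ?G) + 2 * ?S + 2 * ?G" by (simp add: algebra_simps)
    consider "is = []" | j where "is = [j]" | j k where "is = [j, k]"
      using l by (cases "is" rule: list.exhaust; cases "tl is" rule: list.exhaust) (auto simp: Suc_length_conv le_Suc_eq numeral_2_eq_2)
    then have "nsq ?c \<le> (2 * K + 2) * (?S + ?G)"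
    proof cases
      case 1
      have "nsq ?c \<le> K * (2 * ?S)"
        using K(2)[OF t, of i] mult_left_mono[OF test_first_derivative_bound[OF \<phi>, of i i] K(1)] 1 by simp
      then show ?thesis unfolding exp using SG KS by linarith
    next
      case 2
      then have "nsq ?c \<le> 2 * ?S" using test_first_derivative_bound[OF \<phi>, of j i] by simp
      then show ?thesis unfolding exp using SG KS by linarith
    next
      case 3
      then have "nsq ?c \<le> 2 * ?G" using test_second_derivative_bound[OF \<phi>, of j k i] by simp
      then show ?thesis unfolding exp using SG KS by linarith
    qed
    then show "nsq (wd is (\<lambda>x. \<phi> x $ i)) \<le> (2 * K + 2) * (?S + ?G)"
      unfolding eq .
  qed
qed

section \<open>The weak formulation has a solution\<close>

definition energy :: "real \<Rightarrow> real \<Rightarrow> real \<Rightarrow> 'n vector_field \<Rightarrow> 'n vector_field \<Rightarrow> real" where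
  "energy \<mu> lam \<iota> v w = \<iota>\<^sup>2 * ip (\<lambda>x. elasticity3 \<mu> lam (strain_grad v x)) (strain_grad w)
     + ip (\<lambda>x. elasticity2 \<mu> lam (\<epsilon> v x)) (\<epsilon> w)"

lemma strain_L2_H2: "v \<in> sobolev_vec 2 \<Longrightarrow> \<epsilon> v \<in> L2_space \<Omega>"
  by (rule strain_L2[OF sobolev_vec_mono[of 1 2]]) simp_all

lemma energy_commute: "energy \<mu> lam \<iota> v w = energy \<mu> lam \<iota> w v"
  unfolding energy_def L2_inner_elasticity3_commute[of \<Omega> \<mu> lam "strain_grad v"]
    L2_inner_elasticity2_commute[of \<Omega> \<mu> lam "\<epsilon> v"] ..

lemma energy_axpy:
  assumes u: "u \<in> sobolev_vec 2" and v: "v \<in> sobolev_vec 2" and w: "w \<in> sobolev_vec 2"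
  shows "energy \<mu> lam \<iota> (\<lambda>x. v x + c *\<^sub>R w x) u = energy \<mu> lam \<iota> v u + c * energy \<mu> lam \<iota> w u"
proof -
  note vw = sobolev_vec_axpy[OF v w, of c]
  have v1: "v \<in> sobolev_vec 1" and w1: "w \<in> sobolev_vec 1"
    using sobolev_vec_mono[of 1 2] v w by simp_all
  have "AE x in lebesgue_on \<Omega>. elasticity3 \<mu> lam (strain_grad (\<lambda>x. v x + c *\<^sub>R w x) x)
      = elasticity3 \<mu> lam (strain_grad v x) + c *\<^sub>R elasticity3 \<mu> lam (strain_grad w x)"
    using strain_grad_axpy_AE[OF v w, of c] by eventually_elim (simp add: elasticity3_axpy)
  note 1 = L2_inner_axpy_AE[OF _ _ _ _ this]
  have "AE x in lebesgue_on \<Omega>. elasticity2 \<mu> lam (\<epsilon> (\<lambda>x. v x + c *\<^sub>R w x) x)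
      = elasticity2 \<mu> lam (\<epsilon> v x) + c *\<^sub>R elasticity2 \<mu> lam (\<epsilon> w x)"
    using strain_axpy_AE[OF v1 w1, of c] by eventually_elim (simp add: elasticity2_axpy)
  note 2 = L2_inner_axpy_AE[OF _ _ _ _ this]
  show ?thesis
    unfolding energy_def
    by (simp add: 1 2 L2_elasticity3 L2_elasticity2 strain_grad_L2 strain_L2_H2 u v w vw algebra_simps)
qed

lemma energy_tendsto:
  assumes "vec_tendsto 2 V v" "w \<in> sobolev_vec 2"
  shows "(\<lambda>n. energy \<mu> lam \<iota> w (V n)) \<longlonglongrightarrow> energy \<mu> lam \<iota> w v"
  unfolding energy_def using assms
  by (intro tendsto_intros L2_inner_tendsto L2_tendsto_const strain_grad_tendsto strain_tendsto
      L2_elasticity3 L2_elasticity2 strain_grad_L2 strain_L2_H2 vec_tendsto_mono[of 1 2]) auto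

lemma energy_eq:
  assumes "v \<in> sobolev_vec 2" "w \<in> sobolev_vec 2"
  shows "\<iota>\<^sup>2 * ip (grad \<Omega> (stress \<Omega> \<mu> lam v)) (grad \<Omega> (\<epsilon> w))
    + ip (stress \<Omega> \<mu> lam v) (\<epsilon> w) = energy \<mu> lam \<iota> v w"
proof -
  have "ip (grad \<Omega> (stress \<Omega> \<mu> lam v)) (grad \<Omega> (\<epsilon> w))
    = ip (\<lambda>x. elasticity3 \<mu> lam (strain_grad v x)) (strain_grad w)"
    by (intro L2_inner_cong_AE grad_stress_AE grad_strain_AE grad_stress_L2 grad_strain_L2 L2_elasticity3
        strain_grad_L2 assms)
  then show ?thesis by (simp add: energy_def stress_eq_elasticity2[abs_def])
qed

lemma energy_coercive:
  assumes v: "v \<in> sobolev_vec 2" and "0 < \<mu>" "0 < lam" "0 < \<iota>" "\<iota> \<le> 1"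
  shows "2 * \<mu> * \<iota>\<^sup>2 * (nsq (\<epsilon> v) + nsq (strain_grad v))
    \<le> energy \<mu> lam \<iota> v v"
proof -
  let ?S = "nsq (\<epsilon> v)" and ?G = "nsq (strain_grad v)"
  have i: "\<iota>\<^sup>2 \<le> 1" using assms power_le_one[of \<iota> 2] by simp
  have "\<iota>\<^sup>2 * (2 * \<mu> * ?S) \<le> 1 * (2 * \<mu> * ?S)"
    using assms(2) L2_inner_self_nonneg[of \<Omega> "\<epsilon> v"] by (intro mult_right_mono i) simp
  also have "\<dots> \<le> ip (\<lambda>x. elasticity2 \<mu> lam (\<epsilon> v x)) (\<epsilon> v)"
    using L2_inner_elasticity2_coercive[OF strain_L2_H2[OF v]] assms(3) by simp
  finally have 1: "\<iota>\<^sup>2 * (2 * \<mu> * ?S) \<le> ip (\<lambda>x. elasticity2 \<mu> lam (\<epsilon> v x)) (\<epsilon> v)" .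
  have 2: "\<iota>\<^sup>2 * (2 * \<mu> * ?G) \<le> \<iota>\<^sup>2 * ip (\<lambda>x. elasticity3 \<mu> lam (strain_grad v x)) (strain_grad v)"
    using L2_inner_elasticity3_coercive[OF strain_grad_L2[OF v]] assms(3) by (intro mult_left_mono) simp_all
  show ?thesis using add_mono[OF 2 1] by (simp add: energy_def algebra_simps)
qed

text \<open>
  Both sides of the equation are continuous in \<open>v\<close> for the \<open>H\<^sup>2\<close>-norm, and test fields are dense in \<open>H\<^sub>0\<^sup>2\<close>.
\<close>

lemma weak_formulation_iff:
  assumes f: "f \<in> L2_space \<Omega>"
  shows "weak_formulation \<Omega> \<mu> lam \<iota> f u \<longleftrightarrow>
    u \<in> sobolev0_vec 2 \<Omega> \<and> (\<forall>\<phi>\<in>test_vector_fields \<Omega>. energy \<mu> lam \<iota> u \<phi> = ip f \<phi>)"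
proof -
  have ext: "energy \<mu> lam \<iota> u v = ip f v"
    if u: "u \<in> sobolev0_vec 2 \<Omega>" and t: "\<And>\<phi>. \<phi> \<in> test_vector_fields \<Omega> \<Longrightarrow> energy \<mu> lam \<iota> u \<phi> = ip f \<phi>"
      and v: "v \<in> sobolev0_vec 2 \<Omega>" for v
  proof -
    obtain V where V: "\<And>n. V n \<in> test_vector_fields \<Omega>" "vec_tendsto 2 V v"
      using sobolev0_vec_approx[OF v] by blast
    have "(\<lambda>n. energy \<mu> lam \<iota> u (V n)) \<longlonglongrightarrow> energy \<mu> lam \<iota> u v"
      by (rule energy_tendsto[OF V(2) sobolev0_vec_sobolev_vec[OF u]])
    moreover have "(\<lambda>n. ip f (V n)) \<longlonglongrightarrow> ip f v"
      by (intro L2_inner_tendsto L2_tendsto_const f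
          vec_tendsto_L2[OF V(2) test_vec_sobolev_vec[OF V(1)] sobolev0_vec_sobolev_vec[OF v]])
    ultimately show ?thesis by (simp add: t[OF V(1)] LIMSEQ_unique)
  qed
  show ?thesis
    unfolding weak_formulation_def
    using energy_eq[OF sobolev0_vec_sobolev_vec sobolev0_vec_sobolev_vec, of u _ \<iota> \<mu> lam] ext test_vec_sobolev0_vec
    by metis
qed

text \<open>
  The Riesz representation theorem for the energy on \<open>H\<^sub>0\<^sup>2\<close>: by Korn's inequality a minimising
  sequence of test fields is Cauchy together with all its derivatives up to order two.
\<close>

lemma weak_solution_exists:
  assumes pos: "0 < \<mu>" "0 < lam" "0 < \<iota>" "\<iota> \<le> 1" and f: "f \<in> L2_space \<Omega>"
  shows "\<exists>w. weak_formulation \<Omega> \<mu> lam \<iota> f w"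
proof -
  let ?T = "test_vector_fields \<Omega>" and ?a = "energy \<mu> lam \<iota>" and ?L = "ip f"
  let ?Q = "\<lambda>\<phi>. nsq (\<epsilon> \<phi>) + nsq (strain_grad \<phi>)"
  define c where "c = 2 * \<mu> * \<iota>\<^sup>2"
  have c: "0 < c" using pos by (simp add: c_def)
  note T2 = test_vec_sobolev_vec[of _ 2]
  have coer: "c * ?Q \<phi> \<le> ?a \<phi> \<phi>" if "\<phi> \<in> ?T" for \<phi>
    unfolding c_def by (rule energy_coercive[OF T2[OF that] pos])
  obtain K where K: "0 \<le> K" "\<And>\<phi> is i. \<phi> \<in> ?T \<Longrightarrow> length is \<le> 2 \<Longrightarrow>
    nsq (wd is (\<lambda>x. \<phi> x $ i)) \<le> K * ?Q \<phi>"
    using korn_H2_test by blast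
  have Ka: "nsq (wd is (\<lambda>x. \<phi> x $ i)) \<le> K / c * ?a \<phi> \<phi>"
    if "\<phi> \<in> ?T" "length is \<le> 2" for \<phi> "is" i
  proof -
    have "K * ?Q \<phi> = K / c * (c * ?Q \<phi>)" using c by simp
    also have "\<dots> \<le> K / c * ?a \<phi> \<phi>" using K(1) c by (intro mult_left_mono coer that(1)) simp
    finally show ?thesis using K(2)[OF that, of i] by linarith
  qed
  have a_nonneg: "0 \<le> ?a \<phi> \<phi>" if "\<phi> \<in> ?T" for \<phi>
    using coer[OF that] c by (meson L2_inner_self_nonneg add_nonneg_nonneg less_imp_le mult_nonneg_nonneg order_trans)
  obtain V where V: "\<And>n. V n \<in> ?T"
    "\<And>e. 0 < e \<Longrightarrow> \<exists>N. \<forall>m\<ge>N. \<forall>n\<ge>N. ?a (\<lambda>x. V m x - V n x) (\<lambda>x. V m x - V n x) < e"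
    "\<And>\<phi>. \<phi> \<in> ?T \<Longrightarrow> (\<lambda>n. ?a (V n) \<phi>) \<longlonglongrightarrow> ?L \<phi>"
  proof (rule minimising_sequence[of ?T ?a ?L "nsq f * (real CARD('n) * (K / c))"])
    show "?T \<noteq> {}" using test_function_zero by (auto simp: test_vector_fields_def intro!: exI[of _ "\<lambda>x. 0"])
    show "(\<lambda>x. v x + c *\<^sub>R w x) \<in> ?T" if "v \<in> ?T" "w \<in> ?T" for v w c by (rule test_vec_axpy[OF that])
    show "?a (\<lambda>x. v x + c *\<^sub>R w x) u = ?a v u + c * ?a w u" if "u \<in> ?T" "v \<in> ?T" "w \<in> ?T" for u v w c
      by (intro energy_axpy T2 that)
    show "?a v w = ?a w v" for v w by (rule energy_commute)
    show "?L (\<lambda>x. v x + c *\<^sub>R w x) = ?L v + c * ?L w" if "v \<in> ?T" "w \<in> ?T" for v w c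
      using sobolev_vec_L2[OF T2] that f by (simp add: L2_inner_add_right L2_scaleR L2_inner_scaleR_right)
    show "0 \<le> nsq f * (real CARD('n) * (K / c))" using K(1) c by (simp add: L2_inner_self_nonneg)
    fix v assume v: "v \<in> ?T"
    show "0 \<le> ?a v v" by (rule a_nonneg[OF v])
    have vL: "v \<in> L2_space \<Omega>" by (rule sobolev_vec_L2[OF T2[OF v]])
    have "nsq v = (\<Sum>i\<in>UNIV. nsq (\<lambda>x. v x $ i))" by (rule L2_inner_vec[OF vL vL])
    also have "\<dots> \<le> (\<Sum>i\<in>(UNIV::'n set). K / c * ?a v v)"
    proof (rule sum_mono)
      fix i
      note vi = sobolev_vecD[OF T2[OF v], of i]
      have "nsq (\<lambda>x. v x $ i) = nsq (wd [] (\<lambda>x. v x $ i))"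
        by (intro L2_inner_cong_AE AE_symmetric[OF sobolev_AE_Nil[OF vi]] sobolev_L2[OF vi] sobolevD(2)[OF vi]) simp_all
      then show "nsq (\<lambda>x. v x $ i) \<le> K / c * ?a v v" using Ka[OF v, of "[]" i] by simp
    qed
    finally have "nsq v \<le> real CARD('n) * (K / c) * ?a v v" by simp
    from mult_left_mono[OF this L2_inner_self_nonneg[of \<Omega> f]] L2_Cauchy_Schwarz[OF f vL]
    show "(?L v)\<^sup>2 \<le> nsq f * (real CARD('n) * (K / c)) * ?a v v" by (simp add: mult.assoc)
  qed blast
  note Vs = sobolev_vecD[OF T2[OF V(1)]]
  have "\<exists>g. L2_tendsto \<Omega> (\<lambda>n. wd is (\<lambda>x. V n x $ i)) g" if l: "length is \<le> 2" for "is" i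
  proof (rule L2_complete[OF domain_lmeasurable sobolevD(2)[OF Vs l]])
    let ?d = "\<lambda>m n x. wd is (\<lambda>x. V m x $ i) x - wd is (\<lambda>x. V n x $ i) x"
    let ?e = "\<lambda>m n x. V m x - V n x"
    fix r :: real assume "0 < r"
    \<comment> \<open>The summand \<open>1\<close> allows dividing by this factor even if \<open>K = 0\<close>.\<close>
    have kc: "0 < K / c + 1" using K(1) c by (simp add: add_nonneg_pos)
    then have "0 < r / (K / c + 1)" using \<open>0 < r\<close> by simp
    from V(2)[OF this] obtain N where N: "\<And>m n. m \<ge> N \<Longrightarrow> n \<ge> N \<Longrightarrow> ?a (?e m n) (?e m n) < r / (K / c + 1)"
      by blast
    have "nsq (?d m n) < r" if mn: "m \<ge> N" "n \<ge> N" for m n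
    proof -
      have D: "?e m n \<in> ?T" using test_vec_axpy[OF V(1) V(1), of m "-1" n] by simp
      have "nsq (?d m n) = nsq (wd is (\<lambda>x. ?e m n x $ i))"
        using L2_inner_weak_deriv_diff[OF Vs Vs l, of m i n i] by simp
      also have "\<dots> \<le> K / c * ?a (?e m n) (?e m n)" by (rule Ka[OF D l])
      also have "\<dots> \<le> (K / c + 1) * ?a (?e m n) (?e m n)"
        by (intro mult_right_mono a_nonneg D) simp
      also have "\<dots> < (K / c + 1) * (r / (K / c + 1))" by (intro mult_strict_left_mono N mn kc)
      also have "\<dots> = r" using kc by simp
      finally show ?thesis .
    qed
    then show "\<exists>N. \<forall>m\<ge>N. \<forall>n\<ge>N. nsq (?d m n) < r" by blast
  qed
  then obtain g where g: "\<And>is i. length is \<le> 2 \<Longrightarrow> L2_tendsto \<Omega> (\<lambda>n. wd is (\<lambda>x. V n x $ i)) (g is i)"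
    by metis
  define w where "w x = (\<chi> i. g [] i x)" for x
  have gL: "g is i \<in> L2_space \<Omega>" if "length is \<le> 2" for "is" i using g[OF that] by (simp add: L2_tendsto_def)
  have lim: "L2_tendsto \<Omega> (\<lambda>n x. V n x $ i) (g [] i)" for i
  proof (rule L2_tendsto_cong_AE)
    show "L2_tendsto \<Omega> (\<lambda>n. wd [] (\<lambda>x. V n x $ i)) (g [] i)" by (rule g) simp
  qed (simp_all add: sobolev_L2[OF Vs] sobolev_AE_Nil[OF Vs] gL)
  have wd: "has_weak_deriv \<Omega> is (\<lambda>x. w x $ i) (g is i)" if l: "length is \<le> 2" for "is" i
    using has_weak_deriv_limit[OF lim g[OF l] sobolevD(1)[OF Vs l]] by (simp add: w_def)
  have ws: "(\<lambda>x. w x $ i) \<in> sobolev 2 \<Omega>" for i by (rule sobolevI[OF wd gL])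
  have w_lim: "vec_tendsto 2 V w"
    unfolding vec_tendsto_def sobolev_tendsto_def
  proof (intro allI impI)
    fix i and "is" :: "'n list" assume l: "length is \<le> 2"
    show "L2_tendsto \<Omega> (\<lambda>n. wd is (\<lambda>x. V n x $ i)) (wd is (\<lambda>x. w x $ i))"
      by (rule L2_tendsto_cong_AE[OF g[OF l, of i]])
         (simp_all add: sobolevD(2)[OF Vs l] sobolevD(2)[OF ws l] AE_symmetric[OF weak_deriv_AE[OF wd[OF l]]])
  qed
  have "w \<in> sobolev0_vec 2 \<Omega>"
    unfolding sobolev0_vec_def sobolev0_iff_limit mem_Collect_eq
  proof (intro allI conjI ws exI)
    fix i
    show "(\<lambda>x. V n x $ i) \<in> test_functions \<Omega>" for n using V(1) by (simp add: test_vector_fields_def)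
    show "sobolev_tendsto 2 (\<lambda>n x. V n x $ i) (\<lambda>x. w x $ i)" using w_lim by (simp add: vec_tendsto_def)
  qed
  moreover have "?a w \<phi> = ?L \<phi>" if \<phi>: "\<phi> \<in> ?T" for \<phi>
  proof -
    have "(\<lambda>n. ?a \<phi> (V n)) \<longlonglongrightarrow> ?a \<phi> w" by (rule energy_tendsto[OF w_lim T2[OF \<phi>]])
    then have "(\<lambda>n. ?a (V n) \<phi>) \<longlonglongrightarrow> ?a w \<phi>" by (simp only: energy_commute[of _ _ _ \<phi>])
    then show ?thesis using V(3)[OF \<phi>] LIMSEQ_unique by blast
  qed
  ultimately show ?thesis unfolding weak_formulation_iff[OF f] by blast
qed

section \<open>The double divergence\<close>

lemma div_div_eq:
  "div_div \<Omega> \<Psi> i \<phi> = (\<Sum>j\<in>UNIV. \<Sum>k\<in>UNIV.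
     ip (\<lambda>x. \<Psi> x $ i $ j $ k) (pd k (pd j \<phi>)))"
  by (simp add: div_div_def distr_div2_def distr_div3_def distr_partial_def distr_eq_L2_inner sum_negf)

text \<open>
  A symmetric family annihilates the antisymmetric part of \<open>p\<close>.
\<close>

lemma sum_L2_inner_symmetric:
  fixes t p :: "'n \<Rightarrow> 'n \<Rightarrow> 'n scalar_field"
  assumes t: "\<And>i j. t i j \<in> L2_space \<Omega>" and p: "\<And>i j. p i j \<in> L2_space \<Omega>"
    and sym: "\<And>i j. AE x in lebesgue_on \<Omega>. t i j x = t j i x"
  shows "(\<Sum>i\<in>UNIV. \<Sum>j\<in>UNIV. ip (t i j) (\<lambda>x. (p i j x + p j i x) / 2)) = (\<Sum>i\<in>UNIV. \<Sum>j\<in>UNIV. ip (t i j) (p i j))"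
proof -
  have avg: "ip (t i j) (\<lambda>x. (p i j x + p j i x) / 2) = (ip (t i j) (p i j) + ip (t j i) (p j i)) / 2" for i j
  proof -
    have "ip (t i j) (p j i) = ip (t j i) (p j i)" by (intro L2_inner_cong_AE t p sym) simp
    then show ?thesis
      using L2_inner_cmult_right[of \<Omega> "t i j" "1 / 2" "\<lambda>x. p i j x + p j i x"]
      by (simp add: L2_inner_add_right t p)
  qed
  have swap: "(\<Sum>i\<in>UNIV. \<Sum>j\<in>UNIV. ip (t j i) (p j i)) = (\<Sum>i\<in>UNIV. \<Sum>j\<in>UNIV. ip (t i j) (p i j))"
    by (rule sum.swap)
  show ?thesis unfolding avg by (simp add: sum.distrib sum_divide_distrib[symmetric] swap)
qed

lemma L2_inner_symmetric_test_strain: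
  assumes \<phi>: "\<phi> \<in> test_vector_fields \<Omega>" and \<tau>: "\<tau> \<in> L2_space \<Omega>"
    and sym: "\<And>i j x. \<tau> x $ i $ j = \<tau> x $ j $ i"
  shows "ip \<tau> (\<epsilon> \<phi>) = (\<Sum>i\<in>UNIV. \<Sum>j\<in>UNIV. ip (\<lambda>x. \<tau> x $ i $ j) (pd j (\<lambda>x. \<phi> x $ i)))"
proof -
  note pL = test_L2[OF test_function_partial[OF test_vec_component[OF \<phi>]]]
  have tL: "(\<lambda>x. \<tau> x $ i $ j) \<in> L2_space \<Omega>" for i j using \<tau> by (simp add: L2_space_vec_iff)
  show ?thesis
    unfolding sum_L2_inner_symmetric[OF tL pL AE_I2[OF sym], symmetric]
    by (intro L2_inner_components2 \<tau> strain_L2 test_vec_sobolev_vec \<phi> strain_test_AE) simp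
qed

text \<open>
  The double divergence lets \<open>\<Psi>\<^sub>i\<^sub>j\<^sub>k\<close> act on \<open>\<partial>\<^sub>k \<partial>\<^sub>j \<phi>\<^sub>i\<close>. By the symmetry of \<open>\<Psi>\<close> only the part of this that is
  symmetric in \<open>i\<close> and \<open>j\<close> contributes, and that part is the gradient of the strain.
\<close>

lemma L2_inner_symmetric_test_strain_grad:
  assumes \<phi>: "\<phi> \<in> test_vector_fields \<Omega>" and \<Psi>: "\<Psi> \<in> L2_space \<Omega>"
    and sym: "AE x in lebesgue_on \<Omega>. \<forall>i j k. \<Psi> x $ i $ j $ k = \<Psi> x $ j $ i $ k"
  shows "ip \<Psi> (strain_grad \<phi>) = (\<Sum>i\<in>UNIV. div_div \<Omega> \<Psi> i (\<lambda>x. \<phi> x $ i))"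
proof -
  let ?p = "\<lambda>i j k. pd k (pd j (\<lambda>x. \<phi> x $ i))" and ?t = "\<lambda>i j k x. \<Psi> x $ i $ j $ k"
  note pL = test_L2[OF test_function_partial[OF test_function_partial[OF test_vec_component[OF \<phi>]]]]
  have sym': "AE x in lebesgue_on \<Omega>. ?t i j k x = ?t j i k x" for i j k
    using sym by eventually_elim simp
  have rot: "(\<Sum>i\<in>UNIV. \<Sum>j\<in>UNIV. \<Sum>k\<in>UNIV. F i j k) = (\<Sum>k\<in>UNIV. \<Sum>i\<in>UNIV. \<Sum>j\<in>UNIV. F i j k)"
    for F :: "'n \<Rightarrow> 'n \<Rightarrow> 'n \<Rightarrow> real"
  proof -
    have "(\<Sum>i\<in>UNIV. \<Sum>j\<in>UNIV. \<Sum>k\<in>UNIV. F i j k) = (\<Sum>i\<in>UNIV. \<Sum>k\<in>UNIV. \<Sum>j\<in>UNIV. F i j k)"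
      by (intro sum.cong refl sum.swap)
    also have "\<dots> = (\<Sum>k\<in>UNIV. \<Sum>i\<in>UNIV. \<Sum>j\<in>UNIV. F i j k)" by (rule sum.swap)
    finally show ?thesis .
  qed
  have "ip \<Psi> (strain_grad \<phi>) = (\<Sum>i\<in>UNIV. \<Sum>j\<in>UNIV. \<Sum>k\<in>UNIV. ip (?t i j k) (\<lambda>x. (?p i j k x + ?p j i k x) / 2))"
    by (intro L2_inner_components3 \<Psi> strain_grad_L2 test_vec_sobolev_vec \<phi> strain_grad_test_AE) simp
  also have "\<dots> = (\<Sum>k\<in>UNIV. \<Sum>i\<in>UNIV. \<Sum>j\<in>UNIV. ip (?t i j k) (\<lambda>x. (?p i j k x + ?p j i k x) / 2))"
    by (rule rot)
  also have "\<dots> = (\<Sum>k\<in>UNIV. \<Sum>i\<in>UNIV. \<Sum>j\<in>UNIV. ip (?t i j k) (?p i j k))"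
    by (intro sum.cong refl sum_L2_inner_symmetric L2_vec3D[OF \<Psi>] pL sym')
  also have "\<dots> = (\<Sum>i\<in>UNIV. \<Sum>j\<in>UNIV. \<Sum>k\<in>UNIV. ip (?t i j k) (?p i j k))"
    by (rule rot[symmetric])
  finally show ?thesis by (simp add: div_div_eq)
qed

lemma H_minus1_tendsto:
  assumes F: "F \<in> H_minus1 \<Omega>" and V: "\<And>n. V n \<in> sobolev0_vec 1 \<Omega>" and v: "v \<in> sobolev0_vec 1 \<Omega>"
    and lim: "vec_tendsto 1 V v"
  shows "(\<lambda>n. F (V n)) \<longlonglongrightarrow> F v"
proof -
  obtain C where C: "\<And>w. w \<in> sobolev0_vec 1 \<Omega> \<Longrightarrow> \<bar>F w\<bar> \<le> C * sobolev_norm_vec 1 \<Omega> w"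
    using F unfolding H_minus1_def by blast
  have F_add: "F (\<lambda>x. a x + b x) = F a + F b" if "a \<in> sobolev0_vec 1 \<Omega>" "b \<in> sobolev0_vec 1 \<Omega>" for a b
    using F that unfolding H_minus1_def by blast
  define e where "e n = (\<lambda>x. v x - V n x)" for n
  have e: "e n \<in> sobolev0_vec 1 \<Omega>" for n using sobolev0_vec_axpy[OF v V, of "-1" n] by (simp add: e_def)
  have Fe: "F v - F (V n) = F (e n)" for n
    using F_add[OF V e, of n n] by (simp add: e_def)
  let ?N = "\<lambda>n. C\<^sup>2 * (sobolev_norm_vec 1 \<Omega> (e n))\<^sup>2"
  have le: "(F v - F (V n))\<^sup>2 \<le> ?N n" for n
    using power_mono[OF C[OF e[of n]], of 2] by (simp add: Fe power_mult_distrib)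
  have "?N \<longlonglongrightarrow> C\<^sup>2 * (\<Sum>i\<in>(UNIV::'n set). 0)"
    unfolding sobolev_norm_vec_def
  proof (simp only: real_sqrt_pow2[OF sum_nonneg[OF zero_le_power2]], intro tendsto_mult tendsto_const tendsto_sum)
    fix i
    show "(\<lambda>n. (sobolev_norm 1 \<Omega> (\<lambda>x. e n x $ i))\<^sup>2) \<longlonglongrightarrow> 0"
      using sobolev_norm_diff_tendsto[of 1 "\<lambda>n x. V n x $ i" "\<lambda>x. v x $ i"] lim V v
      by (simp add: e_def vec_tendsto_def sobolev0_vec_def sobolev0_sobolev)
  qed
  then have "?N \<longlonglongrightarrow> 0" by simp
  from tendsto_diff[OF tendsto_const[of "F v"] tendsto_0_of_square_le[OF le this]] show ?thesis by simp
qed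

text \<open>
  Bounded functionals on \<open>H\<^sub>0\<^sup>1\<close> are determined by their values on the dense set of test fields. So the
  duality pairing does not depend on the extension chosen in its definition.
\<close>

lemma extends_distr_unique:
  assumes "extends_distr \<Omega> T F" "extends_distr \<Omega> T G" "v \<in> sobolev0_vec 1 \<Omega>"
  shows "F v = G v"
proof -
  obtain V where V: "\<And>n. V n \<in> test_vector_fields \<Omega>" "vec_tendsto 1 V v"
    using sobolev0_vec_approx[OF assms(3)] by blast
  note lim = H_minus1_tendsto[OF _ test_vec_sobolev0_vec[OF V(1)] assms(3) V(2)]
  have "(\<lambda>n. F (V n)) \<longlonglongrightarrow> F v" "(\<lambda>n. G (V n)) \<longlonglongrightarrow> G v"
    using assms(1,2) unfolding extends_distr_def by (blast intro: lim)+
  moreover have "F (V n) = G (V n)" for n using assms V(1) by (simp add: extends_distr_def)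
  ultimately show ?thesis by (simp add: LIMSEQ_unique)
qed

lemma extends_distr_duality_pairing: "extends_distr \<Omega> T F \<Longrightarrow> extends_distr \<Omega> T (duality_pairing \<Omega> T)"
  unfolding duality_pairing_def[abs_def] by (rule someI[of "extends_distr \<Omega> T"])

lemma duality_pairing_eq:
  "extends_distr \<Omega> T F \<Longrightarrow> v \<in> sobolev0_vec 1 \<Omega> \<Longrightarrow> duality_pairing \<Omega> T v = F v"
  using extends_distr_unique extends_distr_duality_pairing by blast

text \<open>
  Convergence in \<open>H\<^sup>2\<close> implies convergence in \<open>H\<^sup>1\<close>, for which the pairing is continuous. Hence the identity
  extends from test fields to \<open>H\<^sub>0\<^sup>2\<close>.
\<close>

lemma duality_pairing_strain_grad:
  assumes \<Psi>: "\<Psi> \<in> H_minus1_div_div \<Omega>" and w: "w \<in> sobolev0_vec 2 \<Omega>"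
  shows "duality_pairing \<Omega> (div_div \<Omega> \<Psi>) w = ip \<Psi> (strain_grad w)"
proof -
  have L: "\<Psi> \<in> L2_space \<Omega>" and sym: "AE x in lebesgue_on \<Omega>. \<forall>i j k. \<Psi> x $ i $ j $ k = \<Psi> x $ j $ i $ k"
    and ext: "extends_distr \<Omega> (div_div \<Omega> \<Psi>) (duality_pairing \<Omega> (div_div \<Omega> \<Psi>))"
    using \<Psi> extends_distr_duality_pairing by (auto simp: H_minus1_div_div_def in_H_minus1_def)
  obtain V where V: "\<And>n. V n \<in> test_vector_fields \<Omega>" "vec_tendsto 2 V w"
    using sobolev0_vec_approx[OF w] by blast
  have "(\<lambda>n. duality_pairing \<Omega> (div_div \<Omega> \<Psi>) (V n)) \<longlonglongrightarrow> duality_pairing \<Omega> (div_div \<Omega> \<Psi>) w"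
  proof (rule H_minus1_tendsto)
    show "duality_pairing \<Omega> (div_div \<Omega> \<Psi>) \<in> H_minus1 \<Omega>" using ext by (simp add: extends_distr_def)
    show "V n \<in> sobolev0_vec 1 \<Omega>" for n by (rule test_vec_sobolev0_vec[OF V(1)])
    show "w \<in> sobolev0_vec 1 \<Omega>" by (rule sobolev0_vec_mono[OF _ w]) simp
    show "vec_tendsto 1 V w" by (rule vec_tendsto_mono[OF _ V(2)]) simp
  qed
  moreover have "duality_pairing \<Omega> (div_div \<Omega> \<Psi>) (V n) = ip \<Psi> (strain_grad (V n))" for n
    using ext V(1) by (simp add: extends_distr_def L2_inner_symmetric_test_strain_grad[OF V(1) L sym])
  moreover have "(\<lambda>n. ip \<Psi> (strain_grad (V n))) \<longlonglongrightarrow> ip \<Psi> (strain_grad w)"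
    by (intro L2_inner_tendsto L2_tendsto_const L strain_grad_tendsto V)
  ultimately show ?thesis by (simp add: LIMSEQ_unique)
qed

section \<open>Solutions of the weak formulation solve the mixed formulation\<close>

lemma L2_norm_le_sobolev_norm_vec:
  assumes v: "v \<in> sobolev_vec 1"
  shows "nsq v \<le> (sobolev_norm_vec 1 \<Omega> v)\<^sup>2"
    and "nsq (\<epsilon> v) \<le> (real CARD('n))\<^sup>2 * (sobolev_norm_vec 1 \<Omega> v)\<^sup>2"
proof -
  note vs = sobolev_vecD[OF v]
  let ?N = "\<lambda>is i. nsq (wd is (\<lambda>x. v x $ i))"
  have sq: "(sobolev_norm_vec 1 \<Omega> v)\<^sup>2 = (\<Sum>i\<in>UNIV. \<Sum>is | length is \<le> 1. ?N is i)"
    by (simp add: sobolev_norm_vec_def sum_nonneg sobolev_norm_square L2_inner_self_nonneg)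
  have le1: "?N is i \<le> (\<Sum>is | length is \<le> 1. ?N is i)" if "length is \<le> 1" for "is" i
    using that by (intro member_le_sum finite_multi_indices) (auto simp: L2_inner_self_nonneg)
  have le: "?N is i \<le> (sobolev_norm_vec 1 \<Omega> v)\<^sup>2" if "length is \<le> 1" for "is" i
  proof -
    have "(\<Sum>is | length is \<le> 1. ?N is i) \<le> (\<Sum>i\<in>UNIV. \<Sum>is | length is \<le> 1. ?N is i)"
      by (rule member_le_sum) (auto simp: L2_inner_self_nonneg sum_nonneg)
    with le1[OF that, of i] show ?thesis unfolding sq by linarith
  qed
  have nil: "nsq (\<lambda>x. v x $ i) = ?N [] i" for i
    by (intro L2_inner_cong_AE AE_symmetric[OF sobolev_AE_Nil[OF vs]] sobolev_L2[OF vs] sobolevD(2)[OF vs]) simp_all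
  have "nsq v = (\<Sum>i\<in>UNIV. ?N [] i)"
    unfolding nil[symmetric] by (intro L2_inner_vec sobolev_vec_L2[OF v])
  also have "\<dots> \<le> (sobolev_norm_vec 1 \<Omega> v)\<^sup>2" unfolding sq by (intro sum_mono le1) simp
  finally show "nsq v \<le> (sobolev_norm_vec 1 \<Omega> v)\<^sup>2" .
  let ?d = "\<lambda>i j. wd [j] (\<lambda>x. v x $ i)"
  have dL: "?d i j \<in> L2_space \<Omega>" for i j by (intro sobolevD(2)[OF vs]) simp
  have S: "\<epsilon> v \<in> L2_space \<Omega>" by (rule strain_L2[OF v])
  then have sL: "(\<lambda>x. \<epsilon> v x $ i $ j) \<in> L2_space \<Omega>" for i j by (simp add: L2_space_vec_iff)
  have comp: "nsq (\<lambda>x. \<epsilon> v x $ i $ j) \<le> (sobolev_norm_vec 1 \<Omega> v)\<^sup>2" for i j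
  proof -
    have eq: "(\<lambda>x. \<epsilon> v x $ i $ j) = (\<lambda>x. (1 / 2) * (?d i j x + 1 *\<^sub>R ?d j i x))"
      by (simp add: strain_def fun_eq_iff)
    have "nsq (\<lambda>x. \<epsilon> v x $ i $ j)
      = (?N [j] i + 2 * ip (?d i j) (?d j i) + ?N [i] j) / 4"
      unfolding eq L2_inner_cmult_left L2_inner_cmult_right L2_inner_line[OF dL dL] by simp
    moreover have "2 * ip (?d i j) (?d j i) \<le> ?N [j] i + ?N [i] j"
      using L2_inner_self_nonneg[of \<Omega> "\<lambda>x. ?d i j x + (-1) *\<^sub>R ?d j i x"] L2_inner_line[OF dL[of j i] dL[of i j], of "-1"]
      by simp
    ultimately show ?thesis using le[of "[j]" i] le[of "[i]" j] by simp
  qed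
  have "nsq (\<epsilon> v)
      = (\<Sum>i\<in>UNIV. \<Sum>j\<in>UNIV. nsq (\<lambda>x. \<epsilon> v x $ i $ j))"
    using S by (simp add: L2_inner_vec L2_space_vec_iff)
  also have "\<dots> \<le> (\<Sum>i\<in>(UNIV::'n set). \<Sum>j\<in>(UNIV::'n set). (sobolev_norm_vec 1 \<Omega> v)\<^sup>2)"
    by (intro sum_mono comp)
  finally show "nsq (\<epsilon> v) \<le> (real CARD('n))\<^sup>2 * (sobolev_norm_vec 1 \<Omega> v)\<^sup>2"
    by (simp add: power2_eq_square mult.assoc)
qed

text \<open>
  With \<open>\<sigma>\<close> the stress of a weak solution, this functional will turn out to extend the double divergence
  of \<open>\<iota>\<^sup>2 grad \<sigma>\<close>.
\<close>

lemma load_minus_stress_H_minus1: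
  assumes f: "f \<in> L2_space \<Omega>" and \<sigma>: "\<sigma> \<in> L2_space \<Omega>"
  shows "(\<lambda>v. ip f v - ip \<sigma> (\<epsilon> v)) \<in> H_minus1 \<Omega>"
  unfolding H_minus1_def mem_Collect_eq
proof (intro conjI ballI allI)
  fix v w assume "v \<in> sobolev0_vec 1 \<Omega>" "w \<in> sobolev0_vec 1 \<Omega>"
  then have v: "v \<in> sobolev_vec 1" and w: "w \<in> sobolev_vec 1" by (auto intro: sobolev0_vec_sobolev_vec)
  have vw: "(\<lambda>x. v x + w x) \<in> sobolev_vec 1" using sobolev_vec_axpy[OF v w, of 1] by simp
  have "ip \<sigma> (\<epsilon> (\<lambda>x. v x + w x)) = ip \<sigma> (\<epsilon> v) + ip \<sigma> (\<epsilon> w)"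
    using L2_inner_axpy_AE[OF strain_L2[OF vw] strain_L2[OF v] strain_L2[OF w] \<sigma>, of 1] strain_axpy_AE[OF v w, of 1]
    by (simp add: L2_inner_commute[of _ \<sigma>])
  then show "ip f (\<lambda>x. v x + w x) - ip \<sigma> (\<epsilon> (\<lambda>x. v x + w x)) = ip f v - ip \<sigma> (\<epsilon> v) + (ip f w - ip \<sigma> (\<epsilon> w))"
    by (simp add: L2_inner_add_right f sobolev_vec_L2[OF v] sobolev_vec_L2[OF w])
next
  fix c v assume "v \<in> sobolev0_vec 1 \<Omega>"
  then have v: "v \<in> sobolev_vec 1" by (auto intro: sobolev0_vec_sobolev_vec)
  have eq: "(\<lambda>x. c *\<^sub>R v x) = (\<lambda>x. v x + (c - 1) *\<^sub>R v x)" by (simp add: algebra_simps)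
  have "ip \<sigma> (\<epsilon> (\<lambda>x. c *\<^sub>R v x)) = ip \<sigma> (\<epsilon> v) + (c - 1) * ip \<sigma> (\<epsilon> v)"
    using L2_inner_axpy_AE[OF strain_L2[OF sobolev_vec_axpy[OF v v]] strain_L2[OF v] strain_L2[OF v] \<sigma> strain_axpy_AE[OF v v]]
    unfolding eq by (simp add: L2_inner_commute[of _ \<sigma>])
  then show "ip f (\<lambda>x. c *\<^sub>R v x) - ip \<sigma> (\<epsilon> (\<lambda>x. c *\<^sub>R v x)) = c * (ip f v - ip \<sigma> (\<epsilon> v))"
    by (simp add: L2_inner_scaleR_right algebra_simps)
next
  let ?C = "sqrt (nsq f) + sqrt (nsq \<sigma>) * real CARD('n)"
  show "\<exists>C. \<forall>v\<in>sobolev0_vec 1 \<Omega>. \<bar>ip f v - ip \<sigma> (\<epsilon> v)\<bar> \<le> C * sobolev_norm_vec 1 \<Omega> v"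
  proof (intro exI[of _ ?C] ballI)
    fix v assume "v \<in> sobolev0_vec 1 \<Omega>"
    then have v: "v \<in> sobolev_vec 1" by (auto intro: sobolev0_vec_sobolev_vec)
    have n: "0 \<le> sobolev_norm_vec 1 \<Omega> v" by (simp add: sobolev_norm_vec_def sum_nonneg)
    have cs: "\<bar>ip g h\<bar> \<le> sqrt (nsq g) * b"
      if "g \<in> L2_space \<Omega>" "h \<in> L2_space \<Omega>" "nsq h \<le> b\<^sup>2" "0 \<le> b" for g h :: "real ^ 'n \<Rightarrow> 'b::euclidean_space" and b
    proof -
      have "(ip g h)\<^sup>2 \<le> nsq g * b\<^sup>2"
        using L2_Cauchy_Schwarz[OF that(1,2)] mult_left_mono[OF that(3) L2_inner_self_nonneg[of \<Omega> g]] by linarith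
      then have "sqrt ((ip g h)\<^sup>2) \<le> sqrt (nsq g * b\<^sup>2)" by (rule real_sqrt_le_mono)
      then show ?thesis using that(4) by (simp add: real_sqrt_mult)
    qed
    have "\<bar>ip f v\<bar> \<le> sqrt (nsq f) * sobolev_norm_vec 1 \<Omega> v"
      by (intro cs f sobolev_vec_L2[OF v] L2_norm_le_sobolev_norm_vec(1)[OF v] n)
    moreover have "\<bar>ip \<sigma> (\<epsilon> v)\<bar> \<le> sqrt (nsq \<sigma>) * (real CARD('n) * sobolev_norm_vec 1 \<Omega> v)"
      using L2_norm_le_sobolev_norm_vec(2)[OF v] n
      by (intro cs \<sigma> strain_L2 v) (simp_all add: power_mult_distrib)
    ultimately show "\<bar>ip f v - ip \<sigma> (\<epsilon> v)\<bar> \<le> ?C * sobolev_norm_vec 1 \<Omega> v"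
      by (simp add: algebra_simps)
  qed
qed

lemma elasticity3_scaleR: "elasticity3 \<mu> lam (c *\<^sub>R E) = c *\<^sub>R elasticity3 \<mu> lam E"
  using elasticity3_axpy[of \<mu> lam 0 c E] elasticity3_axpy[of \<mu> lam 0 "-1" 0] by simp

lemma elasticity3_strain_grad_symmetric:
  "elasticity3 \<mu> lam (strain_grad v x) $ i $ j $ k = elasticity3 \<mu> lam (strain_grad v x) $ j $ i $ k"
  by (simp add: elasticity3_def strain_grad_def tensor_prod_def mat_def add.commute)

lemma stress_symmetric: "stress \<Omega> \<mu> lam v x $ i $ j = stress \<Omega> \<mu> lam v x $ j $ i"
  by (simp add: stress_def strain_def mat_def add.commute)

lemma stress_L2: "v \<in> sobolev_vec 1 \<Longrightarrow> stress \<Omega> \<mu> lam v \<in> L2_space \<Omega>"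
  unfolding stress_eq_elasticity2[abs_def] by (intro L2_elasticity2 strain_L2)

text \<open>
  Read with test fields, the weak formulation says that \<open>div div \<Phi>\<close> acts as \<open>(f, v) - (\<sigma>(w), \<epsilon>(v))\<close>. This
  functional is bounded on \<open>H\<^sub>0\<^sup>1\<close>, which gives both \<open>div div \<Phi> \<in> H\<^sup>-\<^sup>1\<close> and the second mixed equation. The
  first one is the adjointness of the double divergence, since the compliance of \<open>\<Phi>\<close> is \<open>\<iota>\<^sup>2 grad \<epsilon>(w)\<close>.
\<close>

lemma weak_imp_mixed:
  assumes pos: "0 < \<mu>" "0 < lam" "0 < \<iota>" and f: "f \<in> L2_space \<Omega>"
    and weak: "weak_formulation \<Omega> \<mu> lam \<iota> f w"
    and ae: "AE x in lebesgue_on \<Omega>. \<Phi> x = \<iota>\<^sup>2 *\<^sub>R grad \<Omega> (stress \<Omega> \<mu> lam w) x"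
  shows "mixed_formulation \<Omega> \<mu> lam \<iota> f \<Phi> w"
proof -
  have w: "w \<in> sobolev0_vec 2 \<Omega>" and eq: "\<And>\<phi>. \<phi> \<in> test_vector_fields \<Omega> \<Longrightarrow> energy \<mu> lam \<iota> w \<phi> = ip f \<phi>"
    using weak by (simp_all add: weak_formulation_iff[OF f])
  note w2 = sobolev0_vec_sobolev_vec[OF w]
  have w1: "w \<in> sobolev0_vec 1 \<Omega>" by (rule sobolev0_vec_mono[OF _ w]) simp
  have w1': "w \<in> sobolev_vec 1" by (rule sobolev0_vec_sobolev_vec[OF w1])
  note G = strain_grad_L2[OF w2]
  have \<Phi>_ae: "AE x in lebesgue_on \<Omega>. elasticity3 \<mu> lam (\<iota>\<^sup>2 *\<^sub>R strain_grad w x) = \<Phi> x"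
    using ae grad_stress_AE[OF w2, of \<mu> lam] by eventually_elim (simp add: elasticity3_scaleR)
  have \<Phi>: "\<Phi> \<in> L2_space \<Omega>"
    by (rule L2_vec_cong_AE[OF L2_elasticity3[OF L2_scaleR[OF G]] \<Phi>_ae])
  have \<Phi>_sym: "AE x in lebesgue_on \<Omega>. \<forall>i j k. \<Phi> x $ i $ j $ k = \<Phi> x $ j $ i $ k"
    using \<Phi>_ae
  proof eventually_elim
    case (elim x)
    show ?case
      unfolding elim[symmetric] elasticity3_scaleR
      using elasticity3_strain_grad_symmetric[of \<mu> lam w x] by simp
  qed
  define F where "F v = ip f v - ip (stress \<Omega> \<mu> lam w) (\<epsilon> v)" for v
  have ext: "extends_distr \<Omega> (div_div \<Omega> \<Phi>) F"
    unfolding extends_distr_def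
  proof (intro conjI ballI)
    show "F \<in> H_minus1 \<Omega>"
      unfolding F_def[abs_def] by (intro load_minus_stress_H_minus1 f stress_L2 w1')
    fix \<phi> assume \<phi>: "\<phi> \<in> test_vector_fields \<Omega>"
    have "(\<Sum>i\<in>UNIV. div_div \<Omega> \<Phi> i (\<lambda>x. \<phi> x $ i)) = ip \<Phi> (strain_grad \<phi>)"
      by (rule L2_inner_symmetric_test_strain_grad[OF \<phi> \<Phi> \<Phi>_sym, symmetric])
    also have "\<dots> = ip (\<lambda>x. \<iota>\<^sup>2 *\<^sub>R elasticity3 \<mu> lam (strain_grad w x)) (strain_grad \<phi>)"
      using \<Phi>_ae
      by (intro L2_inner_cong_AE \<Phi> L2_scaleR L2_elasticity3 G strain_grad_L2 test_vec_sobolev_vec \<phi>)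
         (auto simp: elasticity3_scaleR elim: eventually_mono)
    also have "\<dots> = F \<phi>"
      using eq[OF \<phi>] by (simp add: energy_def F_def L2_inner_scaleR_left stress_eq_elasticity2[abs_def])
    finally show "F \<phi> = (\<Sum>i\<in>UNIV. div_div \<Omega> \<Phi> i (\<lambda>x. \<phi> x $ i))" by simp
  qed
  then have \<Phi>H: "\<Phi> \<in> H_minus1_div_div \<Omega>"
    using \<Phi> \<Phi>_sym by (auto simp: H_minus1_div_div_def in_H_minus1_def)
  show ?thesis
    unfolding mixed_formulation_def
  proof (intro conjI ballI \<Phi>H w1)
    fix \<Psi> assume \<Psi>: "\<Psi> \<in> H_minus1_div_div \<Omega>"
    then have \<Psi>L: "\<Psi> \<in> L2_space \<Omega>" by (simp add: H_minus1_div_div_def)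
    have "ip (\<lambda>x. compliance \<mu> lam (\<Phi> x)) \<Psi> = ip (\<lambda>x. \<iota>\<^sup>2 *\<^sub>R strain_grad w x) \<Psi>"
    proof (intro L2_inner_cong_AE L2_compliance \<Phi> L2_scaleR G \<Psi>L)
      show "AE x in lebesgue_on \<Omega>. compliance \<mu> lam (\<Phi> x) = \<iota>\<^sup>2 *\<^sub>R strain_grad w x"
        using \<Phi>_ae by eventually_elim (use compliance_elasticity3[OF pos(1,2)] in metis)
    qed simp
    then show "1 / \<iota>\<^sup>2 * ip (\<lambda>x. compliance \<mu> lam (\<Phi> x)) \<Psi> - duality_pairing \<Omega> (div_div \<Omega> \<Psi>) w = 0"
      using pos(3) by (simp add: duality_pairing_strain_grad[OF \<Psi> w] L2_inner_scaleR_left L2_inner_commute[of \<Omega> \<Psi>])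
  next
    fix v assume v: "v \<in> sobolev0_vec 1 \<Omega>"
    show "- duality_pairing \<Omega> (div_div \<Omega> \<Phi>) v - ip (stress \<Omega> \<mu> lam w) (\<epsilon> v) = - ip f v"
      by (simp add: duality_pairing_eq[OF ext v] F_def)
  qed
qed

section \<open>Solutions of the mixed formulation are unique\<close>

lemma compliance_diff: "compliance \<mu> lam (A - B) = compliance \<mu> lam A - compliance \<mu> lam B"
  by (simp add: vec_eq_iff compliance_def tensor_prod_def trace3_def sum_subtractf algebra_simps)

lemma L2_inner_diff_diff:
  assumes "a \<in> L2_space \<Omega>" "b \<in> L2_space \<Omega>" "c \<in> L2_space \<Omega>" "d \<in> L2_space \<Omega>"
  shows "ip (\<lambda>x. a x - b x) (\<lambda>x. c x - d x)
    = ip a c - ip a d - ip b c + ip b d"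
  using assms by (simp add: L2_inner_diff_left L2_inner_diff_right L2_diff)

text \<open>
  Insert both \<open>\<Phi>\<close> and \<open>\<Theta>\<close> into the first equations and both \<open>u\<close> and \<open>w\<close> into the second ones. In the
  combination for the differences the pairings and the loads cancel.
\<close>

lemma mixed_unique:
  assumes pos: "0 < \<mu>" "0 < lam" "0 < \<iota>"
    and m1: "mixed_formulation \<Omega> \<mu> lam \<iota> f \<Phi> u" and m2: "mixed_formulation \<Omega> \<mu> lam \<iota> f \<Theta> w"
  shows "AE x in lebesgue_on \<Omega>. \<Phi> x = \<Theta> x" "AE x in lebesgue_on \<Omega>. u x = w x"
proof -
  let ?P = "\<lambda>\<Psi>. duality_pairing \<Omega> (div_div \<Omega> \<Psi>)" and ?A = "compliance \<mu> lam"
  have H: "\<Phi> \<in> H_minus1_div_div \<Omega>" "\<Theta> \<in> H_minus1_div_div \<Omega>" "u \<in> sobolev0_vec 1 \<Omega>" "w \<in> sobolev0_vec 1 \<Omega>"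
    using m1 m2 by (auto simp: mixed_formulation_def)
  have L: "\<Phi> \<in> L2_space \<Omega>" "\<Theta> \<in> L2_space \<Omega>" using H by (auto simp: H_minus1_div_div_def)
  have first: "ip (\<lambda>x. ?A (\<Phi> x)) \<Psi> = \<iota>\<^sup>2 * ?P \<Psi> u" "ip (\<lambda>x. ?A (\<Theta> x)) \<Psi> = \<iota>\<^sup>2 * ?P \<Psi> w"
    if "\<Psi> \<in> H_minus1_div_div \<Omega>" for \<Psi>
    using m1 m2 that pos(3) by (auto simp: mixed_formulation_def field_simps)
  have second: "?P \<Phi> v = ip f v - ip (stress \<Omega> \<mu> lam u) (\<epsilon> v)"
    "?P \<Theta> v = ip f v - ip (stress \<Omega> \<mu> lam w) (\<epsilon> v)"
    if "v \<in> sobolev0_vec 1 \<Omega>" for v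
    using m1 m2 that unfolding mixed_formulation_def by force+
  note us = sobolev0_vec_sobolev_vec[OF H(3)] and ws = sobolev0_vec_sobolev_vec[OF H(4)]
  define D where "D x = \<Phi> x - \<Theta> x" for x
  define T where "T x = \<epsilon> u x - \<epsilon> w x" for x
  have DL: "D \<in> L2_space \<Omega>" unfolding D_def[abs_def] by (intro L2_diff L)
  have TL: "T \<in> L2_space \<Omega>" unfolding T_def[abs_def] by (intro L2_diff strain_L2 us ws)
  have AD: "ip (\<lambda>x. ?A (D x)) D = ip (\<lambda>x. ?A (\<Phi> x)) \<Phi> - ip (\<lambda>x. ?A (\<Phi> x)) \<Theta>
      - ip (\<lambda>x. ?A (\<Theta> x)) \<Phi> + ip (\<lambda>x. ?A (\<Theta> x)) \<Theta>"
    unfolding D_def[abs_def] compliance_diff by (intro L2_inner_diff_diff L2_compliance L)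
  have e2: "elasticity2 \<mu> lam (A - B) = elasticity2 \<mu> lam A - elasticity2 \<mu> lam B" for A B :: "real ^ 'n ^ 'n"
    using elasticity2_axpy[of \<mu> lam A "-1" B] by simp
  have CT: "ip (\<lambda>x. elasticity2 \<mu> lam (T x)) T
      = ip (stress \<Omega> \<mu> lam u) (\<epsilon> u) - ip (stress \<Omega> \<mu> lam u) (\<epsilon> w)
       - ip (stress \<Omega> \<mu> lam w) (\<epsilon> u) + ip (stress \<Omega> \<mu> lam w) (\<epsilon> w)"
    unfolding T_def[abs_def] e2 stress_eq_elasticity2[abs_def]
    by (intro L2_inner_diff_diff L2_elasticity2 strain_L2 us ws)
  have sum0: "ip (\<lambda>x. ?A (D x)) D + \<iota>\<^sup>2 * ip (\<lambda>x. elasticity2 \<mu> lam (T x)) T = 0"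
    unfolding AD CT first[OF H(1)] first[OF H(2)] second[OF H(3)] second[OF H(4)] by (simp add: algebra_simps)
  define s where "s = 2 * \<mu> + real CARD('n) * lam"
  have s: "0 < s" using pos by (simp add: s_def add_pos_nonneg)
  have "nsq D \<le> ip (\<lambda>x. s *\<^sub>R ?A (D x)) D"
    by (intro L2_inner_mono DL L2_scaleR L2_compliance AE_I2) (simp add: s_def compliance_positive[OF pos(1,2)])
  then have 1: "nsq D \<le> s * ip (\<lambda>x. ?A (D x)) D" by (simp add: L2_inner_scaleR_left)
  have 2: "2 * \<mu> * nsq T \<le> ip (\<lambda>x. elasticity2 \<mu> lam (T x)) T"
    using L2_inner_elasticity2_coercive[OF TL] pos by simp
  have nD: "0 \<le> nsq D" and nT: "0 \<le> 2 * \<mu> * nsq T" using pos by (simp_all add: L2_inner_self_nonneg)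
  have "0 \<le> s * ip (\<lambda>x. ?A (D x)) D" using 1 nD by linarith
  then have nA: "0 \<le> ip (\<lambda>x. ?A (D x)) D" using s by (simp add: zero_le_mult_iff)
  have nC: "0 \<le> ip (\<lambda>x. elasticity2 \<mu> lam (T x)) T" using 2 nT by linarith
  have "ip (\<lambda>x. ?A (D x)) D = 0" "\<iota>\<^sup>2 * ip (\<lambda>x. elasticity2 \<mu> lam (T x)) T = 0"
    using sum0 nA nC mult_nonneg_nonneg[OF zero_le_power2[of \<iota>] nC] by linarith+
  then have z: "nsq D = 0" "nsq T = 0"
    using 1 2 nD nT pos by auto
  show "AE x in lebesgue_on \<Omega>. \<Phi> x = \<Theta> x"
    using L2_inner_self_eq_0D[OF DL z(1)] by eventually_elim (simp add: D_def)
  let ?e = "\<lambda>x. u x + (-1) *\<^sub>R w x"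
  have e: "?e \<in> sobolev0_vec 1 \<Omega>" by (rule sobolev0_vec_axpy[OF H(3,4)])
  have eL: "?e \<in> L2_space \<Omega>" by (rule sobolev_vec_L2[OF sobolev0_vec_sobolev_vec[OF e]])
  have "nsq (\<epsilon> ?e) = nsq T"
    using strain_axpy_AE[OF us ws, of "-1"]
    by (intro L2_inner_cong_AE strain_L2 sobolev0_vec_sobolev_vec[OF e] TL) (simp_all add: T_def)
  moreover obtain K where "nsq ?e \<le> K * nsq (\<epsilon> ?e)"
    using korn_H1 e by blast
  ultimately have "nsq ?e = 0" using z L2_inner_self_nonneg[of \<Omega> ?e] by simp
  from L2_inner_self_eq_0D[OF eL this] show "AE x in lebesgue_on \<Omega>. u x = w x"
    by eventually_elim simp
qed

text \<open>
  The mixed formulation inherits the regularity of its displacement from the weak formulation: the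
  solution of the latter yields a solution of the former, and there is only one.
\<close>

lemma mixed_imp_weak:
  assumes pos: "0 < \<mu>" "0 < lam" "0 < \<iota>" "\<iota> \<le> 1" and f: "f \<in> L2_space \<Omega>"
    and mixed: "mixed_formulation \<Omega> \<mu> lam \<iota> f \<Phi> u"
  shows "weak_formulation \<Omega> \<mu> lam \<iota> f u \<and> (AE x in lebesgue_on \<Omega>. \<Phi> x = \<iota>\<^sup>2 *\<^sub>R grad \<Omega> (stress \<Omega> \<mu> lam u) x)"
proof -
  obtain w where weak: "weak_formulation \<Omega> \<mu> lam \<iota> f w" using weak_solution_exists[OF pos f] by blast
  have "mixed_formulation \<Omega> \<mu> lam \<iota> f (\<lambda>x. \<iota>\<^sup>2 *\<^sub>R grad \<Omega> (stress \<Omega> \<mu> lam w) x) w"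
    by (rule weak_imp_mixed[OF pos(1-3) f weak]) simp
  note unique = mixed_unique[OF pos(1-3) mixed this]
  have w0: "w \<in> sobolev0_vec 2 \<Omega>" using weak by (simp add: weak_formulation_def)
  have w: "(\<lambda>x. w x $ i) \<in> sobolev 2 \<Omega>" for i by (rule sobolev_vecD[OF sobolev0_vec_sobolev_vec[OF w0]])
  have u: "(\<lambda>x. u x $ i) \<in> sobolev 1 \<Omega>" for i
    using mixed by (auto simp: mixed_formulation_def intro: sobolev_vecD[OF sobolev0_vec_sobolev_vec])
  have same: "has_weak_deriv \<Omega> is (\<lambda>x. u x $ i) = has_weak_deriv \<Omega> is (\<lambda>x. w x $ i)" for "is" i
    using unique(2)
    by (intro has_weak_deriv_cong_AE sobolev_locally_integrable[OF u] sobolev_locally_integrable[OF w])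
       (auto elim: eventually_mono)
  then have wd: "wd is (\<lambda>x. u x $ i) = wd is (\<lambda>x. w x $ i)" for "is" i
    by (simp add: weak_deriv_def)
  have strain: "\<epsilon> u = \<epsilon> w" by (simp add: strain_def wd)
  then have stress: "stress \<Omega> \<mu> lam u = stress \<Omega> \<mu> lam w" by (simp add: stress_eq_elasticity2[abs_def])
  have "(\<lambda>x. u x $ i) \<in> sobolev0 2 \<Omega>" for i
  proof -
    have "(\<lambda>x. u x $ i) \<in> sobolev 2 \<Omega>" using w[of i] by (simp add: sobolev_def same)
    moreover have "(\<lambda>x. w x $ i) \<in> sobolev0 2 \<Omega>" using w0 by (simp add: sobolev0_vec_def)
    ultimately show ?thesis by (simp add: sobolev0_iff_limit sobolev_tendsto_def wd)
  qed
  then have "weak_formulation \<Omega> \<mu> lam \<iota> f u"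
    using weak by (simp add: weak_formulation_def sobolev0_vec_def stress)
  then show ?thesis using unique(1) by (simp add: stress)
qed

section \<open>The boundary value problem\<close>

text \<open>
  One of the two derivatives in each \<open>\<partial>\<^sub>k \<partial>\<^sub>k\<close> is moved to the stress, which has weak first derivatives in
  \<open>L\<^sup>2\<close>. The other one stays on the test function.
\<close>

lemma distr_laplacian_stress:
  assumes u: "u \<in> sobolev_vec 2" and \<phi>: "\<phi> \<in> test_functions \<Omega>"
  shows "distr_laplacian (distr \<Omega> (\<lambda>x. stress \<Omega> \<mu> lam u x $ i $ j)) (pd j \<phi>)
    = - (\<Sum>k\<in>UNIV. ip (\<lambda>x. elasticity3 \<mu> lam (strain_grad u x) $ i $ j $ k) (pd k (pd j \<phi>)))"
proof -
  have "distr \<Omega> (\<lambda>x. stress \<Omega> \<mu> lam u x $ i $ j) (pd k (pd k (pd j \<phi>)))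
    = - distr \<Omega> (\<lambda>x. elasticity3 \<mu> lam (strain_grad u x) $ i $ j $ k) (pd k (pd j \<phi>))" for k
  proof -
    have "\<forall>\<psi>\<in>test_functions \<Omega>. - distr \<Omega> (\<lambda>x. stress \<Omega> \<mu> lam u x $ i $ j) (pd k \<psi>)
      = distr \<Omega> (\<lambda>x. elasticity3 \<mu> lam (strain_grad u x) $ i $ j $ k) \<psi>"
      using has_weak_deriv_stress[OF u, of k \<mu> lam i j] by (simp add: has_weak_deriv_iff)
    from bspec[OF this test_function_partial[OF test_function_partial[OF \<phi>]], of k j] show ?thesis by simp
  qed
  then show ?thesis by (simp add: distr_laplacian_def distr_partial_def distr_eq_L2_inner sum_negf)
qed

lemma strain_gradient_operator:
  assumes u: "u \<in> sobolev_vec 2" and \<phi>: "\<phi> \<in> test_functions \<Omega>"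
  shows "- distr_div2 (\<lambda>i j \<psi>. distr \<Omega> (\<lambda>x. stress \<Omega> \<mu> lam u x $ i $ j) \<psi>
       - \<iota>\<^sup>2 * distr_laplacian (distr \<Omega> (\<lambda>x. stress \<Omega> \<mu> lam u x $ i $ j)) \<psi>) i \<phi>
    = \<iota>\<^sup>2 * div_div \<Omega> (\<lambda>x. elasticity3 \<mu> lam (strain_grad u x)) i \<phi>
      + (\<Sum>j\<in>UNIV. ip (\<lambda>x. stress \<Omega> \<mu> lam u x $ i $ j) (pd j \<phi>))"
  by (simp add: distr_div2_def distr_partial_def distr_laplacian_stress[OF u \<phi>] div_div_eq distr_eq_L2_inner
      sum_negf sum_subtractf sum.distrib sum_distrib_left)

text \<open>
  For test fields the weak formulation is the sum over \<open>i\<close> of the components of the distributional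
  equation. Single components are recovered by fields with one nonzero component.
\<close>

lemma energy_test:
  assumes u: "u \<in> sobolev_vec 2" and \<phi>: "\<phi> \<in> test_vector_fields \<Omega>"
  shows "energy \<mu> lam \<iota> u \<phi> = (\<Sum>i\<in>UNIV.
     - distr_div2 (\<lambda>i j \<psi>. distr \<Omega> (\<lambda>x. stress \<Omega> \<mu> lam u x $ i $ j) \<psi>
       - \<iota>\<^sup>2 * distr_laplacian (distr \<Omega> (\<lambda>x. stress \<Omega> \<mu> lam u x $ i $ j)) \<psi>) i (\<lambda>x. \<phi> x $ i))"
proof -
  have t: "(\<lambda>x. \<phi> x $ i) \<in> test_functions \<Omega>" for i using \<phi> by (simp add: test_vector_fields_def)
  have u1: "u \<in> sobolev_vec 1" by (rule sobolev_vec_mono[OF _ u]) simp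
  have 1: "ip (\<lambda>x. elasticity3 \<mu> lam (strain_grad u x)) (strain_grad \<phi>)
     = (\<Sum>i\<in>UNIV. div_div \<Omega> (\<lambda>x. elasticity3 \<mu> lam (strain_grad u x)) i (\<lambda>x. \<phi> x $ i))"
    by (intro L2_inner_symmetric_test_strain_grad \<phi> L2_elasticity3 strain_grad_L2 u AE_I2 allI
        elasticity3_strain_grad_symmetric)
  have 2: "ip (stress \<Omega> \<mu> lam u) (\<epsilon> \<phi>)
     = (\<Sum>i\<in>UNIV. \<Sum>j\<in>UNIV. ip (\<lambda>x. stress \<Omega> \<mu> lam u x $ i $ j) (pd j (\<lambda>x. \<phi> x $ i)))"
    by (intro L2_inner_symmetric_test_strain \<phi> stress_L2 u1 stress_symmetric)
  show ?thesis
    unfolding strain_gradient_operator[OF u t] sum.distrib sum_distrib_left[symmetric] 1[symmetric] 2[symmetric]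
    by (simp add: energy_def stress_eq_elasticity2[abs_def])
qed

lemma weak_iff_strain_gradient_problem:
  assumes f: "f \<in> L2_space \<Omega>"
  shows "weak_formulation \<Omega> \<mu> lam \<iota> f u \<longleftrightarrow> strain_gradient_problem \<Omega> \<mu> lam \<iota> f u"
proof (cases "u \<in> sobolev0_vec 2 \<Omega>")
  case False
  then show ?thesis by (simp add: weak_formulation_def strain_gradient_problem_def)
next
  case True
  note u = sobolev0_vec_sobolev_vec[OF True]
  define R where "R i \<phi> = - distr_div2 (\<lambda>i j \<psi>. distr \<Omega> (\<lambda>x. stress \<Omega> \<mu> lam u x $ i $ j) \<psi>
       - \<iota>\<^sup>2 * distr_laplacian (distr \<Omega> (\<lambda>x. stress \<Omega> \<mu> lam u x $ i $ j)) \<psi>) i \<phi>" for i \<phi>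
  have R0: "R i (\<lambda>x. 0) = 0" for i
    unfolding R_def strain_gradient_operator[OF u test_function_zero]
    by (simp add: div_div_eq classical_partial_const L2_inner_def)
  have e: "energy \<mu> lam \<iota> u \<phi> = (\<Sum>i\<in>UNIV. R i (\<lambda>x. \<phi> x $ i))" if "\<phi> \<in> test_vector_fields \<Omega>" for \<phi>
    unfolding R_def by (rule energy_test[OF u that])
  have fe: "ip f \<phi> = (\<Sum>i\<in>UNIV. distr \<Omega> (\<lambda>x. f x $ i) (\<lambda>x. \<phi> x $ i))" if "\<phi> \<in> test_vector_fields \<Omega>" for \<phi>
    using L2_inner_vec[OF f sobolev_vec_L2[OF test_vec_sobolev_vec[OF that]]] by (simp add: distr_eq_L2_inner)
  have "(\<forall>\<phi>\<in>test_vector_fields \<Omega>. energy \<mu> lam \<iota> u \<phi> = ip f \<phi>)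
    \<longleftrightarrow> (\<forall>i. \<forall>\<phi>\<in>test_functions \<Omega>. R i \<phi> = distr \<Omega> (\<lambda>x. f x $ i) \<phi>)"
  proof (intro iffI allI ballI)
    fix i \<phi> assume *: "\<forall>\<phi>\<in>test_vector_fields \<Omega>. energy \<mu> lam \<iota> u \<phi> = ip f \<phi>" and \<phi>: "\<phi> \<in> test_functions \<Omega>"
    define \<psi> :: "'n vector_field" where "\<psi> x = (\<chi> k. if k = i then \<phi> x else 0)" for x
    have comp: "(\<lambda>x. \<psi> x $ k) = (if k = i then \<phi> else (\<lambda>x. 0))" for k by (simp add: \<psi>_def fun_eq_iff)
    have \<psi>: "\<psi> \<in> test_vector_fields \<Omega>" by (simp add: test_vector_fields_def comp \<phi> test_function_zero)
    have d0: "distr \<Omega> g (\<lambda>x. 0) = 0" for g by (simp add: distr_def)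
    have "(\<Sum>k\<in>UNIV. R k (\<lambda>x. \<psi> x $ k)) = (\<Sum>k\<in>UNIV. distr \<Omega> (\<lambda>x. f x $ k) (\<lambda>x. \<psi> x $ k))"
      using *[rule_format, OF \<psi>] by (simp only: e[OF \<psi>] fe[OF \<psi>])
    moreover have "R k (\<lambda>x. \<psi> x $ k) = (if k = i then R i \<phi> else 0)" for k by (simp add: comp R0)
    moreover have "distr \<Omega> (\<lambda>x. f x $ k) (\<lambda>x. \<psi> x $ k) = (if k = i then distr \<Omega> (\<lambda>x. f x $ i) \<phi> else 0)" for k
      by (simp add: comp d0)
    ultimately show "R i \<phi> = distr \<Omega> (\<lambda>x. f x $ i) \<phi>" by simp
  next
    fix \<phi> assume "\<forall>i. \<forall>\<phi>\<in>test_functions \<Omega>. R i \<phi> = distr \<Omega> (\<lambda>x. f x $ i) \<phi>" and \<phi>: "\<phi> \<in> test_vector_fields \<Omega>"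
    then show "energy \<mu> lam \<iota> u \<phi> = ip f \<phi>" by (simp add: e[OF \<phi>] fe[OF \<phi>] test_vector_fields_def)
  qed
  then show ?thesis
    using True by (simp add: weak_formulation_iff[OF f] strain_gradient_problem_def R_def)
qed

end

theorem theorem2p4:
  fixes \<Omega> :: "(real ^ 'n) set" and \<mu> lam \<iota> :: real
    and f u :: "real ^ 'n \<Rightarrow> real ^ 'n" and \<Phi> :: "real ^ 'n \<Rightarrow> real ^ 'n ^ 'n ^ 'n"
  assumes "CARD('n) \<ge> 2"
    and "bounded_polytopal_domain \<Omega>"
    and "\<mu> > 0" and "lam > 0" and "0 < \<iota>" and "\<iota> \<le> 1"
    and "f \<in> L2_space \<Omega>"
  shows "(mixed_formulation \<Omega> \<mu> lam \<iota> f \<Phi> u \<longleftrightarrow>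
            weak_formulation \<Omega> \<mu> lam \<iota> f u \<and>
            (AE x in lebesgue_on \<Omega>. \<Phi> x = \<iota>\<^sup>2 *\<^sub>R grad \<Omega> (stress \<Omega> \<mu> lam u) x))
       \<and> ((\<exists>\<Theta>. mixed_formulation \<Omega> \<mu> lam \<iota> f \<Theta> u) \<longleftrightarrow> weak_formulation \<Omega> \<mu> lam \<iota> f u)
       \<and> (weak_formulation \<Omega> \<mu> lam \<iota> f u \<longleftrightarrow> strain_gradient_problem \<Omega> \<mu> lam \<iota> f u)"
proof -
  interpret bounded_open \<Omega>
    using assms(2) by unfold_locales (simp_all add: bounded_polytopal_domain_def)
  have iff: "mixed_formulation \<Omega> \<mu> lam \<iota> f \<Theta> u \<longleftrightarrow> weak_formulation \<Omega> \<mu> lam \<iota> f u \<and>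
      (AE x in lebesgue_on \<Omega>. \<Theta> x = \<iota>\<^sup>2 *\<^sub>R grad \<Omega> (stress \<Omega> \<mu> lam u) x)" for \<Theta>
    using mixed_imp_weak[OF assms(3-7)] weak_imp_mixed[OF assms(3-5,7)] by blast
  moreover have "(\<exists>\<Theta>. mixed_formulation \<Omega> \<mu> lam \<iota> f \<Theta> u) \<longleftrightarrow> weak_formulation \<Omega> \<mu> lam \<iota> f u"
    unfolding iff by (auto intro!: exI[of _ "\<lambda>x. \<iota>\<^sup>2 *\<^sub>R grad \<Omega> (stress \<Omega> \<mu> lam u) x"])
  ultimately show ?thesis using weak_iff_strain_gradient_problem[OF assms(7)] by blast
qed

end
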